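(* Let $(\mathcal M,g)$ be a semi-Riemannian manifold, let $P,Q\subset\mathcal M$ be smooth submanifolds, and let $\gamma:[a,b]\to\mathcal M$ be a non-constant geodesic such that $\gamma(a)\in P$, $\dot\gamma(a)\in T_{\gamma(a)}P^\perp$, $\gamma(b)\in Q$ and $\dot\gamma(b)\in T_{\gamma(b)}Q^\perp$. Assume that $T_{\gamma(b)}Q\subset\mathcal J[b]$, where $\mathcal J[b]=\{J(b): J \text{ is a } P\text{-Jacobi field along }\gamma\}$. Let $\mathcal V$ be a vector subspace of $\mathcal H^{(P,Q)}$ that contains the space $\mathcal J^Q$ of all $P$-Jacobi fields along $\gamma$ belonging to $\mathcal H^{(P,Q)}$. Then $$\mathrm{ind}\big(I^{(P,Q)},\mathcal V\big)=\mathrm{ind}\big(I^P,\mathcal H^P\cap\mathcal V\big)+\mathrm{ind}\big(\mathcal A,\mathcal J^Q\big),$$ as an equality in $\mathbb N\cup\{+\infty\}$, where $\mathcal A$ is the restriction of $I^{(P,Q)}$ to $\mathcal J^Q$, that is, $\mathcal A(J_1,J_2)=\mathcal S^Q_{\dot\gamma(b)}(J_1(b),J_2(b))+g(J_1'(b),J_2(b))$ for $J_1,J_2\in\mathcal J^Q$.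
   Context: A semi-Riemannian metric $g$ is a smooth nondegenerate symmetric $(0,2)$-tensor of constant index; $\nabla$ is its Levi-Civita connection and $R(X,Y)=\nabla_X\nabla_Y-\nabla_Y\nabla_X-\nabla_{[X,Y]}$ its curvature tensor. Orthogonality $\perp$ is with respect to $g$. For a submanifold $P$ (not assumed nondegenerate), $p\in P$ and $n\in T_pP^\perp$, the second fundamental form in the direction $n$ is the symmetric bilinear form on $T_pP$ given by $\mathcal S^P_n(v_1,v_2)=g(n,\nabla_{v_1}V_2)$, where $V_2$ is any extension of $v_2$ to a vector field tangent to $P$; similarly for $Q$. For a vector field $V$ along $\gamma$, $V'$ denotes its covariant derivative along $\gamma$. Piecewise smooth vector fields are understood to be continuous. $\tilde{\mathcal H}^P$ is the vector space of piecewise smooth vector fields $V$ along $\gamma$ with $V(a)\in T_{\gamma(a)}P$. $\mathcal H^P$ is the subspace of those $V\in\tilde{\mathcal H}^P$ with $g(V,\dot\gamma)\equiv0$ and $V(b)=0$. $\mathcal H^{(P,Q)}$ is the space of piecewise smooth vector fields $V$ along $\gamma$ with $g(V,\dot\gamma)\equiv 0$, $V(a)\in T_{\gamma(a)}P$ and $V(b)\in T_{\gamma(b)}Q$. The symmetric bilinear form $I^P$ on $\tilde{\mathcal H}^P$ is $$I^P(V,W)=\int_a^b\big[g(V',W')+g(R(\dot\gamma,V)\dot\gamma,W)\big]\,dt-\mathcal S^P_{\dot\gamma(a)}(V(a),W(a)),$$ and the symmetric bilinear form $I^{(P,Q)}$ on $\mathcal H^{(P,Q)}$ is $$I^{(P,Q)}(V,W)=I^P(V,W)+\mathcal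 S^Q_{\dot\gamma(b)}(V(b),W(b)).$$ A Jacobi field along $\gamma$ is a smooth vector field $J$ along $\gamma$ with $J''-R(\dot\gamma,J)\dot\gamma=0$. It is a $P$-Jacobi field if in addition $J(a)\in T_{\gamma(a)}P$ and $g(J'(a),w)+\mathcal S^P_{\dot\gamma(a)}(J(a),w)=0$ for all $w\in T_{\gamma(a)}P$. For a symmetric bilinear form $B$ defined on a real vector space containing the subspace $\mathcal K$, $\mathrm{ind}(B,\mathcal K)\in\mathbb N\cup\{+\infty\}$ is the supremum of the dimensions of subspaces of $\mathcal K$ on which $B$ is negative definite. *)

theory Defs
  imports "HOL-Analysis.Analysis" "HOL-Library.Function_Algebras" "HOL-Library.Extended_Nat"
begin

section \<open>Linear algebra: the index of a bilinear form\<close>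

instantiation "fun" :: (type, real_vector) real_vector
begin

definition scaleR_fun :: "real \<Rightarrow> ('a \<Rightarrow> 'b) \<Rightarrow> 'a \<Rightarrow> 'b"
  where "scaleR_fun r f = (\<lambda>x. r *\<^sub>R f x)"

instance
  by standard (auto simp: scaleR_fun_def fun_eq_iff algebra_simps)

end

text \<open>The library's \<^const>\<open>dim\<close> is a natural number with a junk value on infinite-dimensional
  spaces; \<open>edim\<close> is the dimension with values in \<open>\<nat> \<union> {\<infinity>}\<close>.\<close>

definition edim :: "'v::real_vector set \<Rightarrow> enat"
  where "edim W = (if \<exists>S. finite S \<and> W \<subseteq> span S then enat (dim W) else \<infinity>)"

definition ind :: "('v::real_vector \<Rightarrow> 'v \<Rightarrow> real) \<Rightarrow> 'v set \<Rightarrow> enat"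
  where "ind B K = (SUP W \<in> {W. subspace W \<and> W \<subseteq> K \<and> (\<forall>w\<in>W. w \<noteq> 0 \<longrightarrow> B w w < 0)}. edim W)"


section \<open>Smooth maps between Euclidean spaces\<close>

text \<open>Meant for two kinds of domain \<open>S\<close>: open sets, and (for functions of a real variable) sets
  that are relatively open in a nondegenerate interval, with one-sided derivatives at the end
  points. In both cases the derivative within \<open>S\<close> is unique.\<close>

primrec Ck_on :: "nat \<Rightarrow> 'a::real_normed_vector set \<Rightarrow> ('a \<Rightarrow> 'b::real_normed_vector) \<Rightarrow> bool" where
  "Ck_on 0 S f = continuous_on S f"
| "Ck_on (Suc k) S f =
     ((\<forall>x\<in>S. f differentiable (at x within S)) \<and>
      (\<forall>v. Ck_on k S (\<lambda>x. frechet_derivative f (at x within S) v)))"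

definition smooth_on :: "'a::real_normed_vector set \<Rightarrow> ('a \<Rightarrow> 'b::real_normed_vector) \<Rightarrow> bool"
  where "smooth_on S f \<longleftrightarrow> (\<forall>k. Ck_on k S f)"


section \<open>Smooth manifolds\<close>

text \<open>The manifold is the whole type \<open>'m\<close>, modelled on the Euclidean space \<open>'e\<close>. A chart is a pair
  of a domain and a coordinate map; the values of the coordinate map off the domain are irrelevant.\<close>

type_synonym ('m, 'e) chart = "'m set \<times> ('m \<Rightarrow> 'e)"

abbreviation cdom :: "('m, 'e) chart \<Rightarrow> 'm set" where "cdom c \<equiv> fst c"
abbreviation cmap :: "('m, 'e) chart \<Rightarrow> 'm \<Rightarrow> 'e" where "cmap c \<equiv> snd c"

definition cinv :: "('m, 'e) chart \<Rightarrow> 'e \<Rightarrow> 'm"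
  where "cinv c = inv_into (cdom c) (cmap c)"

definition is_chart :: "('m::topological_space, 'e::euclidean_space) chart \<Rightarrow> bool"
  where "is_chart c \<longleftrightarrow> open (cdom c) \<and> open (cmap c ` cdom c) \<and>
    homeomorphism (cdom c) (cmap c ` cdom c) (cmap c) (cinv c)"

definition compatible ::
    "('m::topological_space, 'e::euclidean_space) chart \<Rightarrow> ('m, 'e) chart \<Rightarrow> bool"
  where "compatible c d \<longleftrightarrow>
    smooth_on (cmap c ` (cdom c \<inter> cdom d)) (cmap d \<circ> cinv c) \<and>
    smooth_on (cmap d ` (cdom c \<inter> cdom d)) (cmap c \<circ> cinv d)"

text \<open>The topological requirements on a manifold (Hausdorff, second countable) are expressed by
  the sort of the type. The atlas need not be maximal.\<close>

definition smooth_atlas ::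
    "('m::{t2_space,second_countable_topology}, 'e::euclidean_space) chart set \<Rightarrow> bool"
  where "smooth_atlas A \<longleftrightarrow> (\<forall>c\<in>A. is_chart c) \<and> (\<Union>c\<in>A. cdom c) = UNIV \<and>
    (\<forall>c\<in>A. \<forall>d\<in>A. compatible c d)"

definition maximal_atlas ::
    "('m::topological_space, 'e::euclidean_space) chart set \<Rightarrow> ('m, 'e) chart set"
  where "maximal_atlas A = {c. is_chart c \<and> (\<forall>d\<in>A. compatible c d)}"

text \<open>Tangent vectors: an atlas provides a preferred chart at every point, and a vector of
  \<open>T\<^sub>pM\<close> is represented by its coordinates in the preferred chart at \<open>p\<close>. Thus every tangent
  space is a copy of \<open>'e\<close>, and a vector field is a function \<open>'m \<Rightarrow> 'e\<close>. As the preferred chart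
  jumps from point to point, smoothness of fields is never tested on this representation directly,
  but on the coordinates \<open>coord A c p v\<close> with respect to a fixed chart \<open>c\<close>, obtained by applying
  the Jacobian of the change of coordinates.\<close>

definition chart_at :: "('m, 'e) chart set \<Rightarrow> 'm \<Rightarrow> ('m, 'e) chart"
  where "chart_at A p = (SOME c. c \<in> A \<and> p \<in> cdom c)"

definition coord ::
    "('m, 'e::euclidean_space) chart set \<Rightarrow> ('m, 'e) chart \<Rightarrow> 'm \<Rightarrow> 'e \<Rightarrow> 'e"
  where "coord A c p v =
    frechet_derivative (cmap c \<circ> cinv (chart_at A p)) (at (cmap (chart_at A p) p)) v"

text \<open>The vector field on \<open>cdom c\<close> whose coordinates in \<open>c\<close> are constantly \<open>u\<close>.\<close>

definition coord_field ::
    "('m, 'e::euclidean_space) chart set \<Rightarrow> ('m, 'e) chart \<Rightarrow> 'e \<Rightarrow> 'm \<Rightarrow> 'e"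
  where "coord_field A c u p =
    frechet_derivative (cmap (chart_at A p) \<circ> cinv c) (at (cmap c p)) u"

text \<open>The derivative \<open>v(f)\<close> of a function \<open>f\<close> in the direction \<open>v \<in> T\<^sub>pM\<close>.\<close>

definition dirderiv ::
    "('m, 'e::euclidean_space) chart set \<Rightarrow> 'm \<Rightarrow> 'e \<Rightarrow> ('m \<Rightarrow> real) \<Rightarrow> real"
  where "dirderiv A p v f =
    frechet_derivative (f \<circ> cinv (chart_at A p)) (at (cmap (chart_at A p) p)) v"

definition smooth_fun_on ::
    "('m::topological_space, 'e::euclidean_space) chart set \<Rightarrow> 'm set \<Rightarrow> ('m \<Rightarrow> real) \<Rightarrow> bool"
  where "smooth_fun_on A U f \<longleftrightarrow> open U \<and>
    (\<forall>c\<in>A. smooth_on (cmap c ` (cdom c \<inter> U)) (f \<circ> cinv c))"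

definition smooth_field_on ::
    "('m::topological_space, 'e::euclidean_space) chart set \<Rightarrow> 'm set \<Rightarrow> ('m \<Rightarrow> 'e) \<Rightarrow> bool"
  where "smooth_field_on A U X \<longleftrightarrow> open U \<and>
    (\<forall>c\<in>A. smooth_on (cmap c ` (cdom c \<inter> U)) (\<lambda>x. coord A c (cinv c x) (X (cinv c x))))"

definition smooth_fun_near ::
    "('m::topological_space, 'e::euclidean_space) chart set \<Rightarrow> 'm \<Rightarrow> ('m \<Rightarrow> real) \<Rightarrow> bool"
  where "smooth_fun_near A p f \<longleftrightarrow> (\<exists>U. p \<in> U \<and> smooth_fun_on A U f)"

definition smooth_field_near ::
    "('m::topological_space, 'e::euclidean_space) chart set \<Rightarrow> 'm \<Rightarrow> ('m \<Rightarrow> 'e) \<Rightarrow> bool"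
  where "smooth_field_near A p X \<longleftrightarrow> (\<exists>U. p \<in> U \<and> smooth_field_on A U X)"

definition lie_bracket ::
    "('m::topological_space, 'e::euclidean_space) chart set \<Rightarrow> ('m \<Rightarrow> 'e) \<Rightarrow> ('m \<Rightarrow> 'e) \<Rightarrow> 'm \<Rightarrow> 'e"
  where "lie_bracket A X Y p = (THE w. \<forall>f. smooth_fun_near A p f \<longrightarrow>
    dirderiv A p w f = dirderiv A p (X p) (\<lambda>q. dirderiv A q (Y q) f)
                     - dirderiv A p (Y p) (\<lambda>q. dirderiv A q (X q) f))"


section \<open>Semi-Riemannian metrics, the Levi-Civita connection and curvature\<close>

definition semi_riemannian_metric ::
    "('m::topological_space, 'e::euclidean_space) chart set \<Rightarrow> ('m \<Rightarrow> 'e \<Rightarrow> 'e \<Rightarrow> real) \<Rightarrow> bool"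
  where "semi_riemannian_metric A g \<longleftrightarrow>
    (\<forall>p. bilinear (g p) \<and> (\<forall>v w. g p v w = g p w v) \<and>
         (\<forall>v. (\<forall>w. g p v w = 0) \<longrightarrow> v = 0)) \<and>
    (\<forall>c\<in>A. \<forall>u v. smooth_on (cmap c ` cdom c)
       (\<lambda>x. g (cinv c x) (coord_field A c u (cinv c x)) (coord_field A c v (cinv c x)))) \<and>
    (\<exists>\<nu>::nat. \<forall>p. ind (g p) UNIV = enat \<nu>)"

text \<open>A connection \<open>D\<close> is given by its values \<open>D p v Y = \<nabla>\<^sub>v Y\<close> for \<open>v \<in> T\<^sub>pM\<close> and vector fields \<open>Y\<close>
  defined and smooth near \<open>p\<close>. That \<open>D p v Y\<close> only depends on \<open>Y\<close> near \<open>p\<close> follows from the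
  Leibniz rule, because the indicator function of a neighbourhood of \<open>p\<close> is smooth near \<open>p\<close>.\<close>

definition affine_connection ::
    "('m::topological_space, 'e::euclidean_space) chart set \<Rightarrow> ('m \<Rightarrow> 'e \<Rightarrow> ('m \<Rightarrow> 'e) \<Rightarrow> 'e) \<Rightarrow> bool"
  where "affine_connection A D \<longleftrightarrow>
    (\<forall>p Y. smooth_field_near A p Y \<longrightarrow> linear (\<lambda>v. D p v Y)) \<and>
    (\<forall>p v Y Z. smooth_field_near A p Y \<and> smooth_field_near A p Z \<longrightarrow>
       D p v (\<lambda>q. Y q + Z q) = D p v Y + D p v Z) \<and>
    (\<forall>p v f Y. smooth_fun_near A p f \<and> smooth_field_near A p Y \<longrightarrow>
       D p v (\<lambda>q. f q *\<^sub>R Y q) = dirderiv A p v f *\<^sub>R Y p + f p *\<^sub>R D p v Y) \<and>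
    (\<forall>U X Y. smooth_field_on A U X \<and> smooth_field_on A U Y \<longrightarrow>
       smooth_field_on A U (\<lambda>p. D p (X p) Y))"

definition levi_civita ::
    "('m::topological_space, 'e::euclidean_space) chart set \<Rightarrow> ('m \<Rightarrow> 'e \<Rightarrow> 'e \<Rightarrow> real) \<Rightarrow>
     ('m \<Rightarrow> 'e \<Rightarrow> ('m \<Rightarrow> 'e) \<Rightarrow> 'e) \<Rightarrow> bool"
  where "levi_civita A g D \<longleftrightarrow> affine_connection A D \<and>
    (\<forall>p X Y. smooth_field_near A p X \<and> smooth_field_near A p Y \<longrightarrow>
       D p (X p) Y - D p (Y p) X = lie_bracket A X Y p) \<and>
    (\<forall>p v Y Z. smooth_field_near A p Y \<and> smooth_field_near A p Z \<longrightarrow>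
       dirderiv A p v (\<lambda>q. g q (Y q) (Z q)) = g p (D p v Y) (Z p) + g p (Y p) (D p v Z))"

text \<open>The curvature tensor \<open>R(x,y)z\<close> at \<open>p\<close>, for the sign convention
  \<open>R(X,Y) = \<nabla>\<^sub>X\<nabla>\<^sub>Y - \<nabla>\<^sub>Y\<nabla>\<^sub>X - \<nabla>\<^bsub>[X,Y]\<^esub>\<close>: the common value of the right-hand side for all
  smooth local extensions of \<open>x\<close>, \<open>y\<close>, \<open>z\<close>.\<close>

definition curvature ::
    "('m::topological_space, 'e::euclidean_space) chart set \<Rightarrow> ('m \<Rightarrow> 'e \<Rightarrow> ('m \<Rightarrow> 'e) \<Rightarrow> 'e) \<Rightarrow>
     'm \<Rightarrow> 'e \<Rightarrow> 'e \<Rightarrow> 'e \<Rightarrow> 'e"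
  where "curvature A D p x y z = (THE r. \<forall>X Y Z.
    smooth_field_near A p X \<and> smooth_field_near A p Y \<and> smooth_field_near A p Z \<and>
    X p = x \<and> Y p = y \<and> Z p = z \<longrightarrow>
    D p (X p) (\<lambda>q. D q (Y q) Z) - D p (Y p) (\<lambda>q. D q (X q) Z) - D p (lie_bracket A X Y p) Z = r)"


section \<open>Curves and vector fields along curves\<close>

definition smooth_curve ::
    "('m::topological_space, 'e::euclidean_space) chart set \<Rightarrow> real set \<Rightarrow> (real \<Rightarrow> 'm) \<Rightarrow> bool"
  where "smooth_curve A I \<gamma> \<longleftrightarrow> continuous_on I \<gamma> \<and>
    (\<forall>c\<in>A. smooth_on {t \<in> I. \<gamma> t \<in> cdom c} (cmap c \<circ> \<gamma>))"

definition velocity ::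
    "('m, 'e::euclidean_space) chart set \<Rightarrow> real set \<Rightarrow> (real \<Rightarrow> 'm) \<Rightarrow> real \<Rightarrow> 'e"
  where "velocity A I \<gamma> t = vector_derivative (cmap (chart_at A (\<gamma> t)) \<circ> \<gamma>) (at t within I)"

definition continuous_along ::
    "('m, 'e::euclidean_space) chart set \<Rightarrow> (real \<Rightarrow> 'm) \<Rightarrow> real set \<Rightarrow> (real \<Rightarrow> 'e) \<Rightarrow> bool"
  where "continuous_along A \<gamma> I V \<longleftrightarrow>
    (\<forall>c\<in>A. continuous_on {t \<in> I. \<gamma> t \<in> cdom c} (\<lambda>t. coord A c (\<gamma> t) (V t)))"

definition smooth_along ::
    "('m, 'e::euclidean_space) chart set \<Rightarrow> (real \<Rightarrow> 'm) \<Rightarrow> real set \<Rightarrow> (real \<Rightarrow> 'e) \<Rightarrow> bool"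
  where "smooth_along A \<gamma> I V \<longleftrightarrow>
    (\<forall>c\<in>A. smooth_on {t \<in> I. \<gamma> t \<in> cdom c} (\<lambda>t. coord A c (\<gamma> t) (V t)))"

text \<open>A field along \<open>\<gamma> : [a,b] \<rightarrow> M\<close> is a function on \<open>real\<close> vanishing outside \<open>[a,b]\<close>, so that
  fields that agree on \<open>[a,b]\<close> are equal.\<close>

definition smooth_fields ::
    "('m, 'e::euclidean_space) chart set \<Rightarrow> real \<Rightarrow> real \<Rightarrow> (real \<Rightarrow> 'm) \<Rightarrow> (real \<Rightarrow> 'e) set"
  where "smooth_fields A a b \<gamma> =
    {V. (\<forall>t. t \<notin> {a..b} \<longrightarrow> V t = 0) \<and> smooth_along A \<gamma> {a..b} V}"

definition piecewise_smooth_fields ::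
    "('m, 'e::euclidean_space) chart set \<Rightarrow> real \<Rightarrow> real \<Rightarrow> (real \<Rightarrow> 'm) \<Rightarrow> (real \<Rightarrow> 'e) set"
  where "piecewise_smooth_fields A a b \<gamma> =
    {V. (\<forall>t. t \<notin> {a..b} \<longrightarrow> V t = 0) \<and> continuous_along A \<gamma> {a..b} V \<and>
        (\<exists>T. finite T \<and> {a, b} \<subseteq> T \<and> T \<subseteq> {a..b} \<and>
           (\<forall>s\<in>T. \<forall>u\<in>T. s < u \<and> T \<inter> {s<..<u} = {} \<longrightarrow> smooth_along A \<gamma> {s..u} V))}"

text \<open>The covariant derivative \<open>V'(t)\<close> in the preferred chart \<open>c\<close> at \<open>\<gamma> t\<close>: the derivative of the
  coordinates plus the Christoffel term \<open>\<Gamma>(\<gamma>'(t), V(t))\<close>, which is the derivative in the direction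
  \<open>\<gamma>'(t)\<close> of the field with constant coordinates \<open>V(t)\<close> in \<open>c\<close>. At a break point of a piecewise
  smooth \<open>V\<close> the value is meaningless; it only enters under the integral sign there.\<close>

definition covd ::
    "('m, 'e::euclidean_space) chart set \<Rightarrow> ('m \<Rightarrow> 'e \<Rightarrow> ('m \<Rightarrow> 'e) \<Rightarrow> 'e) \<Rightarrow>
     real \<Rightarrow> real \<Rightarrow> (real \<Rightarrow> 'm) \<Rightarrow> (real \<Rightarrow> 'e) \<Rightarrow> real \<Rightarrow> 'e"
  where "covd A D a b \<gamma> V t =
    vector_derivative (\<lambda>s. coord A (chart_at A (\<gamma> t)) (\<gamma> s) (V s)) (at t within {a..b}) +
    D (\<gamma> t) (velocity A {a..b} \<gamma> t) (coord_field A (chart_at A (\<gamma> t)) (V t))"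

definition geodesic ::
    "('m::topological_space, 'e::euclidean_space) chart set \<Rightarrow> ('m \<Rightarrow> 'e \<Rightarrow> ('m \<Rightarrow> 'e) \<Rightarrow> 'e) \<Rightarrow>
     real \<Rightarrow> real \<Rightarrow> (real \<Rightarrow> 'm) \<Rightarrow> bool"
  where "geodesic A D a b \<gamma> \<longleftrightarrow> smooth_curve A {a..b} \<gamma> \<and>
    (\<forall>t\<in>{a..b}. covd A D a b \<gamma> (velocity A {a..b} \<gamma>) t = 0)"


section \<open>Submanifolds and the second fundamental form\<close>

definition submanifold ::
    "('m::topological_space, 'e::euclidean_space) chart set \<Rightarrow> 'm set \<Rightarrow> bool"
  where "submanifold A P \<longleftrightarrow> (\<exists>k. \<forall>p\<in>P. \<exists>c\<in>maximal_atlas A. \<exists>S. subspace S \<and> dim S = k \<and>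
    p \<in> cdom c \<and> cmap c ` (cdom c \<inter> P) = cmap c ` cdom c \<inter> S)"

text \<open>The tangent space consists of the velocities of smooth curves in \<open>P\<close>.\<close>

definition tangent_space ::
    "('m::topological_space, 'e::euclidean_space) chart set \<Rightarrow> 'm set \<Rightarrow> 'm \<Rightarrow> 'e set"
  where "tangent_space A P p = {velocity A {-\<epsilon><..<\<epsilon>} \<alpha> 0 |\<epsilon> \<alpha>.
    \<epsilon> > 0 \<and> smooth_curve A {-\<epsilon><..<\<epsilon>} \<alpha> \<and> \<alpha> ` {-\<epsilon><..<\<epsilon>} \<subseteq> P \<and> \<alpha> 0 = p}"

definition tangent_extension ::
    "('m::topological_space, 'e::euclidean_space) chart set \<Rightarrow> 'm set \<Rightarrow> 'm \<Rightarrow> 'e \<Rightarrow> ('m \<Rightarrow> 'e) \<Rightarrow> bool"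
  where "tangent_extension A P p v V \<longleftrightarrow> V p = v \<and>
    (\<exists>U. p \<in> U \<and> smooth_field_on A U V \<and> (\<forall>q \<in> P \<inter> U. V q \<in> tangent_space A P q))"

text \<open>\<open>S\<^sup>P\<^sub>n(v\<^sub>1,v\<^sub>2) = g(n, \<nabla>\<^bsub>v\<^sub>1\<^esub> V\<^sub>2)\<close>, the common value for all extensions \<open>V\<^sub>2\<close> of \<open>v\<^sub>2\<close> tangent to \<open>P\<close>.\<close>

definition second_ff ::
    "('m::topological_space, 'e::euclidean_space) chart set \<Rightarrow> ('m \<Rightarrow> 'e \<Rightarrow> 'e \<Rightarrow> real) \<Rightarrow>
     ('m \<Rightarrow> 'e \<Rightarrow> ('m \<Rightarrow> 'e) \<Rightarrow> 'e) \<Rightarrow> 'm set \<Rightarrow> 'm \<Rightarrow> 'e \<Rightarrow> 'e \<Rightarrow> 'e \<Rightarrow> real"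
  where "second_ff A g D P p n v1 v2 =
    (THE r. \<forall>V2. tangent_extension A P p v2 V2 \<longrightarrow> g p n (D p v1 V2) = r)"


section \<open>Index forms and Jacobi fields\<close>

definition H_tilde ::
    "('m::topological_space, 'e::euclidean_space) chart set \<Rightarrow> real \<Rightarrow> real \<Rightarrow> (real \<Rightarrow> 'm) \<Rightarrow>
     'm set \<Rightarrow> (real \<Rightarrow> 'e) set"
  where "H_tilde A a b \<gamma> P =
    {V \<in> piecewise_smooth_fields A a b \<gamma>. V a \<in> tangent_space A P (\<gamma> a)}"

definition H_P ::
    "('m::topological_space, 'e::euclidean_space) chart set \<Rightarrow> ('m \<Rightarrow> 'e \<Rightarrow> 'e \<Rightarrow> real) \<Rightarrow>
     real \<Rightarrow> real \<Rightarrow> (real \<Rightarrow> 'm) \<Rightarrow> 'm set \<Rightarrow> (real \<Rightarrow> 'e) set"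
  where "H_P A g a b \<gamma> P =
    {V \<in> H_tilde A a b \<gamma> P. (\<forall>t\<in>{a..b}. g (\<gamma> t) (V t) (velocity A {a..b} \<gamma> t) = 0) \<and> V b = 0}"

definition H_PQ ::
    "('m::topological_space, 'e::euclidean_space) chart set \<Rightarrow> ('m \<Rightarrow> 'e \<Rightarrow> 'e \<Rightarrow> real) \<Rightarrow>
     real \<Rightarrow> real \<Rightarrow> (real \<Rightarrow> 'm) \<Rightarrow> 'm set \<Rightarrow> 'm set \<Rightarrow> (real \<Rightarrow> 'e) set"
  where "H_PQ A g a b \<gamma> P Q =
    {V \<in> piecewise_smooth_fields A a b \<gamma>.
       (\<forall>t\<in>{a..b}. g (\<gamma> t) (V t) (velocity A {a..b} \<gamma> t) = 0) \<and>
       V a \<in> tangent_space A P (\<gamma> a) \<and> V b \<in> tangent_space A Q (\<gamma> b)}"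

definition index_form_P ::
    "('m::topological_space, 'e::euclidean_space) chart set \<Rightarrow> ('m \<Rightarrow> 'e \<Rightarrow> 'e \<Rightarrow> real) \<Rightarrow>
     ('m \<Rightarrow> 'e \<Rightarrow> ('m \<Rightarrow> 'e) \<Rightarrow> 'e) \<Rightarrow> real \<Rightarrow> real \<Rightarrow> (real \<Rightarrow> 'm) \<Rightarrow> 'm set \<Rightarrow>
     (real \<Rightarrow> 'e) \<Rightarrow> (real \<Rightarrow> 'e) \<Rightarrow> real"
  where "index_form_P A g D a b \<gamma> P V W =
    integral {a..b} (\<lambda>t.
        g (\<gamma> t) (covd A D a b \<gamma> V t) (covd A D a b \<gamma> W t)
      + g (\<gamma> t) (curvature A D (\<gamma> t) (velocity A {a..b} \<gamma> t) (V t) (velocity A {a..b} \<gamma> t)) (W t))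
    - second_ff A g D P (\<gamma> a) (velocity A {a..b} \<gamma> a) (V a) (W a)"

definition index_form_PQ ::
    "('m::topological_space, 'e::euclidean_space) chart set \<Rightarrow> ('m \<Rightarrow> 'e \<Rightarrow> 'e \<Rightarrow> real) \<Rightarrow>
     ('m \<Rightarrow> 'e \<Rightarrow> ('m \<Rightarrow> 'e) \<Rightarrow> 'e) \<Rightarrow> real \<Rightarrow> real \<Rightarrow> (real \<Rightarrow> 'm) \<Rightarrow> 'm set \<Rightarrow> 'm set \<Rightarrow>
     (real \<Rightarrow> 'e) \<Rightarrow> (real \<Rightarrow> 'e) \<Rightarrow> real"
  where "index_form_PQ A g D a b \<gamma> P Q V W =
    index_form_P A g D a b \<gamma> P V W
    + second_ff A g D Q (\<gamma> b) (velocity A {a..b} \<gamma> b) (V b) (W b)"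

definition jacobi_fields ::
    "('m::topological_space, 'e::euclidean_space) chart set \<Rightarrow> ('m \<Rightarrow> 'e \<Rightarrow> ('m \<Rightarrow> 'e) \<Rightarrow> 'e) \<Rightarrow>
     real \<Rightarrow> real \<Rightarrow> (real \<Rightarrow> 'm) \<Rightarrow> (real \<Rightarrow> 'e) set"
  where "jacobi_fields A D a b \<gamma> =
    {J \<in> smooth_fields A a b \<gamma>. \<forall>t\<in>{a..b}.
       covd A D a b \<gamma> (covd A D a b \<gamma> J) t
       - curvature A D (\<gamma> t) (velocity A {a..b} \<gamma> t) (J t) (velocity A {a..b} \<gamma> t) = 0}"

definition P_jacobi_fields ::
    "('m::topological_space, 'e::euclidean_space) chart set \<Rightarrow> ('m \<Rightarrow> 'e \<Rightarrow> 'e \<Rightarrow> real) \<Rightarrow>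
     ('m \<Rightarrow> 'e \<Rightarrow> ('m \<Rightarrow> 'e) \<Rightarrow> 'e) \<Rightarrow> real \<Rightarrow> real \<Rightarrow> (real \<Rightarrow> 'm) \<Rightarrow> 'm set \<Rightarrow> (real \<Rightarrow> 'e) set"
  where "P_jacobi_fields A g D a b \<gamma> P =
    {J \<in> jacobi_fields A D a b \<gamma>. J a \<in> tangent_space A P (\<gamma> a) \<and>
       (\<forall>w\<in>tangent_space A P (\<gamma> a).
          g (\<gamma> a) (covd A D a b \<gamma> J a) w
          + second_ff A g D P (\<gamma> a) (velocity A {a..b} \<gamma> a) (J a) w = 0)}"

definition J_Q ::
    "('m::topological_space, 'e::euclidean_space) chart set \<Rightarrow> ('m \<Rightarrow> 'e \<Rightarrow> 'e \<Rightarrow> real) \<Rightarrow>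
     ('m \<Rightarrow> 'e \<Rightarrow> ('m \<Rightarrow> 'e) \<Rightarrow> 'e) \<Rightarrow> real \<Rightarrow> real \<Rightarrow> (real \<Rightarrow> 'm) \<Rightarrow> 'm set \<Rightarrow> 'm set \<Rightarrow>
     (real \<Rightarrow> 'e) set"
  where "J_Q A g D a b \<gamma> P Q = P_jacobi_fields A g D a b \<gamma> P \<inter> H_PQ A g a b \<gamma> P Q"

definition form_A ::
    "('m::topological_space, 'e::euclidean_space) chart set \<Rightarrow> ('m \<Rightarrow> 'e \<Rightarrow> 'e \<Rightarrow> real) \<Rightarrow>
     ('m \<Rightarrow> 'e \<Rightarrow> ('m \<Rightarrow> 'e) \<Rightarrow> 'e) \<Rightarrow> real \<Rightarrow> real \<Rightarrow> (real \<Rightarrow> 'm) \<Rightarrow> 'm set \<Rightarrow>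
     (real \<Rightarrow> 'e) \<Rightarrow> (real \<Rightarrow> 'e) \<Rightarrow> real"
  where "form_A A g D a b \<gamma> Q J1 J2 =
    second_ff A g D Q (\<gamma> b) (velocity A {a..b} \<gamma> b) (J1 b) (J2 b)
    + g (\<gamma> b) (covd A D a b \<gamma> J1 b) (J2 b)"

end

(*
  Every V in the given space splits as W + J, where J is a P-Jacobi field with J(b) = V(b), which
  exists by the assumption on the tangent space of Q, and W(b) = 0. The field J lies in J^Q because
  g(J, gamma') is an affine function of the parameter (its second derivative is
  g(R(gamma', J) gamma', gamma') = 0) that vanishes at both end points. Integrating
  g(J', W') + g(R(gamma', J) gamma', W) = g(J', W)' by parts shows that I^P(J, W) = g(J'(b), W(b))
  for every P-Jacobi field J. Hence the two summands are orthogonal for I^(P,Q), which restricts to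
  I^P on the first and to A on the second, and the index is additive on orthogonal sums even when
  the summands intersect (the intersection is then contained in the kernel).
*)
theory Submission
  imports Defs
begin

section \<open>The index of an orthogonal sum\<close>

lemma Sup_enat_mem:
  fixes S :: "enat set"
  assumes "finite S" "S \<noteq> {}"
  shows "Sup S \<in> S"
  using assms Max_in[of S] by (simp add: Sup_enat_def del: Max_in)

lemma edim_finite:
  assumes "finite S" "W \<subseteq> span S"
  shows "edim W = enat (dim W)"
  using assms unfolding edim_def by auto

lemma ind_ge:
  assumes "subspace W" "W \<subseteq> K" "\<And>w. w \<in> W \<Longrightarrow> w \<noteq> 0 \<Longrightarrow> B w w < 0"
  shows "edim W \<le> ind B K"
  unfolding ind_def by (rule SUP_upper) (use assms in auto)

lemma ind_cong:
  assumes "\<And>w. w \<in> K \<Longrightarrow> B w w = B' w w"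
  shows "ind B K = ind B' K"
proof -
  have "{W. subspace W \<and> W \<subseteq> K \<and> (\<forall>w\<in>W. w \<noteq> 0 \<longrightarrow> B w w < 0)}
      = {W. subspace W \<and> W \<subseteq> K \<and> (\<forall>w\<in>W. w \<noteq> 0 \<longrightarrow> B' w w < 0)}"
    using assms by (auto simp: subset_iff)
  then show ?thesis unfolding ind_def by simp
qed

lemma edim_sum_ge:
  fixes W1 W2 :: "'v::real_vector set"
  assumes W: "subspace W1" "subspace W2" and disj: "W1 \<inter> W2 \<subseteq> {0}"
  shows "edim W1 + edim W2 \<le> edim {x + y |x y. x \<in> W1 \<and> y \<in> W2}" (is "_ \<le> edim ?W")
proof (cases "\<exists>S. finite S \<and> ?W \<subseteq> span S")
  case False
  then have "edim ?W = \<infinity>" unfolding edim_def by argo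
  then show ?thesis by simp
next
  case True
  then obtain S where S: "finite S" "?W \<subseteq> span S" by blast
  have sub1: "W1 \<subseteq> ?W" using subspace_0[OF W(2)] by force
  have sub2: "W2 \<subseteq> ?W" using subspace_0[OF W(1)] by force
  obtain B1 where B1: "B1 \<subseteq> W1" "independent B1" "W1 \<subseteq> span B1" "card B1 = dim W1"
    using basis_exists[of W1] by metis
  obtain B2 where B2: "B2 \<subseteq> W2" "independent B2" "W2 \<subseteq> span B2" "card B2 = dim W2"
    using basis_exists[of W2] by metis
  have fin: "finite B1" "finite B2"
    using independent_span_bound[OF S(1) B1(2)] independent_span_bound[OF S(1) B2(2)]
      B1(1) B2(1) sub1 sub2 S(2) by (meson order_trans)+
  have span1: "span B1 = W1" and span2: "span B2 = W2"
    using B1 B2 W by (metis span_minimal subset_antisym)+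
  have B12: "B1 \<inter> B2 = {}"
  proof -
    have "B1 \<inter> B2 \<subseteq> {0}" using B1(1) B2(1) disj by auto
    moreover have "0 \<notin> B1" using B1(2) dependent_zero by blast
    ultimately show ?thesis by auto
  qed
  have ind: "independent (B1 \<union> B2)"
    unfolding independent_explicit_finite_subsets
  proof (intro allI impI ballI)
    fix T u v
    assume T: "T \<subseteq> B1 \<union> B2" "finite T" and s: "(\<Sum>v\<in>T. u v *\<^sub>R v) = 0" and v: "v \<in> T"
    have split: "T = (T \<inter> B1) \<union> (T \<inter> B2)" using T by auto
    have eq: "(\<Sum>v\<in>T. u v *\<^sub>R v) = (\<Sum>v\<in>T\<inter>B1. u v *\<^sub>R v) + (\<Sum>v\<in>T\<inter>B2. u v *\<^sub>R v)"
      by (subst split, rule sum.union_disjoint) (use T B12 in auto)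
    have in1: "(\<Sum>v\<in>T\<inter>B1. u v *\<^sub>R v) \<in> W1"
      using B1(1) W(1) by (intro subspace_sum) (auto intro: subspace_scale)
    have in2: "(\<Sum>v\<in>T\<inter>B2. u v *\<^sub>R v) \<in> W2"
      using B2(1) W(2) by (intro subspace_sum) (auto intro: subspace_scale)
    have "(\<Sum>v\<in>T\<inter>B1. u v *\<^sub>R v) = - (\<Sum>v\<in>T\<inter>B2. u v *\<^sub>R v)"
      using eq s by (simp add: eq_neg_iff_add_eq_0)
    then have "(\<Sum>v\<in>T\<inter>B1. u v *\<^sub>R v) \<in> W1 \<inter> W2"
      using in1 in2 W(2) by (auto intro: subspace_neg)
    then have z1: "(\<Sum>v\<in>T\<inter>B1. u v *\<^sub>R v) = 0" using disj by auto
    then have z2: "(\<Sum>v\<in>T\<inter>B2. u v *\<^sub>R v) = 0" using eq s by simp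
    show "u v = 0"
    proof (cases "v \<in> B1")
      case True
      then show ?thesis
        using B1(2)[unfolded independent_explicit_finite_subsets] T(2) z1 v
        by (metis (no_types, lifting) IntI Int_lower2 finite_Int)
    next
      case False
      then have "v \<in> T \<inter> B2" using v T by auto
      then show ?thesis
        using B2(2)[unfolded independent_explicit_finite_subsets] T(2) z2
        by (metis (no_types, lifting) Int_lower2 finite_Int)
    qed
  qed
  have "B1 \<union> B2 \<subseteq> ?W" using B1(1) B2(1) sub1 sub2 by blast
  moreover have "?W \<subseteq> span (B1 \<union> B2)"
  proof
    fix z assume "z \<in> ?W"
    then obtain x y where "z = x + y" "x \<in> span B1" "y \<in> span B2" using span1 span2 by auto
    then show "z \<in> span (B1 \<union> B2)"
      by (metis Un_upper1 Un_upper2 span_add span_mono subsetD)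
  qed
  ultimately have "dim ?W = card (B1 \<union> B2)"
    using dim_unique[of "B1 \<union> B2" ?W] ind by blast
  also have "\<dots> = dim W1 + dim W2" using card_Un_disjoint[OF fin B12] B1(4) B2(4) by simp
  finally have dimeq: "dim ?W = dim W1 + dim W2" .
  have "edim ?W = enat (dim ?W)" using edim_finite[OF S] .
  moreover have "edim W1 = enat (dim W1)" "edim W2 = enat (dim W2)"
    using edim_finite[OF S(1) order_trans[OF sub1 S(2)]]
      edim_finite[OF S(1) order_trans[OF sub2 S(2)]] by auto
  ultimately show ?thesis using dimeq by simp
qed

lemma edim_le_if_all_finite_dim_le:
  fixes W :: "'v::real_vector set"
  assumes "subspace W"
    and le: "\<And>S. finite S \<Longrightarrow> independent S \<Longrightarrow> S \<subseteq> W \<Longrightarrow> card S \<le> n"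
  shows "edim W \<le> enat n"
proof -
  obtain B where B: "B \<subseteq> W" "independent B" "W \<subseteq> span B" "card B = dim W"
    using basis_exists[of W] by metis
  have "finite B"
  proof (rule ccontr)
    assume "infinite B"
    then obtain S where "S \<subseteq> B" "finite S" "card S = Suc n"
      using infinite_arbitrarily_large by metis
    then show False
      using le[of S] B independent_mono[OF B(2)] by auto
  qed
  then have "edim W = enat (card B)"
    using B edim_finite[OF \<open>finite B\<close> B(3)] by simp
  with le[OF \<open>finite B\<close> B(2,1)] show ?thesis by simp
qed

lemma subspace_if_combine_closed:
  assumes "x0 \<in> S" and S: "\<And>x y r. x \<in> S \<Longrightarrow> y \<in> S \<Longrightarrow> r *\<^sub>R x + y \<in> S"
  shows "subspace S"
proof -
  have 0: "0 \<in> S" using S[OF assms(1,1), of "- 1"] by simp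
  show ?thesis
    unfolding subspace_def using 0 S[of _ _ 1] S[OF _ 0] by simp
qed

locale sym_bilinear_on =
  fixes B :: "'v::real_vector \<Rightarrow> 'v \<Rightarrow> real" and K :: "'v set"
  assumes sub: "subspace K"
    and sym: "v \<in> K \<Longrightarrow> w \<in> K \<Longrightarrow> B v w = B w v"
    and combine: "u \<in> K \<Longrightarrow> v \<in> K \<Longrightarrow> w \<in> K \<Longrightarrow> B (r *\<^sub>R u + v) w = r * B u w + B v w"
begin

lemma add: "u \<in> K \<Longrightarrow> v \<in> K \<Longrightarrow> w \<in> K \<Longrightarrow> B (u + v) w = B u w + B v w"
  using combine[of u v w 1] by simp

lemma scale: "v \<in> K \<Longrightarrow> w \<in> K \<Longrightarrow> B (r *\<^sub>R v) w = r * B v w"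
  using combine[of v 0 w r] combine[of v v w "- 1"] combine[of 0 0 w 1] subspace_0[OF sub] by simp

lemma add_right: "u \<in> K \<Longrightarrow> v \<in> K \<Longrightarrow> w \<in> K \<Longrightarrow> B w (u + v) = B w u + B w v"
  using add[of u v w] sym sub by (simp add: subspace_add)

lemma scale_right: "v \<in> K \<Longrightarrow> w \<in> K \<Longrightarrow> B w (r *\<^sub>R v) = r * B w v"
  using scale[of v w r] sym sub by (simp add: subspace_scale)

lemma quadratic_add:
  "u \<in> K \<Longrightarrow> v \<in> K \<Longrightarrow> B (u + v) (u + v) = B u u + 2 * B u v + B v v"
  using sub by (simp add: add add_right subspace_add sym[of v u])

text \<open>\<open>S\<close> is a basis of a negative definite subspace of maximal dimension.\<close>

lemma finite_index_witness:
  assumes K1: "subspace K1" "K1 \<subseteq> K" and fin: "ind B K1 = enat n"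
  obtains S where "finite S" "card S \<le> n" "S \<subseteq> K1"
    "\<And>k. k \<in> K1 \<Longrightarrow> (\<And>s. s \<in> S \<Longrightarrow> B k s = 0) \<Longrightarrow> B k k \<ge> 0"
proof -
  let ?N = "{W. subspace W \<and> W \<subseteq> K1 \<and> (\<forall>w\<in>W. w \<noteq> 0 \<longrightarrow> B w w < 0)}"
  have ne: "{0} \<in> ?N" using subspace_0[OF K1(1)] by simp
  have "edim ` ?N \<noteq> {}" using ne by blast
  have le: "edim W \<le> enat n" if "W \<in> ?N" for W
    using ind_ge[of W K1 B] that fin by auto
  have "finite (edim ` ?N)"
    by (rule finite_enat_bounded) (use le in blast)
  then have "Sup (edim ` ?N) \<in> edim ` ?N"
    using \<open>edim ` ?N \<noteq> {}\<close> by (rule Sup_enat_mem)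
  then obtain W where W: "W \<in> ?N" "edim W = enat n"
    using fin unfolding ind_def by force
  then obtain S0 where S0: "finite S0" "W \<subseteq> span S0"
    unfolding edim_def by (auto split: if_splits)
  obtain S where S: "S \<subseteq> W" "independent S" "W \<subseteq> span S" "card S = dim W"
    using basis_exists[of W] by metis
  have finS: "finite S"
    using independent_span_bound[OF S0(1) S(2)] S(1) S0(2) by (meson order_trans)
  have cS: "card S = n" using W(2) edim_finite[OF S0] S(4) by simp
  have spanS: "span S = W" using S W(1) by (metis (mono_tags, lifting) mem_Collect_eq span_minimal subset_antisym)
  show thesis
  proof (rule that[OF finS])
    show "card S \<le> n" using cS by simp
    show "S \<subseteq> K1" using S(1) W(1) by auto
    fix k assume k: "k \<in> K1" and orth: "\<And>s. s \<in> S \<Longrightarrow> B k s = 0"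
    show "B k k \<ge> 0"
    proof (rule ccontr)
      assume neg: "\<not> B k k \<ge> 0"
      have WK: "W \<subseteq> K" using W(1) K1(2) by auto
      have kK: "k \<in> K" using k K1(2) by auto
      have "subspace {w \<in> K. B k w = 0}"
        using sub kK subspace_0[OF sub] scale_right[of 0 k 0]
        by (auto simp: subspace_def add_right scale_right)
      then have "span S \<subseteq> {w \<in> K. B k w = 0}"
        using orth S(1) WK by (intro span_minimal) auto
      then have orthW: "B k w = 0" if "w \<in> W" for w
        using that spanS by auto
      let ?X = "{x + y |x y. x \<in> W \<and> y \<in> span {k}}"
      have "?X \<in> ?N"
      proof (intro CollectI conjI ballI impI)
        show "subspace ?X" by (rule subspace_sums) (use W(1) in auto)
        show "?X \<subseteq> K1"
          using W(1) k K1(1) by (auto simp: span_singleton intro!: subspace_add subspace_scale)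
        fix z assume "z \<in> ?X" "z \<noteq> 0"
        then obtain x r where z: "z = x + r *\<^sub>R k" "x \<in> W" by (auto simp: span_singleton)
        have rk: "r *\<^sub>R k \<in> K" using sub kK by (simp add: subspace_scale)
        have xK: "x \<in> K" using z WK by auto
        have Bxk: "B x (r *\<^sub>R k) = 0"
          using scale_right[OF kK xK] sym[OF xK kK] orthW[OF z(2)] by simp
        have "B z z = B x x + r * r * B k k"
          unfolding z(1) quadratic_add[OF xK rk] Bxk
          using scale[OF kK rk] scale_right[OF kK kK] by simp
        moreover have "B 0 0 = 0" using scale[of 0 0 0] subspace_0[OF sub] by simp
        then have "B x x \<le> 0" using W(1) z(2) by (cases "x = 0") (auto simp: less_imp_le)
        moreover have "r * r * B k k \<le> 0" using neg by (simp add: mult_nonneg_nonpos)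
        moreover have "B x x < 0 \<or> r * r * B k k < 0"
        proof (cases "r = 0")
          case True
          then show ?thesis using z \<open>z \<noteq> 0\<close> W(1) by auto
        next
          case False
          then have "r * r > 0" by (cases r "0::real" rule: linorder_cases) (auto simp: zero_less_mult_iff)
          then show ?thesis using neg by (simp add: mult_pos_neg)
        qed
        ultimately show "B z z < 0" by linarith
      qed
      then have "edim ?X \<le> enat n" by (rule le)
      moreover have "W \<inter> span {k} \<subseteq> {0}"
      proof
        fix z assume "z \<in> W \<inter> span {k}"
        then obtain r where r: "z = r *\<^sub>R k" "z \<in> W" by (auto simp: span_singleton)
        have "r * B k k = 0" using orthW[OF r(2)] r(1) scale_right[OF kK kK] by simp
        then show "z \<in> {0}" using neg r by auto
      qed
      then have "edim W + edim (span {k}) \<le> edim ?X"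
        using W(1) by (intro edim_sum_ge) auto
      moreover have "edim (span {k}) = 1"
      proof -
        have "B 0 0 = 0" using scale[of 0 0 0] subspace_0[OF sub] by simp
        then have "k \<noteq> 0" using neg by auto
        then have "dim (span {k}) = 1" by (simp add: dim_eq_card_independent)
        then show ?thesis using edim_finite[of "{k}" "span {k}"] by (simp add: one_enat_def)
      qed
      ultimately have "edim W + 1 \<le> enat n" by (simp add: order_trans)
      then have "enat n + 1 \<le> enat n" using W(2) by simp
      then show False by (simp add: one_enat_def)
    qed
  qed
qed

lemma sum_left:
  "finite U \<Longrightarrow> U \<subseteq> K \<Longrightarrow> w \<in> K \<Longrightarrow> B (\<Sum>u\<in>U. c u *\<^sub>R u) w = (\<Sum>u\<in>U. c u * B u w)"
proof (induction rule: finite_induct)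
  case empty
  then show ?case using scale[of w w 0] by simp
next
  case (insert u U)
  have "(\<Sum>u\<in>U. c u *\<^sub>R u) \<in> K" using insert sub by (intro subspace_sum subspace_scale) auto
  then show ?case using insert sub by (simp add: add scale subspace_scale)
qed

text \<open>The vectors of \<open>U\<close> are embedded into the functions on \<open>T\<close>.\<close>

lemma card_le_if_orthogonal_trivial:
  fixes U T :: "'v set"
  assumes U: "finite U" "independent U" "U \<subseteq> K" and T: "finite T" "T \<subseteq> K"
    and triv: "\<And>w. w \<in> span U \<Longrightarrow> (\<And>t. t \<in> T \<Longrightarrow> B w t = 0) \<Longrightarrow> w = 0"
  shows "card U \<le> card T"
proof -
  define \<phi> where "\<phi> v = (\<lambda>t. if t \<in> T then B v t else 0)" for v
  define \<delta> where "\<delta> t = (\<lambda>s. if s = t then 1 else 0 :: real)" for t :: 'v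
  have vanish: "c u = 0" if "(\<Sum>u\<in>U. c u *\<^sub>R \<phi> u) = 0" "u \<in> U" for c u
  proof -
    have "(\<Sum>u\<in>U. c u *\<^sub>R u) = 0"
    proof (rule triv)
      show "(\<Sum>u\<in>U. c u *\<^sub>R u) \<in> span U" by (intro span_sum span_scale span_base)
      fix t assume t: "t \<in> T"
      have app: "(\<Sum>u\<in>X. f u) t = (\<Sum>u\<in>X. f u t)" if "finite X" for X and f :: "'v \<Rightarrow> 'v \<Rightarrow> real"
        using that by (induction rule: finite_induct) auto
      have "(\<Sum>u\<in>U. c u *\<^sub>R \<phi> u) t = (\<Sum>u\<in>U. c u * B u t)"
        using t by (simp add: app[OF U(1)] scaleR_fun_def \<phi>_def)
      then show "B (\<Sum>u\<in>U. c u *\<^sub>R u) t = 0"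
        using that(1) t T(2) by (subst sum_left[OF U(1,3)]) auto
    qed
    then show ?thesis
      using U(1,2) that(2) independent_explicit_finite_subsets[of U] by blast
  qed
  have inj: "inj_on \<phi> U"
  proof (rule inj_onI, rule ccontr)
    fix x y assume xy: "x \<in> U" "y \<in> U" "\<phi> x = \<phi> y" "x \<noteq> y"
    define c where "c w = (if w = x then 1 else if w = y then -1 else 0 :: real)" for w
    have "(\<Sum>v\<in>U. c v *\<^sub>R \<phi> v) = (\<Sum>v\<in>{x,y}. c v *\<^sub>R \<phi> v)"
      by (rule sum.mono_neutral_right) (use xy U(1) in \<open>auto simp: c_def\<close>)
    also have "\<dots> = 0" using xy by (simp add: c_def)
    finally show False using vanish[of c x] xy by (simp add: c_def)
  qed
  have "independent (\<phi> ` U)"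
  proof (rule independent_if_scalars_zero)
    show "finite (\<phi> ` U)" using U(1) by simp
    fix c x assume s: "(\<Sum>x\<in>\<phi> ` U. c x *\<^sub>R x) = 0" and x: "x \<in> \<phi> ` U"
    have "(\<Sum>v\<in>U. (c (\<phi> v)) *\<^sub>R \<phi> v) = 0"
      using s by (simp add: sum.reindex[OF inj] o_def)
    then show "c x = 0" using vanish[of "\<lambda>v. c (\<phi> v)"] x by auto
  qed
  moreover have "\<phi> ` U \<subseteq> span (\<delta> ` T)"
  proof
    fix f assume "f \<in> \<phi> ` U"
    then have f: "f s = 0" if "s \<notin> T" for s using that by (auto simp: \<phi>_def)
    have app: "(\<Sum>t\<in>X. f t *\<^sub>R \<delta> t) s = (if s \<in> X then f s else 0)" if "finite X" for X s
      using that by (induction rule: finite_induct) (auto simp: scaleR_fun_def \<delta>_def)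
    have "f = (\<Sum>t\<in>T. f t *\<^sub>R \<delta> t)" using f by (auto simp: fun_eq_iff app[OF T(1)])
    also have "\<dots> \<in> span (\<delta> ` T)" by (intro span_sum span_scale span_base imageI)
    finally show "f \<in> span (\<delta> ` T)" .
  qed
  ultimately have "card (\<phi> ` U) \<le> card (\<delta> ` T)"
    using independent_span_bound[of "\<delta> ` T" "\<phi> ` U"] T(1) by simp
  then show ?thesis using card_image[OF inj] card_image_le[OF T(1), of \<delta>] by simp
qed

theorem ind_orthogonal_sum:
  assumes K1: "subspace K1" "K1 \<subseteq> K" and K2: "subspace K2" "K2 \<subseteq> K"
    and sum: "\<And>v. v \<in> K \<Longrightarrow> \<exists>x\<in>K1. \<exists>y\<in>K2. v = x + y"
    and orth: "\<And>x y. x \<in> K1 \<Longrightarrow> y \<in> K2 \<Longrightarrow> B x y = 0"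
  shows "ind B K = ind B K1 + ind B K2"
proof (rule antisym)
  let ?N = "\<lambda>K. {W. subspace W \<and> W \<subseteq> K \<and> (\<forall>w\<in>W. w \<noteq> 0 \<longrightarrow> B w w < 0)}"
  have B0: "B 0 0 = 0" using scale[of 0 0 0] subspace_0[OF sub] by simp
  have K12: "edim W1 + edim W2 \<le> ind B K" if W: "W1 \<in> ?N K1" "W2 \<in> ?N K2" for W1 W2
  proof -
    let ?W = "{x + y |x y. x \<in> W1 \<and> y \<in> W2}"
    have "W1 \<inter> W2 \<subseteq> {0}"
    proof
      fix w assume "w \<in> W1 \<inter> W2"
      then show "w \<in> {0}" using W orth[of w w] by force
    qed
    then have "edim W1 + edim W2 \<le> edim ?W" using W by (intro edim_sum_ge) auto
    also have "\<dots> \<le> ind B K"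
    proof (rule ind_ge)
      show "subspace ?W" using W by (intro subspace_sums) auto
      show "?W \<subseteq> K" using W K1(2) K2(2) sub by (auto intro!: subspace_add)
      fix w assume "w \<in> ?W" "w \<noteq> 0"
      then obtain x y where w: "w = x + y" "x \<in> W1" "y \<in> W2" by auto
      have "x \<in> K1" "y \<in> K2" using w W by auto
      moreover then have "x \<in> K" "y \<in> K" using K1(2) K2(2) by auto
      ultimately have "B w w = B x x + B y y"
        using w(1) quadratic_add[of x y] orth[of x y] by simp
      moreover have "x \<noteq> 0 \<or> y \<noteq> 0" using w \<open>w \<noteq> 0\<close> by auto
      moreover have "x \<noteq> 0 \<Longrightarrow> B x x < 0" "y \<noteq> 0 \<Longrightarrow> B y y < 0" using w W by auto
      ultimately show "B w w < 0"
        using B0 by (cases "x = 0"; cases "y = 0") auto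
    qed
    finally show ?thesis .
  qed
  have ne: "?N K1 \<noteq> {}" "?N K2 \<noteq> {}"
    using subspace_0[OF K1(1)] subspace_0[OF K2(1)] subspace_single_0 by blast+
  show "ind B K1 + ind B K2 \<le> ind B K"
  proof (cases "ind B K = \<infinity>")
    case False
    then obtain m where m: "ind B K = enat m" by auto
    have "e \<le> enat m" if e: "e \<in> edim ` ?N K1 \<union> edim ` ?N K2" for e
    proof -
      obtain W1 W2 where W: "W1 \<in> ?N K1" "W2 \<in> ?N K2" "e = edim W1 \<or> e = edim W2"
      proof -
        obtain U1 U2 where U: "U1 \<in> ?N K1" "U2 \<in> ?N K2" using ne by (meson ex_in_conv)
        from e show thesis
        proof
          assume "e \<in> edim ` ?N K1"
          then show thesis using that[of _ U2] U(2) by (elim imageE) simp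
        next
          assume "e \<in> edim ` ?N K2"
          then show thesis using that[of U1] U(1) by (elim imageE) simp
        qed
      qed
      have "e \<le> edim W1 + edim W2" using W(3) by auto
      also have "\<dots> \<le> enat m" using K12[OF W(1,2)] m by simp
      finally show ?thesis .
    qed
    then have "finite (edim ` ?N K1 \<union> edim ` ?N K2)" by (rule finite_enat_bounded)
    then have fin: "finite (edim ` ?N K1)" "finite (edim ` ?N K2)" by blast+
    have "ind B K1 \<in> edim ` ?N K1"
      unfolding ind_def[of B K1] by (rule Sup_enat_mem[OF fin(1)]) (use ne in blast)
    then obtain W1 where W1: "ind B K1 = edim W1" "W1 \<in> ?N K1" by (rule imageE)
    have "ind B K2 \<in> edim ` ?N K2"
      unfolding ind_def[of B K2] by (rule Sup_enat_mem[OF fin(2)]) (use ne in blast)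
    then obtain W2 where W2: "ind B K2 = edim W2" "W2 \<in> ?N K2" by (rule imageE)
    show ?thesis unfolding W1(1) W2(1) using W1(2) W2(2) by (rule K12)
  qed simp
  show "ind B K \<le> ind B K1 + ind B K2"
  proof (cases "ind B K1 = \<infinity> \<or> ind B K2 = \<infinity>")
    case False
    then obtain n1 n2 where n: "ind B K1 = enat n1" "ind B K2 = enat n2" by auto
    obtain S1 where S1: "finite S1" "card S1 \<le> n1" "S1 \<subseteq> K1"
      "\<And>k. k \<in> K1 \<Longrightarrow> (\<And>s. s \<in> S1 \<Longrightarrow> B k s = 0) \<Longrightarrow> B k k \<ge> 0"
      using finite_index_witness[OF K1 n(1)] by metis
    obtain S2 where S2: "finite S2" "card S2 \<le> n2" "S2 \<subseteq> K2"
      "\<And>k. k \<in> K2 \<Longrightarrow> (\<And>s. s \<in> S2 \<Longrightarrow> B k s = 0) \<Longrightarrow> B k k \<ge> 0"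
      using finite_index_witness[OF K2 n(2)] by metis
    have "ind B K \<le> enat (n1 + n2)"
      unfolding ind_def
    proof (rule SUP_least)
      fix W assume W: "W \<in> ?N K"
      show "edim W \<le> enat (n1 + n2)"
      proof (rule edim_le_if_all_finite_dim_le)
        show "subspace W" using W by auto
        fix U assume U: "finite U" "independent U" "U \<subseteq> W"
        have "card U \<le> card (S1 \<union> S2)"
        proof (rule card_le_if_orthogonal_trivial[OF U(1,2)])
          show "U \<subseteq> K" "finite (S1 \<union> S2)" "S1 \<union> S2 \<subseteq> K"
            using U W S1 S2 K1 K2 by auto
          fix w assume w: "w \<in> span U" and z: "\<And>t. t \<in> S1 \<union> S2 \<Longrightarrow> B w t = 0"
          have wW: "w \<in> W" using w U(3) W by (metis (mono_tags, lifting) mem_Collect_eq span_minimal subsetD)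
          then have "w \<in> K" using W by auto
          then obtain x y where xy: "x \<in> K1" "y \<in> K2" "w = x + y" using sum by blast
          have xyK: "x \<in> K" "y \<in> K" using xy K1 K2 by auto
          have "B x s = 0" if "s \<in> S1" for s
          proof -
            have s: "s \<in> K1" "s \<in> K" using that S1 K1 by auto
            have "B w s = B x s + B y s" using xy xyK s add by simp
            moreover have "B y s = 0" using orth[OF s(1) xy(2)] sym[OF xyK(2) s(2)] by simp
            ultimately show ?thesis using z that by simp
          qed
          then have 1: "B x x \<ge> 0" using S1(4) xy by blast
          have "B y s = 0" if "s \<in> S2" for s
          proof -
            have s: "s \<in> K2" "s \<in> K" using that S2 K2 by auto
            have "B w s = B x s + B y s" using xy xyK s add by simp
            moreover have "B x s = 0" using orth[OF xy(1) s(1)] by simp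
            ultimately show ?thesis using z that by simp
          qed
          then have 2: "B y y \<ge> 0" using S2(4) xy by blast
          have "B w w \<ge> 0" using 1 2 quadratic_add[OF xyK] orth[OF xy(1,2)] xy(3) by simp
          then show "w = 0" using W wW by force
        qed
        also have "\<dots> \<le> n1 + n2" using card_Un_le[of S1 S2] S1 S2 by linarith
        finally show "card U \<le> n1 + n2" .
      qed
    qed
    then show ?thesis using n by simp
  qed auto
qed

end

section \<open>Calculus of smooth maps\<close>

text \<open>This is the condition under which the library proves derivatives within a set to be unique.\<close>

definition fat :: "'a::euclidean_space set \<Rightarrow> bool"
  where "fat S \<longleftrightarrow> (\<forall>x\<in>S. \<forall>i\<in>Basis. \<forall>e>0. \<exists>d. 0 < \<bar>d\<bar> \<and> \<bar>d\<bar> < e \<and> x + d *\<^sub>R i \<in> S)"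

lemma fat_Int_open:
  assumes "fat S" "open U"
  shows "fat (S \<inter> U)"
  unfolding fat_def
proof (intro ballI allI impI)
  fix x i and e :: real
  assume x: "x \<in> S \<inter> U" and i: "(i::'a) \<in> Basis" and e: "e > 0"
  then obtain r where r: "r > 0" "ball x r \<subseteq> U" using assms(2) open_contains_ball by blast
  obtain d where d: "0 < \<bar>d\<bar>" "\<bar>d\<bar> < min e r" "x + d *\<^sub>R i \<in> S"
    using assms(1) x i e r(1) unfolding fat_def by (metis IntD1 min_less_iff_conj)
  have "x + d *\<^sub>R i \<in> ball x r" using d i by (simp add: dist_norm)
  then show "\<exists>d. 0 < \<bar>d\<bar> \<and> \<bar>d\<bar> < e \<and> x + d *\<^sub>R i \<in> S \<inter> U" using d r by auto
qed

lemma fat_UNIV: "fat UNIV"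
  unfolding fat_def by (metis UNIV_I abs_of_pos dense)

lemma fat_open: "open S \<Longrightarrow> fat S"
  using fat_Int_open[OF fat_UNIV, of S] by simp

lemma fat_interval: "a < b \<Longrightarrow> fat {a..b::real}"
  unfolding fat_def
proof (intro ballI allI impI)
  fix x i e :: real
  assume a: "a < b" "x \<in> {a..b}" "i \<in> Basis" "e > 0"
  define d where "d = (if x < b then min (e/2) (b - x) else - min (e/2) (b - a))"
  have "0 < \<bar>d\<bar> \<and> \<bar>d\<bar> < e \<and> x + d *\<^sub>R i \<in> {a..b}"
    using a by (auto simp: d_def min_def)
  then show "\<exists>d. 0 < \<bar>d\<bar> \<and> \<bar>d\<bar> < e \<and> x + d *\<^sub>R i \<in> {a..b}" by blast
qed

lemma fat_openin: "fat S \<Longrightarrow> openin (top_of_set S) S' \<Longrightarrow> fat S'"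
  using fat_Int_open by (auto simp: openin_open)

lemma frechet_derivative_within_fat:
  assumes "fat S" "x \<in> S" "(f has_derivative f') (at x within S)"
  shows "frechet_derivative f (at x within S) = f'"
proof (rule frechet_derivative_unique_within)
  show "(f has_derivative frechet_derivative f (at x within S)) (at x within S)"
    using differentiableI[OF assms(3)] by (simp add: frechet_derivative_works)
qed (use assms in \<open>auto simp: fat_def\<close>)

lemma Ck_on_cong:
  "(\<And>x. x \<in> S \<Longrightarrow> f x = g x) \<Longrightarrow> Ck_on k S f \<longleftrightarrow> Ck_on k S g"
proof (induction k arbitrary: f g)
  case 0
  then show ?case by (simp cong: continuous_on_cong)
next
  case (Suc k)
  have hd: "(f has_derivative D) (at x within S) \<longleftrightarrow> (g has_derivative D) (at x within S)"
    if "x \<in> S" for x D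
    using has_derivative_transform[OF that, of f g] has_derivative_transform[OF that, of g f] Suc.prems
    by auto
  have fd: "frechet_derivative f (at x within S) = frechet_derivative g (at x within S)" if "x \<in> S" for x
    unfolding frechet_derivative_def using hd[OF that] by simp
  have "Ck_on k S (\<lambda>x. frechet_derivative f (at x within S) v)
      \<longleftrightarrow> Ck_on k S (\<lambda>x. frechet_derivative g (at x within S) v)" for v
    by (rule Suc.IH) (simp add: fd)
  then show ?case using hd by (simp add: differentiable_def)
qed

lemma Ck_on_SucD: "Ck_on (Suc k) S f \<Longrightarrow> Ck_on k S f"
proof (induction k arbitrary: f)
  case 0
  then show ?case
    by (auto simp: continuous_on_eq_continuous_within intro: differentiable_imp_continuous_within)
next
  case (Suc k)
  note prems = Suc.prems[unfolded Ck_on.simps(2)[of "Suc k"]]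
  have "Ck_on k S (\<lambda>x. frechet_derivative f (at x within S) v)" for v
    by (rule Suc.IH) (use prems in blast)
  then show ?case using prems by simp
qed

lemma Ck_on_Suc_intro:
  assumes "fat S" and d: "\<And>x. x \<in> S \<Longrightarrow> (f has_derivative f' x) (at x within S)"
    and C: "\<And>v. Ck_on k S (\<lambda>x. f' x v)"
  shows "Ck_on (Suc k) S f"
proof -
  have "Ck_on k S (\<lambda>x. frechet_derivative f (at x within S) v)" for v
    using C[of v] Ck_on_cong[of S "\<lambda>x. frechet_derivative f (at x within S) v" "\<lambda>x. f' x v" k]
      frechet_derivative_within_fat[OF assms(1) _ d] by simp
  then show ?thesis using d by (auto simp: differentiable_def)
qed

lemma Ck_on_SucE:
  assumes "Ck_on (Suc k) S f" "x \<in> S"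
  shows "(f has_derivative frechet_derivative f (at x within S)) (at x within S)"
  using assms frechet_derivative_works by auto

lemma Ck_on_zero: "fat S \<Longrightarrow> Ck_on k S (\<lambda>x. 0)"
proof (induction k)
  case (Suc k)
  then show ?case by (intro Ck_on_Suc_intro[where f' = "\<lambda>_ _. 0"]) auto
qed simp

lemma Ck_on_const: "fat S \<Longrightarrow> Ck_on k S (\<lambda>x. c)"
proof (cases k)
  case (Suc n)
  assume "fat S"
  then show ?thesis unfolding Suc
    by (rule Ck_on_Suc_intro[where f' = "\<lambda>_ _. 0"]) (auto intro: Ck_on_zero \<open>fat S\<close>)
qed auto

lemma Ck_on_bounded_linear:
  assumes "fat S" "bounded_linear L"
  shows "Ck_on k S L"
proof (cases k)
  case 0
  then show ?thesis using linear_continuous_on[OF assms(2)] by simp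
next
  case (Suc n)
  show ?thesis unfolding Suc
    by (rule Ck_on_Suc_intro[OF assms(1), where f' = "\<lambda>_. L"])
       (auto intro: Ck_on_const assms bounded_linear_imp_has_derivative)
qed

lemma Ck_on_add:
  assumes "fat S"
  shows "Ck_on k S f \<Longrightarrow> Ck_on k S g \<Longrightarrow> Ck_on k S (\<lambda>x. f x + g x)"
proof (induction k arbitrary: f g)
  case 0
  then show ?case by (simp add: continuous_on_add)
next
  case (Suc k)
  show ?case
    by (rule Ck_on_Suc_intro[OF assms has_derivative_add[OF Ck_on_SucE[OF Suc.prems(1)] Ck_on_SucE[OF Suc.prems(2)]]])
       (use Suc in auto)
qed

lemma Ck_on_sum:
  assumes "fat S"
  shows "finite I \<Longrightarrow> (\<And>i. i \<in> I \<Longrightarrow> Ck_on k S (f i)) \<Longrightarrow> Ck_on k S (\<lambda>x. \<Sum>i\<in>I. f i x)"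
  by (induction rule: finite_induct) (auto intro: Ck_on_const Ck_on_add assms)

lemma Ck_on_scaleR:
  fixes f :: "'a::euclidean_space \<Rightarrow> real"
  assumes "fat S"
  shows "Ck_on k S f \<Longrightarrow> Ck_on k S g \<Longrightarrow> Ck_on k S (\<lambda>x. f x *\<^sub>R g x)"
proof (induction k arbitrary: f g)
  case 0
  then show ?case by (simp add: continuous_on_scaleR)
next
  case (Suc k)
  show ?case
  proof (rule Ck_on_Suc_intro[OF assms has_derivative_scaleR[OF Ck_on_SucE[OF Suc.prems(1)] Ck_on_SucE[OF Suc.prems(2)]]])
    show "Ck_on k S (\<lambda>x. f x *\<^sub>R frechet_derivative g (at x within S) v + frechet_derivative f (at x within S) v *\<^sub>R g x)" for v
      using Suc.prems by (intro Ck_on_add[OF assms] Suc.IH Ck_on_SucD[OF Suc.prems(1)] Ck_on_SucD[OF Suc.prems(2)]) auto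
  qed
qed

lemma Ck_on_inner:
  fixes f :: "'a::euclidean_space \<Rightarrow> 'b::euclidean_space"
  assumes "fat S"
  shows "Ck_on k S f \<Longrightarrow> Ck_on k S (\<lambda>x. f x \<bullet> i)"
proof (induction k arbitrary: f)
  case 0
  then show ?case by (auto intro: continuous_intros)
next
  case (Suc k)
  show ?case
    by (rule Ck_on_Suc_intro[OF assms has_derivative_inner_left[OF Ck_on_SucE[OF Suc.prems]]])
       (use Suc in auto)
qed

lemma Ck_on_compose:
  fixes f :: "'b::euclidean_space \<Rightarrow> 'c::real_normed_vector" and h :: "'a::euclidean_space \<Rightarrow> 'b"
  assumes "fat S" "fat T" "h ` S \<subseteq> T"
  shows "Ck_on k T f \<Longrightarrow> Ck_on k S h \<Longrightarrow> Ck_on k S (\<lambda>x. f (h x))"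
proof (induction k arbitrary: f)
  case 0
  then show ?case using assms(3) by (auto intro: continuous_on_compose2)
next
  case (Suc k)
  let ?f' = "\<lambda>y. frechet_derivative f (at y within T)"
  let ?h' = "\<lambda>x. frechet_derivative h (at x within S)"
  show ?case
  proof (rule Ck_on_Suc_intro[OF assms(1)])
    fix x assume x: "x \<in> S"
    then have hx: "h x \<in> T" using assms(3) by auto
    note f' = Ck_on_SucE[OF Suc.prems(1) hx]
    have "((\<lambda>x. f (h x)) has_derivative (\<lambda>v. ?f' (h x) (?h' x v))) (at x within S)"
      using has_derivative_in_compose[OF Ck_on_SucE[OF Suc.prems(2) x] has_derivative_subset[OF f' assms(3)]] .
    moreover have "(\<lambda>v. ?f' (h x) (?h' x v)) = (\<lambda>v. \<Sum>i\<in>Basis. (?h' x v \<bullet> i) *\<^sub>R ?f' (h x) i)"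
    proof
      fix v
      have lin: "linear (?f' (h x))" using f' by (rule has_derivative_linear)
      have "?f' (h x) (?h' x v) = ?f' (h x) (\<Sum>i\<in>Basis. (?h' x v \<bullet> i) *\<^sub>R i)"
        by (simp add: euclidean_representation)
      also have "\<dots> = (\<Sum>i\<in>Basis. (?h' x v \<bullet> i) *\<^sub>R ?f' (h x) i)"
        by (simp add: linear_sum[OF lin] linear_scale[OF lin])
      finally show "?f' (h x) (?h' x v) = \<dots>" .
    qed
    ultimately show "((\<lambda>x. f (h x)) has_derivative (\<lambda>v. \<Sum>i\<in>Basis. (?h' x v \<bullet> i) *\<^sub>R ?f' (h x) i)) (at x within S)"
      by simp
  next
    fix v
    have "Ck_on k S (\<lambda>x. ?f' (h x) i)" for i
      using Suc.prems(1) by (intro Suc.IH[OF _ Ck_on_SucD[OF Suc.prems(2)]]) auto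
    moreover have "Ck_on k S (\<lambda>x. ?h' x v \<bullet> i)" for i
      using Suc.prems(2) by (intro Ck_on_inner assms) auto
    ultimately show "Ck_on k S (\<lambda>x. \<Sum>i\<in>Basis. (?h' x v \<bullet> i) *\<^sub>R ?f' (h x) i)"
      by (intro Ck_on_sum Ck_on_scaleR assms) auto
  qed
qed

lemma Ck_on_subset:
  assumes "fat S'" "S' \<subseteq> S"
  shows "Ck_on k S f \<Longrightarrow> Ck_on k S' f"
proof (induction k arbitrary: f)
  case 0
  then show ?case using assms by (auto intro: continuous_on_subset)
next
  case (Suc k)
  show ?case
    by (rule Ck_on_Suc_intro[OF assms(1) has_derivative_subset[OF Ck_on_SucE[OF Suc.prems] assms(2)]])
       (use Suc assms in auto)
qed

lemma Ck_on_local: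
  assumes "fat S"
  shows "(\<And>x. x \<in> S \<Longrightarrow> \<exists>N. open N \<and> x \<in> N \<and> Ck_on k (S \<inter> N) f) \<Longrightarrow> Ck_on k S f"
proof (induction k arbitrary: f)
  case 0
  have "continuous (at x within S) f" if x: "x \<in> S" for x
  proof -
    obtain N where N: "open N" "x \<in> N" "continuous_on (S \<inter> N) f" using 0[OF x] by auto
    then have "continuous (at x within S \<inter> N) f"
      using x by (simp add: continuous_on_eq_continuous_within)
    moreover have "at x within S \<inter> N = at x within S"
      by (rule at_within_nhd[of x N]) (use N in auto)
    ultimately show ?thesis by simp
  qed
  then show ?case by (simp add: continuous_on_eq_continuous_within)
next
  case (Suc k)
  have at: "at x within S \<inter> N = at x within S" if "open N" "x \<in> N" for x and N
    by (rule at_within_nhd[of x N]) (use that in auto)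
  show ?case
  proof (rule Ck_on_Suc_intro[OF assms])
    fix x assume "x \<in> S"
    then obtain N where N: "open N" "x \<in> N" "Ck_on (Suc k) (S \<inter> N) f" using Suc.prems by blast
    show "(f has_derivative frechet_derivative f (at x within S)) (at x within S)"
      using Ck_on_SucE[OF N(3), of x] at[OF N(1,2)] N \<open>x \<in> S\<close> by auto
  next
    fix v
    show "Ck_on k S (\<lambda>x. frechet_derivative f (at x within S) v)"
    proof (rule Suc.IH)
      fix x assume "x \<in> S"
      then obtain N where N: "open N" "x \<in> N" "Ck_on (Suc k) (S \<inter> N) f" using Suc.prems by blast
      have "Ck_on k (S \<inter> N) (\<lambda>y. frechet_derivative f (at y within S \<inter> N) v)" using N by auto
      then have "Ck_on k (S \<inter> N) (\<lambda>y. frechet_derivative f (at y within S) v)"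
        by (subst Ck_on_cong[where g = "\<lambda>y. frechet_derivative f (at y within S \<inter> N) v"]) (use at N in auto)
      then show "\<exists>N. open N \<and> x \<in> N \<and> Ck_on k (S \<inter> N) (\<lambda>x. frechet_derivative f (at x within S) v)"
        using N by blast
    qed
  qed
qed

lemma smooth_on_cong: "(\<And>x. x \<in> S \<Longrightarrow> f x = g x) \<Longrightarrow> smooth_on S f \<longleftrightarrow> smooth_on S g"
  unfolding smooth_on_def using Ck_on_cong by metis

lemma smooth_on_const: "fat S \<Longrightarrow> smooth_on S (\<lambda>x. c)"
  by (simp add: smooth_on_def Ck_on_const)

lemma smooth_on_bounded_linear: "fat S \<Longrightarrow> bounded_linear L \<Longrightarrow> smooth_on S L"
  by (simp add: smooth_on_def Ck_on_bounded_linear)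

lemma smooth_on_add: "fat S \<Longrightarrow> smooth_on S f \<Longrightarrow> smooth_on S g \<Longrightarrow> smooth_on S (\<lambda>x. f x + g x)"
  by (simp add: smooth_on_def Ck_on_add)

lemma smooth_on_sum:
  "fat S \<Longrightarrow> finite I \<Longrightarrow> (\<And>i. i \<in> I \<Longrightarrow> smooth_on S (f i)) \<Longrightarrow> smooth_on S (\<lambda>x. \<Sum>i\<in>I. f i x)"
  by (simp add: smooth_on_def Ck_on_sum)

lemma smooth_on_scaleR:
  fixes f :: "'a::euclidean_space \<Rightarrow> real"
  shows "fat S \<Longrightarrow> smooth_on S f \<Longrightarrow> smooth_on S g \<Longrightarrow> smooth_on S (\<lambda>x. f x *\<^sub>R g x)"
  by (simp add: smooth_on_def Ck_on_scaleR)

lemma smooth_on_compose: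
  fixes f :: "'b::euclidean_space \<Rightarrow> 'c::real_normed_vector" and h :: "'a::euclidean_space \<Rightarrow> 'b"
  shows "fat S \<Longrightarrow> fat T \<Longrightarrow> h ` S \<subseteq> T \<Longrightarrow> smooth_on T f \<Longrightarrow> smooth_on S h \<Longrightarrow> smooth_on S (\<lambda>x. f (h x))"
  by (simp add: smooth_on_def Ck_on_compose)

lemma smooth_on_inner:
  fixes f :: "'a::euclidean_space \<Rightarrow> 'b::euclidean_space"
  shows "fat S \<Longrightarrow> smooth_on S f \<Longrightarrow> smooth_on S (\<lambda>x. f x \<bullet> i)"
  by (simp add: smooth_on_def Ck_on_inner)

lemma smooth_on_subset: "fat S' \<Longrightarrow> S' \<subseteq> S \<Longrightarrow> smooth_on S f \<Longrightarrow> smooth_on S' f"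
  unfolding smooth_on_def using Ck_on_subset by metis

lemma smooth_on_local:
  assumes "fat S" "\<And>x. x \<in> S \<Longrightarrow> \<exists>N. open N \<and> x \<in> N \<and> smooth_on (S \<inter> N) f"
  shows "smooth_on S f"
  unfolding smooth_on_def
proof
  fix k
  show "Ck_on k S f"
    by (rule Ck_on_local[OF assms(1)]) (use assms(2) in \<open>auto simp: smooth_on_def\<close>)
qed

lemma smooth_on_continuous: "smooth_on S f \<Longrightarrow> continuous_on S f"
  unfolding smooth_on_def by (metis Ck_on.simps(1))

lemma smooth_on_derivative_within:
  "smooth_on S f \<Longrightarrow> smooth_on S (\<lambda>x. frechet_derivative f (at x within S) v)"
  unfolding smooth_on_def using Ck_on.simps(2) by blast

lemma smooth_on_has_derivative_within:
  "smooth_on S f \<Longrightarrow> x \<in> S \<Longrightarrow> (f has_derivative frechet_derivative f (at x within S)) (at x within S)"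
  unfolding smooth_on_def using Ck_on_SucE by blast

lemma smooth_on_has_derivative:
  "smooth_on S f \<Longrightarrow> open S \<Longrightarrow> x \<in> S \<Longrightarrow> (f has_derivative frechet_derivative f (at x)) (at x)"
  using smooth_on_has_derivative_within[of S f x] at_within_open[of x S] by simp

lemma smooth_on_derivative:
  assumes "smooth_on S f" "open S"
  shows "smooth_on S (\<lambda>x. frechet_derivative f (at x) v)"
  using smooth_on_derivative_within[OF assms(1), of v] at_within_open[OF _ assms(2)]
  by (subst smooth_on_cong[where g = "\<lambda>x. frechet_derivative f (at x within S) v"]) auto

lemma smooth_on_linear_apply:
  fixes L :: "'a::euclidean_space \<Rightarrow> 'b::euclidean_space \<Rightarrow> 'c::real_normed_vector"
  assumes "fat S" "\<And>x. x \<in> S \<Longrightarrow> linear (L x)" "\<And>v. smooth_on S (\<lambda>x. L x v)" "smooth_on S f"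
  shows "smooth_on S (\<lambda>x. L x (f x))"
proof -
  have "smooth_on S (\<lambda>x. \<Sum>i\<in>Basis. (f x \<bullet> i) *\<^sub>R L x i)"
    using assms by (intro smooth_on_sum smooth_on_scaleR smooth_on_inner) auto
  moreover have "(\<Sum>i\<in>Basis. (f x \<bullet> i) *\<^sub>R L x i) = L x (f x)" if "x \<in> S" for x
    using linear_sum[OF assms(2)[OF that], of "\<lambda>i. (f x \<bullet> i) *\<^sub>R i" Basis]
    by (simp add: linear_scale[OF assms(2)[OF that]] euclidean_representation)
  ultimately show ?thesis
    using smooth_on_cong[of S "\<lambda>x. \<Sum>i\<in>Basis. (f x \<bullet> i) *\<^sub>R L x i" "\<lambda>x. L x (f x)"] by simp
qed

lemma has_derivative_linear_apply:
  fixes L :: "'a::real_normed_vector \<Rightarrow> 'b::euclidean_space \<Rightarrow> 'c::real_normed_vector"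
  assumes lin: "\<And>s. s \<in> T \<Longrightarrow> linear (L s)" and t: "t \<in> T"
    and L: "\<And>w. ((\<lambda>s. L s w) has_derivative L' w) (at t within T)"
    and y: "(y has_derivative y') (at t within T)"
  shows "((\<lambda>s. L s (y s)) has_derivative (\<lambda>h. L' (y t) h + L t (y' h))) (at t within T)"
proof -
  have rep: "L s w = (\<Sum>i\<in>Basis. (w \<bullet> i) *\<^sub>R L s i)" if "s \<in> T" for s w
    using linear_sum[OF lin[OF that], of "\<lambda>i. (w \<bullet> i) *\<^sub>R i" Basis]
    by (simp add: linear_scale[OF lin[OF that]] euclidean_representation)
  have "((\<lambda>s. (y s - y t) \<bullet> i) has_derivative (\<lambda>h. y' h \<bullet> i)) (at t within T)" for i
    by (rule has_derivative_eq_rhs[OF has_derivative_inner_left[OF has_derivative_diff[OF y has_derivative_const]]]) simp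
  then have "((\<lambda>s. ((y s - y t) \<bullet> i) *\<^sub>R L s i) has_derivative (\<lambda>h. (y' h \<bullet> i) *\<^sub>R L t i)) (at t within T)" for i
    by (rule has_derivative_eq_rhs[OF has_derivative_scaleR[OF _ L[of i]]]) simp
  then have "((\<lambda>s. L s (y t) + (\<Sum>i\<in>Basis. ((y s - y t) \<bullet> i) *\<^sub>R L s i)) has_derivative
      (\<lambda>h. L' (y t) h + (\<Sum>i\<in>Basis. (y' h \<bullet> i) *\<^sub>R L t i))) (at t within T)"
    by (intro has_derivative_add has_derivative_sum L)
  then have *: "((\<lambda>s. L s (y t) + (\<Sum>i\<in>Basis. ((y s - y t) \<bullet> i) *\<^sub>R L s i)) has_derivative
      (\<lambda>h. L' (y t) h + L t (y' h))) (at t within T)"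
    unfolding rep[OF t, symmetric] .
  have eq: "L s (y s) = L s (y t) + (\<Sum>i\<in>Basis. ((y s - y t) \<bullet> i) *\<^sub>R L s i)" if "s \<in> T" for s
    using rep[OF that, of "y s - y t"] linear_diff[OF lin[OF that], of "y s" "y t"]
    by (simp add: algebra_simps)
  show ?thesis
    by (rule has_derivative_transform[OF t _ *]) (rule eq)
qed

lemma has_derivative_bilinear_apply:
  fixes B :: "'a::real_normed_vector \<Rightarrow> 'b::euclidean_space \<Rightarrow> 'b \<Rightarrow> 'c::real_normed_vector"
  assumes lin: "\<And>s. s \<in> T \<Longrightarrow> bilinear (B s)" and t: "t \<in> T"
    and B: "\<And>v w. ((\<lambda>s. B s v w) has_derivative B' v w) (at t within T)"
    and y: "(y has_derivative y') (at t within T)" and z: "(z has_derivative z') (at t within T)"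
  shows "((\<lambda>s. B s (y s) (z s)) has_derivative
    (\<lambda>h. B' (y t) (z t) h + B t (y' h) (z t) + B t (y t) (z' h))) (at t within T)"
proof -
  have lin1: "linear (\<lambda>v. B s v w)" and lin2: "linear (\<lambda>w. B s v w)" if "s \<in> T" for s v w
    using lin[OF that] by (auto simp: bilinear_def)
  have 1: "((\<lambda>s. B s (y s) w) has_derivative (\<lambda>h. B' (y t) w h + B t (y' h) w)) (at t within T)" for w
    by (rule has_derivative_linear_apply[of T "\<lambda>s v. B s v w" t "\<lambda>v. B' v w" y y', OF lin1 t B y])
  show ?thesis
    by (rule has_derivative_linear_apply[of T "\<lambda>s. B s (y s)" t "\<lambda>w h. B' (y t) w h + B t (y' h) w" z z', OF lin2 t 1 z])
qed

lemma second_difference_mean_value: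
  fixes f :: "'a::euclidean_space \<Rightarrow> real"
  assumes f: "smooth_on S f" and S: "open S" and h: "h > 0"
    and in_S: "\<And>s t. 0 \<le> s \<Longrightarrow> s \<le> h \<Longrightarrow> 0 \<le> t \<Longrightarrow> t \<le> h \<Longrightarrow> x + s *\<^sub>R u + t *\<^sub>R v \<in> S"
  obtains s t where "0 < s" "s < h" "0 < t" "t < h"
    "f (x + h *\<^sub>R u + h *\<^sub>R v) - f (x + h *\<^sub>R u) - f (x + h *\<^sub>R v) + f x
      = h * h * frechet_derivative (\<lambda>y. frechet_derivative f (at y) u) (at (x + s *\<^sub>R u + t *\<^sub>R v)) v"
proof -
  let ?f' = "\<lambda>y. frechet_derivative f (at y)"
  have f': "(f has_derivative ?f' y) (at y)" if "y \<in> S" for y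
    using smooth_on_has_derivative[OF f S that] .
  have f'': "((\<lambda>y. ?f' y u) has_derivative frechet_derivative (\<lambda>y. ?f' y u) (at y)) (at y)" if "y \<in> S" for y
    using smooth_on_has_derivative[OF smooth_on_derivative[OF f S] S that] .
  have d: "((\<lambda>s. g (p + s *\<^sub>R w)) has_real_derivative g' w) (at s)"
    if "(g has_derivative g') (at (p + s *\<^sub>R w))" for g :: "'a \<Rightarrow> real" and g' p w s
  proof -
    have "((\<lambda>s. p + s *\<^sub>R w) has_derivative (\<lambda>h. h *\<^sub>R w)) (at s)"
      by (auto intro!: derivative_eq_intros)
    from has_derivative_compose[OF this that]
    have "((\<lambda>s. g (p + s *\<^sub>R w)) has_derivative (\<lambda>h. g' (h *\<^sub>R w))) (at s)" .
    moreover have "(\<lambda>h. g' (h *\<^sub>R w)) = (*) (g' w)"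
      using linear_scale[OF has_derivative_linear[OF that]] by (auto simp: fun_eq_iff mult.commute)
    ultimately show ?thesis by (simp add: has_field_derivative_def)
  qed
  define \<phi> where "\<phi> s = f (x + h *\<^sub>R v + s *\<^sub>R u) - f (x + s *\<^sub>R u)" for s
  have "(\<phi> has_real_derivative ?f' (x + h *\<^sub>R v + s *\<^sub>R u) u - ?f' (x + s *\<^sub>R u) u) (at s)"
    if "0 \<le> s" "s \<le> h" for s
    unfolding \<phi>_def using in_S[of s h] in_S[of s 0] that h
    by (intro DERIV_diff d f') (auto simp: algebra_simps)
  from MVT2[OF h this] obtain s where s: "0 < s" "s < h"
    "\<phi> h - \<phi> 0 = h * (?f' (x + h *\<^sub>R v + s *\<^sub>R u) u - ?f' (x + s *\<^sub>R u) u)" by auto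
  have "((\<lambda>t. ?f' (x + s *\<^sub>R u + t *\<^sub>R v) u) has_real_derivative
      frechet_derivative (\<lambda>y. ?f' y u) (at (x + s *\<^sub>R u + t *\<^sub>R v)) v) (at t)"
    if "0 \<le> t" "t \<le> h" for t
    by (rule d[of "\<lambda>y. ?f' y u"]) (use in_S[of s t] that s in \<open>auto intro: f''\<close>)
  from MVT2[OF h this] obtain t where t: "0 < t" "t < h"
    "?f' (x + s *\<^sub>R u + h *\<^sub>R v) u - ?f' (x + s *\<^sub>R u + 0 *\<^sub>R v) u
      = h * frechet_derivative (\<lambda>y. ?f' y u) (at (x + s *\<^sub>R u + t *\<^sub>R v)) v" by auto
  have 1: "x + h *\<^sub>R v + h *\<^sub>R u = x + h *\<^sub>R u + h *\<^sub>R v" for h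
    by (simp add: add_ac)
  have 2: "x + h *\<^sub>R v + s *\<^sub>R u = x + s *\<^sub>R u + h *\<^sub>R v" by (simp add: add_ac)
  have "\<phi> h - \<phi> 0 = h * (h * frechet_derivative (\<lambda>y. ?f' y u) (at (x + s *\<^sub>R u + t *\<^sub>R v)) v)"
    using s(3) t(3) unfolding 2 by simp
  moreover have "\<phi> h - \<phi> 0 = f (x + h *\<^sub>R u + h *\<^sub>R v) - f (x + h *\<^sub>R u) - f (x + h *\<^sub>R v) + f x"
    unfolding \<phi>_def 1 by simp
  ultimately show thesis using that[OF s(1,2) t(1,2)] by (simp add: mult.assoc)
qed

lemma second_derivative_symmetric_real:
  fixes f :: "'a::euclidean_space \<Rightarrow> real"
  assumes f: "smooth_on S f" and S: "open S" "x \<in> S"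
  shows "frechet_derivative (\<lambda>y. frechet_derivative f (at y) u) (at x) v
       = frechet_derivative (\<lambda>y. frechet_derivative f (at y) v) (at x) u" (is "?A u v x = ?A v u x")
proof (rule ccontr)
  assume neq: "?A u v x \<noteq> ?A v u x"
  define e where "e = \<bar>?A u v x - ?A v u x\<bar> / 2"
  have e: "e > 0" using neq by (simp add: e_def)
  have cont: "isCont (?A u v) x" for u v
  proof -
    have "continuous_on S (?A u v)"
      by (rule smooth_on_continuous[OF smooth_on_derivative[OF smooth_on_derivative[OF f S(1)] S(1)]])
    then show ?thesis using continuous_on_eq_continuous_at[OF S(1)] S(2) by blast
  qed
  have ex: "\<exists>d>0. \<forall>y. dist y x < d \<longrightarrow> dist (?A u v y) (?A u v x) < e" for u v
    using cont[of u v, unfolded continuous_at_eps_delta] e by blast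
  obtain d1 where d1: "d1 > 0" "\<And>y. dist y x < d1 \<Longrightarrow> dist (?A u v y) (?A u v x) < e"
    using ex[of u v] by blast
  obtain d2 where d2: "d2 > 0" "\<And>y. dist y x < d2 \<Longrightarrow> dist (?A v u y) (?A v u x) < e"
    using ex[of v u] by blast
  obtain d3 where d3: "d3 > 0" "ball x d3 \<subseteq> S" using S open_contains_ball by blast
  define d where "d = min d1 (min d2 d3)"
  define h where "h = d / (2 * (norm u + norm v + 1))"
  have d: "d > 0" using d1 d2 d3 by (simp add: d_def)
  then have h: "h > 0" unfolding h_def by (simp add: add_nonneg_pos)
  have near: "dist (x + s *\<^sub>R u + t *\<^sub>R v) x < d" if "0 \<le> s" "s \<le> h" "0 \<le> t" "t \<le> h" for s t
  proof -
    have "dist (x + s *\<^sub>R u + t *\<^sub>R v) x = norm (s *\<^sub>R u + t *\<^sub>R v)" by (simp add: dist_norm)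
    also have "\<dots> \<le> s * norm u + t * norm v" using that by (intro norm_triangle_le) simp
    also have "\<dots> \<le> h * norm u + h * norm v" using that by (intro add_mono mult_right_mono) auto
    also have "\<dots> \<le> h * (norm u + norm v + 1)" using h by (simp add: algebra_simps)
    also have "\<dots> = d / 2"
    proof -
      have "norm u + norm v + 1 > 0" by (simp add: add_nonneg_pos)
      then show ?thesis unfolding h_def by (simp add: field_simps)
    qed
    also have "\<dots> < d" using d by simp
    finally show ?thesis .
  qed
  have in_S: "x + s *\<^sub>R u + t *\<^sub>R v \<in> S" if "0 \<le> s" "s \<le> h" "0 \<le> t" "t \<le> h" for s t
    using near[OF that] d3(2) by (auto simp: d_def dist_commute subset_iff)
  obtain s t where st: "0 < s" "s < h" "0 < t" "t < h"
    "f (x + h *\<^sub>R u + h *\<^sub>R v) - f (x + h *\<^sub>R u) - f (x + h *\<^sub>R v) + f x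
      = h * h * ?A u v (x + s *\<^sub>R u + t *\<^sub>R v)"
    by (rule second_difference_mean_value[OF f S(1) h in_S])
  have in_S': "x + s *\<^sub>R v + t *\<^sub>R u \<in> S" if "0 \<le> s" "s \<le> h" "0 \<le> t" "t \<le> h" for s t
    using in_S[OF that(3,4,1,2)] by (simp add: add_ac)
  obtain s' t' where st': "0 < s'" "s' < h" "0 < t'" "t' < h"
    "f (x + h *\<^sub>R v + h *\<^sub>R u) - f (x + h *\<^sub>R v) - f (x + h *\<^sub>R u) + f x
      = h * h * ?A v u (x + s' *\<^sub>R v + t' *\<^sub>R u)"
    by (rule second_difference_mean_value[OF f S(1) h in_S'])
  have comm: "x + h *\<^sub>R v + h *\<^sub>R u = x + h *\<^sub>R u + h *\<^sub>R v" by (simp add: add_ac)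
  have "h * h * ?A u v (x + s *\<^sub>R u + t *\<^sub>R v) = h * h * ?A v u (x + s' *\<^sub>R v + t' *\<^sub>R u)"
    using st(5) st'(5) unfolding comm by linarith
  then have eq: "?A u v (x + s *\<^sub>R u + t *\<^sub>R v) = ?A v u (x + s' *\<^sub>R v + t' *\<^sub>R u)" using h by simp
  have "dist (?A u v (x + s *\<^sub>R u + t *\<^sub>R v)) (?A u v x) < e"
    using near[of s t] st by (intro d1(2)) (auto simp: d_def)
  moreover have "dist (?A v u (x + s' *\<^sub>R v + t' *\<^sub>R u)) (?A v u x) < e"
    using near[of t' s'] st' by (intro d2(2)) (auto simp: d_def add_ac)
  ultimately have "\<bar>?A u v x - ?A v u x\<bar> < 2 * e" unfolding eq dist_real_def by linarith
  then show False by (simp add: e_def)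
qed

lemma second_derivative_symmetric:
  fixes f :: "'a::euclidean_space \<Rightarrow> 'b::euclidean_space"
  assumes f: "smooth_on S f" and S: "open S" "x \<in> S"
  shows "frechet_derivative (\<lambda>y. frechet_derivative f (at y) u) (at x) v
       = frechet_derivative (\<lambda>y. frechet_derivative f (at y) v) (at x) u"
proof (rule euclidean_eqI)
  fix i :: 'b assume "i \<in> Basis"
  have comp: "frechet_derivative (\<lambda>y. g y \<bullet> i) (at y) w = frechet_derivative g (at y) w \<bullet> i"
    if "smooth_on S g" "y \<in> S" for g :: "'a \<Rightarrow> 'b" and y w
    using has_derivative_inner_left[OF smooth_on_has_derivative[OF that(1) S(1) that(2)]]
    by (metis frechet_derivative_at)
  have sm: "smooth_on S (\<lambda>y. frechet_derivative f (at y) u)" for u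
    by (rule smooth_on_derivative[OF f S(1)])
  have *: "frechet_derivative (\<lambda>y. frechet_derivative (\<lambda>y. f y \<bullet> i) (at y) u) (at x) v
      = frechet_derivative (\<lambda>y. frechet_derivative f (at y) u) (at x) v \<bullet> i" for u v
  proof -
    have "frechet_derivative (\<lambda>y. frechet_derivative (\<lambda>y. f y \<bullet> i) (at y) u) (at x)
        = frechet_derivative (\<lambda>y. frechet_derivative f (at y) u \<bullet> i) (at x)"
    proof (rule sym, rule frechet_derivative_transform_within_open[OF _ S])
      show "(\<lambda>y. frechet_derivative f (at y) u \<bullet> i) differentiable at x"
        using has_derivative_inner_left[OF smooth_on_has_derivative[OF sm S]] by (rule differentiableI)
    qed (simp add: comp[OF f])
    then show ?thesis using comp[OF sm S(2)] by simp
  qed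
  have "fat S" using S by (simp add: fat_open)
  show "frechet_derivative (\<lambda>y. frechet_derivative f (at y) u) (at x) v \<bullet> i
      = frechet_derivative (\<lambda>y. frechet_derivative f (at y) v) (at x) u \<bullet> i"
    using second_derivative_symmetric_real[OF smooth_on_inner[OF \<open>fat S\<close> f] S, of i u v] by (simp add: *)
qed

section \<open>Charts and coordinates\<close>

locale smooth_manifold =
  fixes A :: "('m::{t2_space,second_countable_topology}, 'e::euclidean_space) chart set"
  assumes atlas: "smooth_atlas A"
begin

abbreviation M :: "('m, 'e) chart set" where "M \<equiv> maximal_atlas A"

definition Jac :: "('m, 'e) chart \<Rightarrow> ('m, 'e) chart \<Rightarrow> 'e \<Rightarrow> 'e \<Rightarrow> 'e"
  where "Jac c d x = frechet_derivative (cmap d \<circ> cinv c) (at x)"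

definition rep :: "('m, 'e) chart \<Rightarrow> ('m \<Rightarrow> 'e) \<Rightarrow> 'e \<Rightarrow> 'e"
  where "rep c X x = coord A c (cinv c x) (X (cinv c x))"

lemma atlas_maximal: "c \<in> A \<Longrightarrow> c \<in> M"
  using atlas by (auto simp: smooth_atlas_def maximal_atlas_def)

lemma ex_chart: "\<exists>c. c \<in> A \<and> p \<in> cdom c"
proof -
  have "p \<in> (\<Union>c\<in>A. cdom c)" using atlas by (simp add: smooth_atlas_def)
  then show ?thesis by blast
qed

lemma chart_at: "chart_at A p \<in> A" "p \<in> cdom (chart_at A p)" "chart_at A p \<in> M"
  using someI_ex[OF ex_chart[of p]] atlas_maximal by (auto simp: chart_at_def)

lemma is_chart: "c \<in> M \<Longrightarrow> is_chart c"
  by (simp add: maximal_atlas_def)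

lemma homeo: "c \<in> M \<Longrightarrow> homeomorphism (cdom c) (cmap c ` cdom c) (cmap c) (cinv c)"
  using is_chart by (simp add: is_chart_def)

lemma open_cdom [simp]: "c \<in> M \<Longrightarrow> open (cdom c)"
  using is_chart by (simp add: is_chart_def)

lemma cinv_cmap [simp]: "c \<in> M \<Longrightarrow> p \<in> cdom c \<Longrightarrow> cinv c (cmap c p) = p"
  using homeo by (auto simp: homeomorphism_def)

lemma cont_cinv: "c \<in> M \<Longrightarrow> continuous_on (cmap c ` cdom c) (cinv c)"
  using homeo by (simp add: homeomorphism_def)

lemma open_image:
  assumes "c \<in> M" "open U"
  shows "open (cmap c ` (cdom c \<inter> U))"
proof -
  have "cmap c ` (cdom c \<inter> U) = cinv c -` U \<inter> cmap c ` cdom c"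
    using assms(1) by (auto simp: image_iff)
  moreover have "open (cmap c ` cdom c)" using is_chart[OF assms(1)] by (simp add: is_chart_def)
  ultimately show ?thesis
    using continuous_on_open_vimage[of "cmap c ` cdom c" "cinv c"] cont_cinv[OF assms(1)] assms(2) by simp
qed

lemma open_image_subset: "c \<in> M \<Longrightarrow> open U \<Longrightarrow> U \<subseteq> cdom c \<Longrightarrow> open (cmap c ` U)"
  using open_image[of c U] by (simp add: Int_absorb1)

lemma open_overlap: "c \<in> M \<Longrightarrow> d \<in> M \<Longrightarrow> open (cmap c ` (cdom c \<inter> cdom d))"
  by (simp add: open_image)

lemma smooth_on_chartwise:
  assumes c: "c \<in> M" and U: "open U"
    and F: "\<And>e. e \<in> A \<Longrightarrow> smooth_on (cmap c ` (cdom c \<inter> cdom e \<inter> U)) F"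
  shows "smooth_on (cmap c ` (cdom c \<inter> U)) F"
proof (rule smooth_on_local)
  show "fat (cmap c ` (cdom c \<inter> U))" using open_image[OF c U] by (rule fat_open)
  fix x assume "x \<in> cmap c ` (cdom c \<inter> U)"
  then obtain p where p: "p \<in> cdom c" "p \<in> U" "x = cmap c p" by auto
  let ?N = "cmap c ` (cdom c \<inter> cdom (chart_at A p) \<inter> U)"
  have "open ?N" using c U chart_at(3) by (intro open_image_subset open_Int open_cdom) auto
  moreover have "cmap c ` (cdom c \<inter> U) \<inter> ?N = ?N" by auto
  moreover have "x \<in> ?N" using p chart_at(2) by auto
  ultimately show "\<exists>N. open N \<and> x \<in> N \<and> smooth_on (cmap c ` (cdom c \<inter> U) \<inter> N) F"
    using F[OF chart_at(1)] by metis
qed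

lemma smooth_transition:
  assumes c: "c \<in> M" and d: "d \<in> M"
  shows "smooth_on (cmap c ` (cdom c \<inter> cdom d)) (cmap d \<circ> cinv c)"
proof (rule smooth_on_chartwise[OF c open_cdom[OF d]])
  fix e assume e: "e \<in> A"
  have eM: "e \<in> M" using e atlas_maximal by simp
  let ?U = "cdom c \<inter> cdom e \<inter> cdom d"
  have oc: "open (cmap c ` ?U)" and oe: "open (cmap e ` ?U)"
    using c d eM by (auto intro!: open_image_subset open_Int)
  have "compatible c e" "compatible d e" using c d e by (auto simp: maximal_atlas_def)
  then have ce: "smooth_on (cmap c ` (cdom c \<inter> cdom e)) (cmap e \<circ> cinv c)"
    and ed: "smooth_on (cmap e ` (cdom d \<inter> cdom e)) (cmap d \<circ> cinv e)"
    by (auto simp: compatible_def)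
  have "smooth_on (cmap c ` ?U) (\<lambda>x. (cmap d \<circ> cinv e) ((cmap e \<circ> cinv c) x))"
  proof (rule smooth_on_compose[where f = "cmap d \<circ> cinv e" and h = "cmap e \<circ> cinv c" and T = "cmap e ` ?U"])
    show "fat (cmap c ` ?U)" "fat (cmap e ` ?U)" using oc oe by (auto intro: fat_open)
    show "(cmap e \<circ> cinv c) ` cmap c ` ?U \<subseteq> cmap e ` ?U" using c by (auto simp: image_iff)
    show "smooth_on (cmap e ` ?U) (cmap d \<circ> cinv e)"
      by (rule smooth_on_subset[OF _ _ ed]) (use oe in \<open>auto intro: fat_open\<close>)
    show "smooth_on (cmap c ` ?U) (cmap e \<circ> cinv c)"
      by (rule smooth_on_subset[OF _ _ ce]) (use oc in \<open>auto intro: fat_open\<close>)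
  qed
  then show "smooth_on (cmap c ` ?U) (cmap d \<circ> cinv c)"
    by (rule smooth_on_cong[THEN iffD1, rotated]) (use c eM in auto)
qed

lemma Jac_has_derivative:
  assumes "c \<in> M" "d \<in> M" "p \<in> cdom c" "p \<in> cdom d"
  shows "((cmap d \<circ> cinv c) has_derivative Jac c d (cmap c p)) (at (cmap c p))"
  unfolding Jac_def using assms
  by (intro smooth_on_has_derivative[OF smooth_transition open_overlap]) auto

lemma Jac_linear:
  "c \<in> M \<Longrightarrow> d \<in> M \<Longrightarrow> p \<in> cdom c \<Longrightarrow> p \<in> cdom d \<Longrightarrow> linear (Jac c d (cmap c p))"
  using Jac_has_derivative by (rule has_derivative_linear)

lemma smooth_Jac:
  assumes "c \<in> M" "d \<in> M"
  shows "smooth_on (cmap c ` (cdom c \<inter> cdom d)) (\<lambda>x. Jac c d x v)"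
  unfolding Jac_def using smooth_on_derivative[OF smooth_transition[OF assms] open_overlap[OF assms]] .

lemma Jac_Jac:
  assumes "c \<in> M" "d \<in> M" "e \<in> M" "p \<in> cdom c" "p \<in> cdom d" "p \<in> cdom e"
  shows "Jac d e (cmap d p) (Jac c d (cmap c p) v) = Jac c e (cmap c p) v"
proof -
  have "((cmap d \<circ> cinv c) has_derivative Jac c d (cmap c p)) (at (cmap c p))"
    using assms by (intro Jac_has_derivative)
  moreover have "((cmap e \<circ> cinv d) has_derivative Jac d e (cmap d p)) (at ((cmap d \<circ> cinv c) (cmap c p)))"
    using assms Jac_has_derivative[of d e p] by simp
  ultimately have 1: "((\<lambda>x. (cmap e \<circ> cinv d) ((cmap d \<circ> cinv c) x)) has_derivative
      (\<lambda>v. Jac d e (cmap d p) (Jac c d (cmap c p) v))) (at (cmap c p))"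
    by (rule has_derivative_compose)
  have "((cmap e \<circ> cinv c) has_derivative (\<lambda>v. Jac d e (cmap d p) (Jac c d (cmap c p) v))) (at (cmap c p))"
    by (rule has_derivative_transform_within_open[OF 1 open_overlap[OF assms(1,2)]]) (use assms in auto)
  then have "(\<lambda>v. Jac d e (cmap d p) (Jac c d (cmap c p) v)) = Jac c e (cmap c p)"
    using Jac_has_derivative[of c e p] assms by (metis has_derivative_unique)
  then show ?thesis by (rule fun_cong)
qed

lemma Jac_id:
  assumes "c \<in> M" "p \<in> cdom c"
  shows "Jac c c (cmap c p) v = v"
proof -
  have "((cmap c \<circ> cinv c) has_derivative (\<lambda>v. v)) (at (cmap c p))"
    by (rule has_derivative_transform_within_open[OF has_derivative_ident open_overlap[OF assms(1,1)]])
       (use assms in auto)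
  then have "(\<lambda>v. v) = Jac c c (cmap c p)"
    using Jac_has_derivative[of c c p] assms by (metis has_derivative_unique)
  then show ?thesis by metis
qed

lemma coord_eq: "coord A c p = Jac (chart_at A p) c (cmap (chart_at A p) p)"
  by (simp add: fun_eq_iff coord_def Jac_def)

lemma coord_field_eq: "coord_field A c u p = Jac c (chart_at A p) (cmap c p) u"
  by (simp add: coord_field_def Jac_def)

lemma coord_linear: "c \<in> M \<Longrightarrow> p \<in> cdom c \<Longrightarrow> linear (coord A c p)"
  unfolding coord_eq by (intro Jac_linear chart_at)

lemma coord_field_linear: "c \<in> M \<Longrightarrow> p \<in> cdom c \<Longrightarrow> linear (\<lambda>u. coord_field A c u p)"
  unfolding coord_field_eq by (simp add: Jac_linear chart_at)

lemma coord_change: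
  "c \<in> M \<Longrightarrow> d \<in> M \<Longrightarrow> p \<in> cdom c \<Longrightarrow> p \<in> cdom d \<Longrightarrow> coord A d p v = Jac c d (cmap c p) (coord A c p v)"
  unfolding coord_eq by (simp add: Jac_Jac chart_at)

lemma coord_coord_field_change :
  "c \<in> M \<Longrightarrow> d \<in> M \<Longrightarrow> p \<in> cdom c \<Longrightarrow> p \<in> cdom d \<Longrightarrow> coord A d p (coord_field A c u p) = Jac c d (cmap c p) u"
  unfolding coord_eq coord_field_eq by (simp add: Jac_Jac chart_at)

lemma coord_coord_field [simp]: "c \<in> M \<Longrightarrow> p \<in> cdom c \<Longrightarrow> coord A c p (coord_field A c u p) = u"
  by (simp add: coord_coord_field_change Jac_id)

lemma coord_field_coord [simp]: "c \<in> M \<Longrightarrow> p \<in> cdom c \<Longrightarrow> coord_field A c (coord A c p v) p = v"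
  unfolding coord_eq coord_field_eq by (simp add: Jac_Jac Jac_id chart_at)

lemma coord_chart_at [simp]: "coord A (chart_at A p) p v = v"
  unfolding coord_eq by (simp add: Jac_id chart_at)

lemma smooth_field_chart_change:
  assumes c: "c \<in> M" and d: "d \<in> M" and U: "open U"
    and X: "smooth_on (cmap c ` (cdom c \<inter> U)) (rep c X)"
  shows "smooth_on (cmap d ` (cdom d \<inter> cdom c \<inter> U)) (rep d X)"
proof -
  let ?W = "cdom d \<inter> cdom c \<inter> U"
  have od: "fat (cmap d ` ?W)" and oc: "fat (cmap c ` ?W)"
    using c d U by (auto intro!: fat_open open_image_subset open_Int)
  have F: "smooth_on (cmap c ` ?W) (\<lambda>y. Jac c d y (rep c X y))"
  proof (rule smooth_on_linear_apply[OF oc, where L = "Jac c d" and f = "rep c X"])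
    show "linear (Jac c d x)" if "x \<in> cmap c ` ?W" for x using that c d by (auto simp: Jac_linear)
    show "smooth_on (cmap c ` ?W) (\<lambda>x. Jac c d x v)" for v
      by (rule smooth_on_subset[OF oc _ smooth_Jac[OF c d]]) auto
    show "smooth_on (cmap c ` ?W) (rep c X)"
      by (rule smooth_on_subset[OF oc _ X]) auto
  qed
  have "smooth_on (cmap d ` ?W) (cmap c \<circ> cinv d)"
    by (rule smooth_on_subset[OF od _ smooth_transition[OF d c]]) auto
  moreover have "(cmap c \<circ> cinv d) ` cmap d ` ?W \<subseteq> cmap c ` ?W" using d by auto
  ultimately have "smooth_on (cmap d ` ?W)
      (\<lambda>x. Jac c d ((cmap c \<circ> cinv d) x) (rep c X ((cmap c \<circ> cinv d) x)))"
    using smooth_on_compose[OF od oc _ F] by blast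
  then show ?thesis
  proof (rule smooth_on_cong[THEN iffD1, rotated])
    fix x assume "x \<in> cmap d ` ?W"
    then obtain p where "x = cmap d p" "p \<in> cdom d" "p \<in> cdom c" by auto
    then show "Jac c d ((cmap c \<circ> cinv d) x) (rep c X ((cmap c \<circ> cinv d) x)) = rep d X x"
      using c d by (simp add: rep_def coord_change[of c d p])
  qed
qed

lemma smooth_fun_chart_change:
  assumes c: "c \<in> M" and d: "d \<in> M" and U: "open U"
    and f: "smooth_on (cmap c ` (cdom c \<inter> U)) (f \<circ> cinv c)"
  shows "smooth_on (cmap d ` (cdom d \<inter> cdom c \<inter> U)) (f \<circ> cinv d)"
proof -
  let ?W = "cdom d \<inter> cdom c \<inter> U"
  have od: "fat (cmap d ` ?W)" and oc: "fat (cmap c ` ?W)"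
    using c d U by (auto intro!: fat_open open_image_subset open_Int)
  have F: "smooth_on (cmap c ` ?W) (f \<circ> cinv c)"
    by (rule smooth_on_subset[OF oc _ f]) auto
  have "smooth_on (cmap d ` ?W) (cmap c \<circ> cinv d)"
    by (rule smooth_on_subset[OF od _ smooth_transition[OF d c]]) auto
  moreover have "(cmap c \<circ> cinv d) ` cmap d ` ?W \<subseteq> cmap c ` ?W" using d by auto
  ultimately have "smooth_on (cmap d ` ?W) (\<lambda>x. (f \<circ> cinv c) ((cmap c \<circ> cinv d) x))"
    using smooth_on_compose[OF od oc _ F] by blast
  then show ?thesis
    by (rule smooth_on_cong[THEN iffD1, rotated]) (use c d in auto)
qed

lemma smooth_field_onD:
  assumes X: "smooth_field_on A U X" and c: "c \<in> M"
  shows "smooth_on (cmap c ` (cdom c \<inter> U)) (rep c X)"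
proof -
  have U: "open U" using X by (simp add: smooth_field_on_def)
  show ?thesis
  proof (rule smooth_on_chartwise[OF c U])
    fix e assume e: "e \<in> A"
    have "smooth_on (cmap e ` (cdom e \<inter> U)) (rep e X)"
      using X e by (simp add: smooth_field_on_def rep_def[abs_def])
    from smooth_field_chart_change[OF atlas_maximal[OF e] c U this]
    show "smooth_on (cmap c ` (cdom c \<inter> cdom e \<inter> U)) (rep c X)" .
  qed
qed

lemma smooth_fun_onD:
  assumes f: "smooth_fun_on A U f" and c: "c \<in> M"
  shows "smooth_on (cmap c ` (cdom c \<inter> U)) (f \<circ> cinv c)"
proof -
  have U: "open U" using f by (simp add: smooth_fun_on_def)
  show ?thesis
  proof (rule smooth_on_chartwise[OF c U])
    fix e assume e: "e \<in> A"
    have "smooth_on (cmap e ` (cdom e \<inter> U)) (f \<circ> cinv e)"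
      using f e by (simp add: smooth_fun_on_def)
    from smooth_fun_chart_change[OF atlas_maximal[OF e] c U this]
    show "smooth_on (cmap c ` (cdom c \<inter> cdom e \<inter> U)) (f \<circ> cinv c)" .
  qed
qed

lemma smooth_field_onI:
  assumes c: "c \<in> M" and U: "open U" "U \<subseteq> cdom c" and X: "smooth_on (cmap c ` U) (rep c X)"
  shows "smooth_field_on A U X"
  unfolding smooth_field_on_def
proof (intro conjI ballI)
  fix d assume "d \<in> A"
  then have "smooth_on (cmap d ` (cdom d \<inter> cdom c \<inter> U)) (rep d X)"
    using U X by (intro smooth_field_chart_change[OF c atlas_maximal U(1)]) (auto simp: Int_absorb1)
  moreover have "cdom d \<inter> cdom c \<inter> U = cdom d \<inter> U" using U by auto
  ultimately show "smooth_on (cmap d ` (cdom d \<inter> U)) (\<lambda>x. coord A d (cinv d x) (X (cinv d x)))"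
    by (simp add: rep_def[abs_def])
qed (fact U)

lemma smooth_fun_onI:
  assumes c: "c \<in> M" and U: "open U" "U \<subseteq> cdom c" and f: "smooth_on (cmap c ` U) (f \<circ> cinv c)"
  shows "smooth_fun_on A U f"
  unfolding smooth_fun_on_def
proof (intro conjI ballI)
  fix d assume "d \<in> A"
  then have "smooth_on (cmap d ` (cdom d \<inter> cdom c \<inter> U)) (f \<circ> cinv d)"
    using U f by (intro smooth_fun_chart_change[OF c atlas_maximal U(1)]) (auto simp: Int_absorb1)
  moreover have "cdom d \<inter> cdom c \<inter> U = cdom d \<inter> U" using U by auto
  ultimately show "smooth_on (cmap d ` (cdom d \<inter> U)) (f \<circ> cinv d)" by simp
qed (fact U)

lemma smooth_field_on_subset:
  assumes "smooth_field_on A U X" "open V" "V \<subseteq> U"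
  shows "smooth_field_on A V X"
  unfolding smooth_field_on_def
proof (intro conjI ballI)
  fix c assume c: "c \<in> A"
  then have "fat (cmap c ` (cdom c \<inter> V))"
    using assms(2) open_image[OF atlas_maximal] by (intro fat_open)
  then show "smooth_on (cmap c ` (cdom c \<inter> V)) (\<lambda>x. coord A c (cinv c x) (X (cinv c x)))"
    by (rule smooth_on_subset[where S = "cmap c ` (cdom c \<inter> U)"])
       (use assms c in \<open>auto simp: smooth_field_on_def\<close>)
qed (fact assms)

lemma rep_cmap: "c \<in> M \<Longrightarrow> p \<in> cdom c \<Longrightarrow> rep c X (cmap c p) = coord A c p (X p)"
  by (simp add: rep_def)

lemma rep_coord_field: "c \<in> M \<Longrightarrow> x \<in> cmap c ` cdom c \<Longrightarrow> rep c (coord_field A c u) x = u"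
  by (auto simp: rep_def)

lemma smooth_coord_field: "c \<in> M \<Longrightarrow> smooth_field_on A (cdom c) (coord_field A c u)"
proof (rule smooth_field_onI)
  assume c: "c \<in> M"
  have "fat (cmap c ` cdom c)" using c by (intro fat_open open_image_subset open_Int) auto
  from smooth_on_const[OF this, of u] show "smooth_on (cmap c ` cdom c) (rep c (coord_field A c u))"
    by (rule smooth_on_cong[THEN iffD1, rotated]) (use c rep_coord_field in simp)
qed auto

lemma dirderiv_coord:
  assumes c: "c \<in> M" "p \<in> cdom c" and f: "(f \<circ> cinv c) differentiable (at (cmap c p))"
  shows "dirderiv A p v f = frechet_derivative (f \<circ> cinv c) (at (cmap c p)) (coord A c p v)"
proof -
  let ?k = "chart_at A p"
  note k = chart_at(3,2)[of p]
  have "((cmap c \<circ> cinv ?k) has_derivative Jac ?k c (cmap ?k p)) (at (cmap ?k p))"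
    by (intro Jac_has_derivative k c)
  moreover have "((f \<circ> cinv c) has_derivative frechet_derivative (f \<circ> cinv c) (at (cmap c p)))
      (at ((cmap c \<circ> cinv ?k) (cmap ?k p)))"
    using f k c by (simp add: frechet_derivative_works)
  ultimately have 1: "((\<lambda>x. (f \<circ> cinv c) ((cmap c \<circ> cinv ?k) x)) has_derivative
      (\<lambda>v. frechet_derivative (f \<circ> cinv c) (at (cmap c p)) (Jac ?k c (cmap ?k p) v))) (at (cmap ?k p))"
    by (rule has_derivative_compose)
  have "((f \<circ> cinv ?k) has_derivative
      (\<lambda>v. frechet_derivative (f \<circ> cinv c) (at (cmap c p)) (Jac ?k c (cmap ?k p) v))) (at (cmap ?k p))"
    by (rule has_derivative_transform_within_open[OF 1 open_overlap[OF k(1) c(1)]]) (use k c in auto)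
  from frechet_derivative_at[OF this] show ?thesis
    unfolding dirderiv_def coord_eq by metis
qed

section \<open>The Levi-Civita connection in coordinates\<close>

lemma smooth_field_on_open: "smooth_field_on A U X \<Longrightarrow> open U"
  by (simp add: smooth_field_on_def)

lemma smooth_field_nearI: "smooth_field_on A U X \<Longrightarrow> p \<in> U \<Longrightarrow> smooth_field_near A p X"
  by (auto simp: smooth_field_near_def)

lemma smooth_fun_nearI: "smooth_fun_on A U f \<Longrightarrow> p \<in> U \<Longrightarrow> smooth_fun_near A p f"
  by (auto simp: smooth_fun_near_def)

lemma coord_field_near: "c \<in> M \<Longrightarrow> p \<in> cdom c \<Longrightarrow> smooth_field_near A p (coord_field A c u)"
  by (rule smooth_field_nearI[OF smooth_coord_field])

lemma fat_chart_image: "c \<in> A \<Longrightarrow> open U \<Longrightarrow> fat (cmap c ` (cdom c \<inter> U))"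
  by (intro fat_open open_image atlas_maximal)

lemma smooth_field_on_add:
  assumes "smooth_field_on A U X" "smooth_field_on A U Y"
  shows "smooth_field_on A U (\<lambda>q. X q + Y q)"
  unfolding smooth_field_on_def
proof (intro conjI ballI)
  show U: "open U" using assms(1) by (rule smooth_field_on_open)
  fix c assume c: "c \<in> A"
  have "smooth_on (cmap c ` (cdom c \<inter> U))
      (\<lambda>x. coord A c (cinv c x) (X (cinv c x)) + coord A c (cinv c x) (Y (cinv c x)))"
    using assms c by (intro smooth_on_add fat_chart_image U) (auto simp: smooth_field_on_def)
  then show "smooth_on (cmap c ` (cdom c \<inter> U)) (\<lambda>x. coord A c (cinv c x) (X (cinv c x) + Y (cinv c x)))"
    by (rule smooth_on_cong[THEN iffD1, rotated])
       (use c in \<open>auto simp: atlas_maximal linear_add[OF coord_linear]\<close>)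
qed

lemma smooth_field_on_scaleR:
  assumes "smooth_fun_on A U f" "smooth_field_on A U Y"
  shows "smooth_field_on A U (\<lambda>q. f q *\<^sub>R Y q)"
  unfolding smooth_field_on_def
proof (intro conjI ballI)
  show U: "open U" using assms(2) by (rule smooth_field_on_open)
  fix c assume c: "c \<in> A"
  have "smooth_on (cmap c ` (cdom c \<inter> U)) (\<lambda>x. f (cinv c x) *\<^sub>R coord A c (cinv c x) (Y (cinv c x)))"
    using assms c by (intro smooth_on_scaleR fat_chart_image U) (auto simp: smooth_field_on_def smooth_fun_on_def o_def)
  then show "smooth_on (cmap c ` (cdom c \<inter> U)) (\<lambda>x. coord A c (cinv c x) (f (cinv c x) *\<^sub>R Y (cinv c x)))"
    by (rule smooth_on_cong[THEN iffD1, rotated])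
       (use c in \<open>auto simp: atlas_maximal linear_scale[OF coord_linear]\<close>)
qed

lemma smooth_fun_on_locally_const:
  assumes "open U" "\<And>q. q \<in> U \<Longrightarrow> f q = r"
  shows "smooth_fun_on A U f"
  unfolding smooth_fun_on_def
proof (intro conjI ballI)
  fix c assume c: "c \<in> A"
  have "smooth_on (cmap c ` (cdom c \<inter> U)) (\<lambda>x. r)"
    using c assms(1) by (intro smooth_on_const fat_chart_image)
  then show "smooth_on (cmap c ` (cdom c \<inter> U)) (f \<circ> cinv c)"
    by (rule smooth_on_cong[THEN iffD1, rotated]) (use c assms(2) in \<open>auto simp: atlas_maximal\<close>)
qed (fact assms)

lemma dirderiv_locally_const:
  assumes "open U" "p \<in> U" "\<And>q. q \<in> U \<Longrightarrow> f q = r"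
  shows "dirderiv A p v f = 0"
proof -
  let ?k = "chart_at A p"
  note k = chart_at(3,2)[of p]
  have "((f \<circ> cinv ?k) has_derivative (\<lambda>_. 0)) (at (cmap ?k p))"
    by (rule has_derivative_transform_within_open[OF has_derivative_const[of r] open_image[OF k(1) assms(1)]])
       (use k assms in auto)
  from frechet_derivative_at[OF this] show ?thesis unfolding dirderiv_def by metis
qed

lemma smooth_field_on_zero: "open U \<Longrightarrow> smooth_field_on A U (\<lambda>q. 0)"
  unfolding smooth_field_on_def
proof (intro conjI ballI)
  fix c assume U: "open U" and c: "c \<in> A"
  have "smooth_on (cmap c ` (cdom c \<inter> U)) (\<lambda>x. 0)"
    using c U by (intro smooth_on_const fat_chart_image)
  then show "smooth_on (cmap c ` (cdom c \<inter> U)) (\<lambda>x. coord A c (cinv c x) 0)"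
    by (rule smooth_on_cong[THEN iffD1, rotated])
       (use c in \<open>auto simp: atlas_maximal linear_0[OF coord_linear]\<close>)
qed

lemma smooth_field_on_sum:
  "finite I \<Longrightarrow> open U \<Longrightarrow> (\<And>i. i \<in> I \<Longrightarrow> smooth_field_on A U (E i)) \<Longrightarrow>
    smooth_field_on A U (\<lambda>q. \<Sum>i\<in>I. E i q)"
  by (induction rule: finite_induct) (auto intro: smooth_field_on_zero smooth_field_on_add)

lemma rep_has_derivative:
  assumes "smooth_field_on A U Y" "p \<in> U" "c \<in> M" "p \<in> cdom c"
  shows "(rep c Y has_derivative frechet_derivative (rep c Y) (at (cmap c p))) (at (cmap c p))"
  using assms by (intro smooth_on_has_derivative[OF smooth_field_onD] open_image smooth_field_on_open) auto

lemma rep_coord_field_derivative: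
  assumes "c \<in> M" "p \<in> cdom c"
  shows "frechet_derivative (rep c (coord_field A c u)) (at (cmap c p)) v = 0"
proof -
  have "(rep c (coord_field A c u) has_derivative (\<lambda>_. 0)) (at (cmap c p))"
    by (rule has_derivative_transform_within_open[OF has_derivative_const[of u] open_image_subset[OF assms(1) open_cdom]])
       (use assms in \<open>auto simp: rep_coord_field\<close>)
  from frechet_derivative_at[OF this] show ?thesis by metis
qed

lemma fun_derivative_apply:
  assumes f: "smooth_fun_on A U f" and X: "smooth_field_on A U X" and p: "p \<in> U" and c: "c \<in> M" "p \<in> cdom c"
  shows "dirderiv A p v (\<lambda>q. dirderiv A q (X q) f)
    = frechet_derivative (\<lambda>y. frechet_derivative (f \<circ> cinv c) (at y) (coord A c p (X p))) (at (cmap c p)) (coord A c p v)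
    + frechet_derivative (f \<circ> cinv c) (at (cmap c p)) (frechet_derivative (rep c X) (at (cmap c p)) (coord A c p v))"
proof -
  let ?F = "f \<circ> cinv c" and ?S = "cmap c ` (cdom c \<inter> U)" and ?x = "cmap c p"
  let ?F' = "\<lambda>y. frechet_derivative ?F (at y)"
  have U: "open U" using X by (rule smooth_field_on_open)
  have S: "open ?S" "?x \<in> ?S" using open_image[OF c(1) U] p c by auto
  have F: "smooth_on ?S ?F" by (rule smooth_fun_onD[OF f c(1)])
  have F': "(?F has_derivative ?F' y) (at y)" if "y \<in> ?S" for y
    using smooth_on_has_derivative[OF F S(1) that] .
  have "((\<lambda>y. ?F' y (rep c X y)) has_derivative (\<lambda>h. frechet_derivative (\<lambda>y. ?F' y (rep c X ?x)) (at ?x) h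
      + ?F' ?x (frechet_derivative (rep c X) (at ?x) h))) (at ?x within ?S)"
  proof (rule has_derivative_linear_apply[where L = ?F'])
    show "linear (?F' y)" if "y \<in> ?S" for y using F'[OF that] by (rule has_derivative_linear)
    show "((\<lambda>y. ?F' y w) has_derivative frechet_derivative (\<lambda>y. ?F' y w) (at ?x)) (at ?x within ?S)" for w
      by (rule has_derivative_at_withinI[OF smooth_on_has_derivative[OF smooth_on_derivative[OF F S(1)] S]])
    show "(rep c X has_derivative frechet_derivative (rep c X) (at ?x)) (at ?x within ?S)"
      by (rule has_derivative_at_withinI[OF rep_has_derivative[OF X p c]])
  qed (rule S)
  then have 1: "((\<lambda>y. ?F' y (rep c X y)) has_derivative (\<lambda>h. frechet_derivative (\<lambda>y. ?F' y (rep c X ?x)) (at ?x) h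
      + ?F' ?x (frechet_derivative (rep c X) (at ?x) h))) (at ?x)"
    using at_within_open[OF S(2,1)] by simp
  have 2: "(((\<lambda>q. dirderiv A q (X q) f) \<circ> cinv c) has_derivative (\<lambda>h. frechet_derivative (\<lambda>y. ?F' y (rep c X ?x)) (at ?x) h
      + ?F' ?x (frechet_derivative (rep c X) (at ?x) h))) (at ?x)"
  proof (rule has_derivative_transform_within_open[OF 1 S])
    fix y assume y: "y \<in> ?S"
    then obtain q where q: "y = cmap c q" "q \<in> cdom c" "q \<in> U" by auto
    have "?F differentiable at (cmap c q)" using F'[OF y] q by (auto intro: differentiableI)
    then show "?F' y (rep c X y) = ((\<lambda>q. dirderiv A q (X q) f) \<circ> cinv c) y"
      using q c by (simp add: dirderiv_coord[OF c(1) q(2)] rep_cmap)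
  qed
  show ?thesis
    unfolding dirderiv_coord[OF c differentiableI[OF 2]] frechet_derivative_at[OF 2, symmetric]
    using c by (simp add: rep_cmap)
qed

lemma lie_bracket_coord:
  assumes X: "smooth_field_on A U X" and Y: "smooth_field_on A U Y" and p: "p \<in> U"
    and c: "c \<in> M" "p \<in> cdom c"
  shows "coord A c p (lie_bracket A X Y p)
    = frechet_derivative (rep c Y) (at (cmap c p)) (coord A c p (X p))
    - frechet_derivative (rep c X) (at (cmap c p)) (coord A c p (Y p))" (is "_ = ?w")
proof -
  let ?P = "\<lambda>w. \<forall>f. smooth_fun_near A p f \<longrightarrow>
    dirderiv A p w f = dirderiv A p (X p) (\<lambda>q. dirderiv A q (Y q) f)
                     - dirderiv A p (Y p) (\<lambda>q. dirderiv A q (X q) f)"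
  have U: "open U" using X by (rule smooth_field_on_open)
  have P: "?P (coord_field A c ?w p)"
  proof (intro allI impI)
    fix f assume "smooth_fun_near A p f"
    then obtain U' where U': "p \<in> U'" "smooth_fun_on A U' f" by (auto simp: smooth_fun_near_def)
    let ?V = "U \<inter> U'"
    have V: "open ?V" "p \<in> ?V" using U U' p by (auto simp: smooth_fun_on_def)
    have fV: "smooth_fun_on A ?V f"
      unfolding smooth_fun_on_def
    proof (intro conjI ballI)
      fix d assume d: "d \<in> A"
      show "smooth_on (cmap d ` (cdom d \<inter> ?V)) (f \<circ> cinv d)"
        by (rule smooth_on_subset[OF fat_chart_image[OF d V(1)] _ smooth_fun_onD[OF U'(2) atlas_maximal[OF d]]]) auto
    qed (rule V)
    note XV = smooth_field_on_subset[OF X V(1) Int_lower1] and YV = smooth_field_on_subset[OF Y V(1) Int_lower1]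
    let ?F = "f \<circ> cinv c" and ?x = "cmap c p" and ?S = "cmap c ` (cdom c \<inter> ?V)"
    have S: "open ?S" "?x \<in> ?S" using open_image[OF c(1) V(1)] V c by auto
    have F: "smooth_on ?S ?F" by (rule smooth_fun_onD[OF fV c(1)])
    note F' = smooth_on_has_derivative[OF F S]
    show "dirderiv A p (coord_field A c ?w p) f = dirderiv A p (X p) (\<lambda>q. dirderiv A q (Y q) f)
        - dirderiv A p (Y p) (\<lambda>q. dirderiv A q (X q) f)"
      unfolding fun_derivative_apply[OF fV XV V(2) c] fun_derivative_apply[OF fV YV V(2) c]
        dirderiv_coord[OF c differentiableI[OF F']] coord_coord_field[OF c]
        linear_diff[OF has_derivative_linear[OF F']]
        second_derivative_symmetric[OF F S, of "coord A c p (X p)" "coord A c p (Y p)"]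
      by simp
  qed
  have unique: "w = coord_field A c ?w p" if w: "?P w" for w
  proof -
    have "coord A c p w = ?w"
    proof (rule euclidean_eqI)
      fix i :: 'e assume "i \<in> Basis"
      let ?f = "\<lambda>q. cmap c q \<bullet> i"
      have fat: "fat (cmap c ` cdom c)" using c by (intro fat_open open_image_subset) auto
      have "smooth_on (cmap c ` cdom c) (\<lambda>x. x \<bullet> i)"
        by (intro smooth_on_bounded_linear fat bounded_linear_inner_left)
      then have "smooth_on (cmap c ` cdom c) (?f \<circ> cinv c)"
        by (rule smooth_on_cong[THEN iffD1, rotated]) (use c in auto)
      then have sm: "smooth_fun_on A (cdom c) ?f" using c by (intro smooth_fun_onI) auto
      have near: "smooth_fun_near A p ?f" by (rule smooth_fun_nearI[OF sm c(2)])
      have der: "((?f \<circ> cinv c) has_derivative (\<lambda>h. h \<bullet> i)) (at (cmap c p))"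
        by (rule has_derivative_transform_within_open[OF has_derivative_inner_left[OF has_derivative_ident]
              open_image_subset[OF c(1) open_cdom]]) (use c in auto)
      have "dirderiv A p v ?f = coord A c p v \<bullet> i" for v
        unfolding dirderiv_coord[OF c differentiableI[OF der]] frechet_derivative_at[OF der, symmetric] ..
      then show "coord A c p w \<bullet> i = ?w \<bullet> i"
        using w[rule_format, OF near] P[rule_format, OF near] c by simp
    qed
    then show ?thesis using c coord_field_coord by metis
  qed
  have "lie_bracket A X Y p = coord_field A c ?w p"
    unfolding lie_bracket_def by (rule the_equality[of ?P, OF P unique])
  then show ?thesis using c by simp
qed

end

locale semi_riemannian = smooth_manifold A
  for A :: "('m::{t2_space,second_countable_topology}, 'e::euclidean_space) chart set" +
  fixes g :: "'m \<Rightarrow> 'e \<Rightarrow> 'e \<Rightarrow> real" and D :: "'m \<Rightarrow> 'e \<Rightarrow> ('m \<Rightarrow> 'e) \<Rightarrow> 'e"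
  assumes metric: "semi_riemannian_metric A g" and lc: "levi_civita A g D"
begin

text \<open>Christoffel symbols and metric coefficients in the chart \<open>c\<close>, as bilinear maps of coordinate vectors.\<close>

definition Gam :: "('m, 'e) chart \<Rightarrow> 'm \<Rightarrow> 'e \<Rightarrow> 'e \<Rightarrow> 'e"
  where "Gam c p u w = coord A c p (D p (coord_field A c u p) (coord_field A c w))"

definition Gm :: "('m, 'e) chart \<Rightarrow> 'm \<Rightarrow> 'e \<Rightarrow> 'e \<Rightarrow> real"
  where "Gm c p u w = g p (coord_field A c u p) (coord_field A c w p)"

lemma conn: "affine_connection A D"
  using lc by (simp add: levi_civita_def)

lemma D_linear: "smooth_field_near A p Y \<Longrightarrow> linear (\<lambda>v. D p v Y)"
  using conn by (simp add: affine_connection_def)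

lemma D_add:
  "smooth_field_near A p Y \<Longrightarrow> smooth_field_near A p Z \<Longrightarrow> D p v (\<lambda>q. Y q + Z q) = D p v Y + D p v Z"
  using conn by (simp add: affine_connection_def)

lemma D_leibniz:
  "smooth_fun_near A p f \<Longrightarrow> smooth_field_near A p Y \<Longrightarrow>
    D p v (\<lambda>q. f q *\<^sub>R Y q) = dirderiv A p v f *\<^sub>R Y p + f p *\<^sub>R D p v Y"
  using conn by (simp add: affine_connection_def)

lemma D_smooth:
  "smooth_field_on A U X \<Longrightarrow> smooth_field_on A U Y \<Longrightarrow> smooth_field_on A U (\<lambda>p. D p (X p) Y)"
  using conn by (simp add: affine_connection_def)

lemma D_local:
  assumes Y: "smooth_field_near A p Y" and Z: "smooth_field_near A p Z"
    and W: "open W" "p \<in> W" and eq: "\<And>q. q \<in> W \<Longrightarrow> Y q = Z q"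
  shows "D p v Y = D p v Z"
proof -
  let ?f = "indicat_real W"
  have "smooth_fun_near A p ?f"
    by (rule smooth_fun_nearI[OF smooth_fun_on_locally_const[OF W(1)] W(2)]) auto
  moreover have "dirderiv A p v ?f = 0" by (rule dirderiv_locally_const[OF W]) auto
  ultimately have "D p v (\<lambda>q. ?f q *\<^sub>R X q) = D p v X" if "smooth_field_near A p X" for X
    using D_leibniz[OF _ that] W(2) by simp
  moreover have "(\<lambda>q. ?f q *\<^sub>R Y q) = (\<lambda>q. ?f q *\<^sub>R Z q)"
    using eq by (auto simp: fun_eq_iff indicator_def)
  ultimately show ?thesis using Y Z by metis
qed

lemma D_zero: "D p v (\<lambda>q. 0) = 0"
proof -
  have "smooth_field_near A p (\<lambda>q. 0)" by (rule smooth_field_nearI[OF smooth_field_on_zero[OF open_UNIV]]) simp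
  from D_add[OF this this] show ?thesis by simp
qed

lemma D_sum:
  assumes "open U" "p \<in> U"
  shows "finite I \<Longrightarrow> (\<And>i. i \<in> I \<Longrightarrow> smooth_field_on A U (E i)) \<Longrightarrow>
    D p v (\<lambda>q. \<Sum>i\<in>I. E i q) = (\<Sum>i\<in>I. D p v (E i))"
proof (induction rule: finite_induct)
  case empty
  then show ?case by (simp add: D_zero)
next
  case (insert i I)
  have "smooth_field_near A p (E i)" using insert assms by (intro smooth_field_nearI) auto
  moreover have "smooth_field_near A p (\<lambda>q. \<Sum>i\<in>I. E i q)"
    using insert assms by (intro smooth_field_nearI[OF smooth_field_on_sum]) auto
  ultimately show ?case using insert D_add by simp
qed

lemma Gam_linear_right:
  assumes c: "c \<in> M" "p \<in> cdom c"
  shows "linear (\<lambda>w. D p v (coord_field A c w))"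
proof (rule linearI)
  note near = coord_field_near[OF c]
  fix w w' :: 'e and r :: real
  have add: "smooth_field_near A p (\<lambda>q. coord_field A c w q + coord_field A c w' q)"
    using smooth_field_on_add[OF smooth_coord_field smooth_coord_field, OF c(1) c(1)] c(2) by (rule smooth_field_nearI)
  have "D p v (coord_field A c (w + w')) = D p v (\<lambda>q. coord_field A c w q + coord_field A c w' q)"
    by (rule D_local[OF near add open_cdom[OF c(1)] c(2)]) (simp add: linear_add[OF coord_field_linear[OF c(1)]])
  then show "D p v (coord_field A c (w + w')) = D p v (coord_field A c w) + D p v (coord_field A c w')"
    using D_add[OF near near] by simp
  have r: "smooth_fun_on A (cdom c) (\<lambda>q. r)" using c by (intro smooth_fun_on_locally_const) auto
  have sc: "smooth_field_near A p (\<lambda>q. r *\<^sub>R coord_field A c w q)"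
    using smooth_field_on_scaleR[OF r smooth_coord_field[OF c(1)]] c(2) by (rule smooth_field_nearI)
  have "D p v (coord_field A c (r *\<^sub>R w)) = D p v (\<lambda>q. r *\<^sub>R coord_field A c w q)"
    by (rule D_local[OF near sc open_cdom[OF c(1)] c(2)]) (simp add: linear_scale[OF coord_field_linear[OF c(1)]])
  also have "\<dots> = r *\<^sub>R D p v (coord_field A c w)"
    using D_leibniz[OF smooth_fun_nearI[OF r c(2)] near] dirderiv_locally_const[OF open_cdom[OF c(1)] c(2), of "\<lambda>q. r" r]
    by simp
  finally show "D p v (coord_field A c (r *\<^sub>R w)) = r *\<^sub>R D p v (coord_field A c w)" .
qed

lemma Gam_bilinear:
  assumes c: "c \<in> M" "p \<in> cdom c"
  shows "bilinear (Gam c p)"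
  unfolding bilinear_def Gam_def
proof (intro conjI allI)
  fix u :: 'e
  show "linear (\<lambda>w. coord A c p (D p (coord_field A c u p) (coord_field A c w)))"
    using linear_compose[OF Gam_linear_right[OF c] coord_linear[OF c]] by (simp add: o_def)
  show "linear (\<lambda>v. coord A c p (D p (coord_field A c v p) (coord_field A c u)))"
    using linear_compose[OF linear_compose[OF coord_field_linear[OF c] D_linear[OF coord_field_near[OF c]]] coord_linear[OF c]]
    by (simp add: o_def)
qed

lemma D_coord:
  assumes Y: "smooth_field_on A U Y" and p: "p \<in> U" and c: "c \<in> M" "p \<in> cdom c"
  shows "coord A c p (D p v Y) = frechet_derivative (rep c Y) (at (cmap c p)) (coord A c p v)
    + Gam c p (coord A c p v) (coord A c p (Y p))"
proof -
  let ?W = "cdom c \<inter> U" and ?x = "cmap c p"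
  have U: "open U" using Y by (rule smooth_field_on_open)
  have W: "open ?W" "p \<in> ?W" "?W \<subseteq> cdom c" using U p c by auto
  define h where "h i q = coord A c q (Y q) \<bullet> i" for i q
  have h: "smooth_fun_on A ?W (h i)" for i
  proof (rule smooth_fun_onI[OF c(1) W(1,3)])
    have "smooth_on (cmap c ` ?W) (\<lambda>x. rep c Y x \<bullet> i)"
      by (intro smooth_on_inner smooth_field_onD[OF Y c(1)] fat_open open_image c U)
    then show "smooth_on (cmap c ` ?W) (h i \<circ> cinv c)" by (simp add: h_def[abs_def] rep_def o_def)
  qed
  have cf: "smooth_field_on A ?W (coord_field A c i)" for i
    by (rule smooth_field_on_subset[OF smooth_coord_field[OF c(1)] W(1,3)])
  have E: "smooth_field_on A ?W (\<lambda>q. h i q *\<^sub>R coord_field A c i q)" for i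
    by (rule smooth_field_on_scaleR[OF h cf])
  have "D p v Y = D p v (\<lambda>q. \<Sum>i\<in>Basis. h i q *\<^sub>R coord_field A c i q)"
  proof (rule D_local[OF smooth_field_nearI[OF Y p] _ W(1,2)])
    show "smooth_field_near A p (\<lambda>q. \<Sum>i\<in>Basis. h i q *\<^sub>R coord_field A c i q)"
      using smooth_field_on_sum[OF finite_Basis W(1) E] W(2) by (rule smooth_field_nearI)
    fix q assume q: "q \<in> ?W"
    then have qc: "q \<in> cdom c" by simp
    have "(\<Sum>i\<in>Basis. h i q *\<^sub>R coord_field A c i q) = coord_field A c (\<Sum>i\<in>Basis. h i q *\<^sub>R i) q"
      by (simp add: linear_sum[OF coord_field_linear[OF c(1) qc]] linear_scale[OF coord_field_linear[OF c(1) qc]])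
    then show "Y q = (\<Sum>i\<in>Basis. h i q *\<^sub>R coord_field A c i q)"
      using c qc by (simp add: h_def euclidean_representation)
  qed
  also have "\<dots> = (\<Sum>i\<in>Basis. D p v (\<lambda>q. h i q *\<^sub>R coord_field A c i q))"
    by (rule D_sum[OF W(1,2) finite_Basis E])
  also have "\<dots> = (\<Sum>i\<in>Basis. dirderiv A p v (h i) *\<^sub>R coord_field A c i p + h i p *\<^sub>R D p v (coord_field A c i))"
    by (intro sum.cong refl D_leibniz smooth_fun_nearI[OF h W(2)] coord_field_near c)
  finally have 1: "coord A c p (D p v Y) = (\<Sum>i\<in>Basis. dirderiv A p v (h i) *\<^sub>R i)
      + (\<Sum>i\<in>Basis. h i p *\<^sub>R coord A c p (D p v (coord_field A c i)))"
    using c by (simp add: linear_sum[OF coord_linear[OF c]] linear_add[OF coord_linear[OF c]]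
        linear_scale[OF coord_linear[OF c]] sum.distrib)
  have "dirderiv A p v (h i) = frechet_derivative (rep c Y) (at ?x) (coord A c p v) \<bullet> i" for i
  proof -
    have "((h i \<circ> cinv c) has_derivative (\<lambda>v. frechet_derivative (rep c Y) (at ?x) v \<bullet> i)) (at ?x)"
      using has_derivative_inner_left[OF rep_has_derivative[OF Y p c], of i]
      by (simp add: h_def[abs_def] rep_def[abs_def] o_def)
    then show ?thesis
      unfolding dirderiv_coord[OF c differentiableI[OF \<open>(_ has_derivative _) _\<close>]]
      by (metis frechet_derivative_at)
  qed
  then have 2: "(\<Sum>i\<in>Basis. dirderiv A p v (h i) *\<^sub>R i) = frechet_derivative (rep c Y) (at ?x) (coord A c p v)"
    by (simp add: euclidean_representation)
  have lin: "linear (Gam c p (coord A c p v))" using Gam_bilinear[OF c] by (simp add: bilinear_def)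
  have Gam_i: "Gam c p (coord A c p v) i = coord A c p (D p v (coord_field A c i))" for i
    using c by (simp add: Gam_def)
  have "(\<Sum>i\<in>Basis. h i p *\<^sub>R Gam c p (coord A c p v) i)
      = Gam c p (coord A c p v) (\<Sum>i\<in>Basis. h i p *\<^sub>R i)"
    by (simp add: linear_sum[OF lin] linear_scale[OF lin])
  also have "(\<Sum>i\<in>Basis. h i p *\<^sub>R i) = coord A c p (Y p)"
    by (simp add: h_def euclidean_representation)
  finally show ?thesis using 1 2 unfolding Gam_i by simp
qed

lemma rep_D:
  assumes X: "smooth_field_on A U X" and Y: "smooth_field_on A U Y" and c: "c \<in> M" and x: "x \<in> cmap c ` (cdom c \<inter> U)"
  shows "rep c (\<lambda>q. D q (X q) Y) x
    = frechet_derivative (rep c Y) (at x) (rep c X x) + Gam c (cinv c x) (rep c X x) (rep c Y x)"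
proof -
  obtain q where q: "x = cmap c q" "q \<in> cdom c" "q \<in> U" using x by auto
  show ?thesis using D_coord[OF Y q(3) c q(2), of "X q"] q c by (simp add: rep_cmap)
qed

lemma smooth_Gam:
  assumes c: "c \<in> M"
  shows "smooth_on (cmap c ` cdom c) (\<lambda>x. Gam c (cinv c x) u w)"
  using smooth_field_onD[OF D_smooth[OF smooth_coord_field smooth_coord_field, OF c c] c]
  by (simp add: rep_def[abs_def] Gam_def)

lemma Gam_sym:
  assumes c: "c \<in> M" "p \<in> cdom c"
  shows "Gam c p u w = Gam c p w u"
proof -
  let ?X = "coord_field A c u" and ?Y = "coord_field A c w"
  have near: "smooth_field_near A p ?X" "smooth_field_near A p ?Y" using coord_field_near[OF c] by auto
  have "D p (?X p) ?Y - D p (?Y p) ?X = lie_bracket A ?X ?Y p"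
    using lc near by (simp add: levi_civita_def)
  then have "coord A c p (D p (?X p) ?Y) - coord A c p (D p (?Y p) ?X) = coord A c p (lie_bracket A ?X ?Y p)"
    by (metis linear_diff[OF coord_linear[OF c]])
  also have "\<dots> = 0"
    using lie_bracket_coord[OF smooth_coord_field smooth_coord_field c(2) c, OF c(1) c(1)]
      rep_coord_field_derivative[OF c] by simp
  finally show ?thesis by (simp add: Gam_def)
qed

lemma g_sym: "g p v w = g p w v"
  using metric by (simp add: semi_riemannian_metric_def)

lemma g_bilinear: "bilinear (g p)"
  using metric by (simp add: semi_riemannian_metric_def)

lemma Gm_coord: "c \<in> M \<Longrightarrow> p \<in> cdom c \<Longrightarrow> g p v w = Gm c p (coord A c p v) (coord A c p w)"
  by (simp add: Gm_def)

lemma Gm_bilinear: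
  assumes c: "c \<in> M" "p \<in> cdom c"
  shows "bilinear (Gm c p)"
  unfolding bilinear_def Gm_def
proof (intro conjI allI)
  note b = g_bilinear[of p, unfolded bilinear_def]
  fix u :: 'e
  show "linear (\<lambda>w. g p (coord_field A c u p) (coord_field A c w p))"
    using linear_compose[OF coord_field_linear[OF c], of "g p (coord_field A c u p)"] b by (simp add: o_def)
  show "linear (\<lambda>v. g p (coord_field A c v p) (coord_field A c u p))"
    using linear_compose[OF coord_field_linear[OF c], of "\<lambda>v. g p v (coord_field A c u p)"] b by (simp add: o_def)
qed

lemma smooth_Gm: "c \<in> A \<Longrightarrow> smooth_on (cmap c ` cdom c) (\<lambda>x. Gm c (cinv c x) u w)"
  using metric by (simp add: semi_riemannian_metric_def Gm_def)

lemma Gm_derivative: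
  assumes c: "c \<in> A" "p \<in> cdom c"
  shows "frechet_derivative (\<lambda>x. Gm c (cinv c x) v w) (at (cmap c p)) u
    = Gm c p (Gam c p u v) w + Gm c p v (Gam c p u w)"
proof -
  have cM: "c \<in> M" using c atlas_maximal by simp
  note cc = cM c(2)
  let ?Y = "coord_field A c v" and ?Z = "coord_field A c w"
  have S: "open (cmap c ` cdom c)" "cmap c p \<in> cmap c ` cdom c" using open_image_subset[OF cM] c cM by auto
  have "dirderiv A p (coord_field A c u p) (\<lambda>q. g q (?Y q) (?Z q))
      = g p (D p (coord_field A c u p) ?Y) (?Z p) + g p (?Y p) (D p (coord_field A c u p) ?Z)"
    using lc coord_field_near[OF cc] by (simp add: levi_civita_def)
  also have "\<dots> = Gm c p (Gam c p u v) w + Gm c p v (Gam c p u w)"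
    unfolding Gm_coord[OF cc] by (simp add: Gam_def cc)
  finally have 1: "dirderiv A p (coord_field A c u p) (\<lambda>q. g q (?Y q) (?Z q)) = \<dots>" .
  have eq: "(\<lambda>q. g q (?Y q) (?Z q)) \<circ> cinv c = (\<lambda>x. Gm c (cinv c x) v w)" by (auto simp: Gm_def)
  have "((\<lambda>q. g q (?Y q) (?Z q)) \<circ> cinv c) differentiable (at (cmap c p))"
    unfolding eq by (rule differentiableI[OF smooth_on_has_derivative[OF smooth_Gm[OF c(1)] S]])
  from dirderiv_coord[OF cc this, of "coord_field A c u p"] show ?thesis
    unfolding 1 eq by (simp add: cc)
qed

section \<open>Curvature\<close>

definition dGam :: "('m, 'e) chart \<Rightarrow> 'm \<Rightarrow> 'e \<Rightarrow> 'e \<Rightarrow> 'e \<Rightarrow> 'e"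
  where "dGam c p u v w = frechet_derivative (\<lambda>x. Gam c (cinv c x) v w) (at (cmap c p)) u"

definition Rc :: "('m, 'e) chart \<Rightarrow> 'm \<Rightarrow> 'e \<Rightarrow> 'e \<Rightarrow> 'e \<Rightarrow> 'e"
  where "Rc c p u v w = dGam c p u v w - dGam c p v u w
    + Gam c p u (Gam c p v w) - Gam c p v (Gam c p u w)"

lemma chart_nhd:
  assumes "c \<in> M" "p \<in> cdom c"
  shows "open (cmap c ` cdom c)" "cmap c p \<in> cmap c ` cdom c"
  using open_image_subset[OF assms(1) open_cdom[OF assms(1)]] assms by auto

lemma Gam_has_derivative:
  assumes c: "c \<in> M" "p \<in> cdom c"
  shows "((\<lambda>x. Gam c (cinv c x) v w) has_derivative (\<lambda>u. dGam c p u v w)) (at (cmap c p))"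
  using smooth_on_has_derivative[OF smooth_Gam[OF c(1)] chart_nhd[OF c]] by (simp add: dGam_def)

lemma dGam_linear1: "c \<in> M \<Longrightarrow> p \<in> cdom c \<Longrightarrow> linear (\<lambda>u. dGam c p u v w)"
  by (rule has_derivative_linear[OF Gam_has_derivative])

lemma dGam_unique:
  assumes "c \<in> M" "p \<in> cdom c" "(f has_derivative f') (at (cmap c p))"
    "\<And>q. q \<in> cdom c \<Longrightarrow> f (cmap c q) = Gam c q v w"
  shows "dGam c p u v w = f' u"
proof -
  have "((\<lambda>x. Gam c (cinv c x) v w) has_derivative f') (at (cmap c p))"
    by (rule has_derivative_transform_within_open[OF assms(3) chart_nhd[OF assms(1,2)]])
       (use assms(1,4) in auto)
  from has_derivative_unique[OF this Gam_has_derivative[OF assms(1,2)]] show ?thesis by metis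
qed

lemma dGam_sym: "c \<in> M \<Longrightarrow> p \<in> cdom c \<Longrightarrow> dGam c p u v w = dGam c p u w v"
  by (rule dGam_unique[OF _ _ Gam_has_derivative]) (auto simp: Gam_sym)

lemma Gam_linear1: "c \<in> M \<Longrightarrow> p \<in> cdom c \<Longrightarrow> linear (\<lambda>v. Gam c p v w)"
  using Gam_bilinear by (simp add: bilinear_def)

lemma Gam_linear2: "c \<in> M \<Longrightarrow> p \<in> cdom c \<Longrightarrow> linear (\<lambda>w. Gam c p v w)"
  using Gam_bilinear by (simp add: bilinear_def)

lemma dGam_linear2:
  assumes c: "c \<in> M" "p \<in> cdom c"
  shows "linear (\<lambda>v. dGam c p u v w)"
proof (rule linearI)
  show "dGam c p u (v + v') w = dGam c p u v w + dGam c p u v' w" for v v'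
    by (rule dGam_unique[OF c has_derivative_add[OF Gam_has_derivative Gam_has_derivative, OF c c]])
       (simp add: c(1) linear_add[OF Gam_linear1[OF c(1)]])
  show "dGam c p u (r *\<^sub>R v) w = r *\<^sub>R dGam c p u v w" for r v
    by (rule dGam_unique[OF c has_derivative_scaleR_right[OF Gam_has_derivative, OF c]])
       (simp add: c(1) linear_scale[OF Gam_linear1[OF c(1)]])
qed

lemma dGam_linear3: "c \<in> M \<Longrightarrow> p \<in> cdom c \<Longrightarrow> linear (\<lambda>w. dGam c p u v w)"
  using dGam_linear2[of c p u v] by (subst dGam_sym)

lemma Rc_linear2:
  assumes c: "c \<in> M" "p \<in> cdom c"
  shows "linear (\<lambda>v. Rc c p u v w)"
  by (rule linearI)
     (simp_all add: Rc_def linear_add[OF dGam_linear1[OF c]] linear_scale[OF dGam_linear1[OF c]]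
        linear_add[OF dGam_linear2[OF c]] linear_scale[OF dGam_linear2[OF c]]
        linear_add[OF Gam_linear1[OF c]] linear_scale[OF Gam_linear1[OF c]]
        linear_add[OF Gam_linear2[OF c]] linear_scale[OF Gam_linear2[OF c]] algebra_simps)

lemma Rc_antisym: "Rc c p u v w = - Rc c p v u w"
  by (simp add: Rc_def)

lemma Rc_linear1:
  assumes c: "c \<in> M" "p \<in> cdom c"
  shows "linear (\<lambda>u. Rc c p u v w)"
  by (subst Rc_antisym) (rule linear_compose_neg[OF Rc_linear2[OF c]])

lemma Rc_linear3:
  assumes c: "c \<in> M" "p \<in> cdom c"
  shows "linear (\<lambda>w. Rc c p u v w)"
  by (rule linearI)
     (simp_all add: Rc_def linear_add[OF dGam_linear3[OF c]] linear_scale[OF dGam_linear3[OF c]]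
        linear_add[OF Gam_linear2[OF c]] linear_scale[OF Gam_linear2[OF c]] algebra_simps)

lemma Rc_bianchi:
  assumes c: "c \<in> M" "p \<in> cdom c"
  shows "Rc c p u v w + Rc c p v w u + Rc c p w u v = 0"
  unfolding Rc_def using dGam_sym[OF c, of u v w] dGam_sym[OF c, of v w u] dGam_sym[OF c, of w u v]
    Gam_sym[OF c, of u v] Gam_sym[OF c, of v w] Gam_sym[OF c, of w u]
  by (simp add: algebra_simps)

lemma smooth_Rc:
  assumes c: "c \<in> M"
  shows "smooth_on (cmap c ` cdom c) (\<lambda>x. Rc c (cinv c x) u v w)"
proof -
  have S: "open (cmap c ` cdom c)" using c open_image_subset[OF c open_cdom[OF c]] by simp
  note fat = fat_open[OF S]
  have G: "smooth_on (cmap c ` cdom c) (\<lambda>x. Gam c (cinv c x) u (Gam c (cinv c x) v w))" for u v w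
    by (rule smooth_on_linear_apply[OF fat, where L = "\<lambda>x. Gam c (cinv c x) u" and f = "\<lambda>x. Gam c (cinv c x) v w"])
       (auto simp: c Gam_linear2 intro: smooth_Gam[OF c])
  have "smooth_on (cmap c ` cdom c) (\<lambda>x. dGam c (cinv c x) u v w)" for u v w
    by (rule smooth_on_cong[THEN iffD1, rotated, OF smooth_on_derivative[OF smooth_Gam[OF c] S]])
       (auto simp: dGam_def c)
  then have "smooth_on (cmap c ` cdom c) (\<lambda>x. dGam c (cinv c x) u v w + (- 1) *\<^sub>R dGam c (cinv c x) v u w
      + (Gam c (cinv c x) u (Gam c (cinv c x) v w) + (- 1) *\<^sub>R Gam c (cinv c x) v (Gam c (cinv c x) u w)))"
    by (intro smooth_on_add smooth_on_scaleR smooth_on_const G fat)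
  then show ?thesis by (simp add: Rc_def algebra_simps)
qed

lemma second_covd_coord:
  assumes X: "smooth_field_on A U X" and Y: "smooth_field_on A U Y" and Z: "smooth_field_on A U Z"
    and p: "p \<in> U" and c: "c \<in> M" "p \<in> cdom c"
  defines "x \<equiv> cmap c p"
  defines "d \<equiv> \<lambda>X. frechet_derivative (rep c X) (at x)"
  shows "coord A c p (D p (X p) (\<lambda>q. D q (Y q) Z))
    = frechet_derivative (\<lambda>y. frechet_derivative (rep c Z) (at y) (coord A c p (Y p))) (at x) (coord A c p (X p))
    + d Z (d Y (coord A c p (X p)))
    + dGam c p (coord A c p (X p)) (coord A c p (Y p)) (coord A c p (Z p))
    + Gam c p (d Y (coord A c p (X p))) (coord A c p (Z p))
    + Gam c p (coord A c p (Y p)) (d Z (coord A c p (X p)))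
    + Gam c p (coord A c p (X p)) (d Z (coord A c p (Y p)) + Gam c p (coord A c p (Y p)) (coord A c p (Z p)))"
proof -
  let ?S = "cmap c ` (cdom c \<inter> U)"
  let ?X = "coord A c p (X p)" and ?Y = "coord A c p (Y p)" and ?Z = "coord A c p (Z p)"
  let ?Z' = "\<lambda>y. frechet_derivative (rep c Z) (at y)"
  have U: "open U" using X by (rule smooth_field_on_open)
  have S: "open ?S" "x \<in> ?S" using open_image[OF c(1) U] p c by (auto simp: x_def)
  note at = at_within_open[OF S(2,1)]
  have Zs: "smooth_on ?S (rep c Z)" by (rule smooth_field_onD[OF Z c(1)])
  have rep_p: "rep c X x = ?X" "rep c Y x = ?Y" "rep c Z x = ?Z" using c by (auto simp: x_def rep_cmap)
  have dY: "(rep c Y has_derivative d Y) (at x within ?S)" and dZ: "(rep c Z has_derivative d Z) (at x within ?S)"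
    unfolding d_def x_def using rep_has_derivative[OF Y p c] rep_has_derivative[OF Z p c] by (auto intro: has_derivative_at_withinI)
  have "((\<lambda>y. ?Z' y (rep c Y y)) has_derivative (\<lambda>h. frechet_derivative (\<lambda>y. ?Z' y (rep c Y x)) (at x) h + ?Z' x (d Y h)))
      (at x within ?S)"
  proof (rule has_derivative_linear_apply[where L = ?Z', OF _ S(2) _ dY])
    show "linear (?Z' y)" if "y \<in> ?S" for y
      using smooth_on_has_derivative[OF Zs S(1) that] by (rule has_derivative_linear)
    show "((\<lambda>y. ?Z' y w) has_derivative frechet_derivative (\<lambda>y. ?Z' y w) (at x)) (at x within ?S)" for w
      by (rule has_derivative_at_withinI[OF smooth_on_has_derivative[OF smooth_on_derivative[OF Zs S(1)] S]])
  qed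
  moreover have "((\<lambda>y. Gam c (cinv c y) (rep c Y y) (rep c Z y)) has_derivative
      (\<lambda>h. dGam c p h (rep c Y x) (rep c Z x) + Gam c (cinv c x) (d Y h) (rep c Z x)
        + Gam c (cinv c x) (rep c Y x) (d Z h))) (at x within ?S)"
  proof (rule has_derivative_bilinear_apply[where B = "\<lambda>y. Gam c (cinv c y)" and B' = "\<lambda>v w h. dGam c p h v w", OF _ S(2) _ dY dZ])
    show "bilinear (Gam c (cinv c y))" if "y \<in> ?S" for y
      using that c by (auto intro: Gam_bilinear)
    show "((\<lambda>y. Gam c (cinv c y) v w) has_derivative (\<lambda>h. dGam c p h v w)) (at x within ?S)" for v w
      unfolding x_def by (rule has_derivative_at_withinI[OF Gam_has_derivative[OF c]])
  qed
  ultimately have "((\<lambda>y. ?Z' y (rep c Y y) + Gam c (cinv c y) (rep c Y y) (rep c Z y)) has_derivative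
      (\<lambda>h. frechet_derivative (\<lambda>y. ?Z' y (rep c Y x)) (at x) h + ?Z' x (d Y h)
      + (dGam c p h (rep c Y x) (rep c Z x) + Gam c (cinv c x) (d Y h) (rep c Z x)
        + Gam c (cinv c x) (rep c Y x) (d Z h)))) (at x within ?S)"
    by (rule has_derivative_add)
  then have 1: "((\<lambda>y. ?Z' y (rep c Y y) + Gam c (cinv c y) (rep c Y y) (rep c Z y)) has_derivative
      (\<lambda>h. frechet_derivative (\<lambda>y. ?Z' y ?Y) (at x) h + d Z (d Y h)
      + (dGam c p h ?Y ?Z + Gam c p (d Y h) ?Z + Gam c p ?Y (d Z h)))) (at x)"
    unfolding at rep_p using c by (simp add: x_def d_def)
  have DYZ: "smooth_field_on A U (\<lambda>q. D q (Y q) Z)" by (rule D_smooth[OF Y Z])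
  have 2: "(rep c (\<lambda>q. D q (Y q) Z) has_derivative
      (\<lambda>h. frechet_derivative (\<lambda>y. ?Z' y ?Y) (at x) h + d Z (d Y h)
      + (dGam c p h ?Y ?Z + Gam c p (d Y h) ?Z + Gam c p ?Y (d Z h)))) (at x)"
    by (rule has_derivative_transform_within_open[OF 1 S]) (simp add: rep_D[OF Y Z c(1)])
  have 3: "coord A c p (D p (Y p) Z) = d Z ?Y + Gam c p ?Y ?Z"
    using D_coord[OF Z p c, of "Y p"] by (simp add: d_def x_def)
  show ?thesis
    unfolding D_coord[OF DYZ p c] 3 x_def[symmetric] frechet_derivative_at[OF 2, symmetric] by simp
qed

lemma curvature_coord:
  assumes c: "c \<in> M" "p \<in> cdom c"
  shows "coord A c p (curvature A D p x y z) = Rc c p (coord A c p x) (coord A c p y) (coord A c p z)"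
proof -
  let ?r = "coord_field A c (Rc c p (coord A c p x) (coord A c p y) (coord A c p z)) p"
  let ?lhs = "\<lambda>X Y Z. D p (X p) (\<lambda>q. D q (Y q) Z) - D p (Y p) (\<lambda>q. D q (X q) Z) - D p (lie_bracket A X Y p) Z"
  let ?ext = "\<lambda>X Y Z. smooth_field_near A p X \<and> smooth_field_near A p Y \<and> smooth_field_near A p Z \<and>
    X p = x \<and> Y p = y \<and> Z p = z"
  have key: "?lhs X Y Z = ?r" if ext: "?ext X Y Z" for X Y Z
  proof -
    obtain U1 U2 U3 where U: "p \<in> U1" "smooth_field_on A U1 X" "p \<in> U2" "smooth_field_on A U2 Y"
      "p \<in> U3" "smooth_field_on A U3 Z"
      using ext unfolding smooth_field_near_def by blast
    let ?U = "U1 \<inter> U2 \<inter> U3"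
    have oU: "open ?U" and pU: "p \<in> ?U" using U by (auto simp: smooth_field_on_def)
    have X: "smooth_field_on A ?U X" by (rule smooth_field_on_subset[OF U(2) oU]) auto
    have Y: "smooth_field_on A ?U Y" by (rule smooth_field_on_subset[OF U(4) oU]) auto
    have Z: "smooth_field_on A ?U Z" by (rule smooth_field_on_subset[OF U(6) oU]) auto
    have S: "open (cmap c ` (cdom c \<inter> ?U))" "cmap c p \<in> cmap c ` (cdom c \<inter> ?U)"
      using open_image[OF c(1) oU] c pU by auto
    have Xp: "X p = x" "Y p = y" "Z p = z" using ext by auto
    note lin = linear_diff[OF coord_linear[OF c]] linear_add[OF Gam_linear2[OF c]] linear_diff[OF Gam_linear1[OF c]]
      linear_diff[OF has_derivative_linear[OF rep_has_derivative[OF Z pU c]]]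
    note sym = second_derivative_symmetric[OF smooth_field_onD[OF Z c(1)] S, of "coord A c p x" "coord A c p y"]
    have "coord A c p (?lhs X Y Z) = Rc c p (coord A c p x) (coord A c p y) (coord A c p z)"
      unfolding linear_diff[OF coord_linear[OF c]] second_covd_coord[OF X Y Z pU c] second_covd_coord[OF Y X Z pU c]
        D_coord[OF Z pU c] lie_bracket_coord[OF X Y pU c]
      unfolding Xp sym by (simp add: lin Rc_def)
    then show ?thesis using c coord_field_coord by metis
  qed
  have "(\<forall>X Y Z. ?ext X Y Z \<longrightarrow> ?lhs X Y Z = r) \<longleftrightarrow> r = ?r" for r
  proof
    assume r: "\<forall>X Y Z. ?ext X Y Z \<longrightarrow> ?lhs X Y Z = r"
    let ?cf = "\<lambda>v. coord_field A c (coord A c p v)"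
    have ext: "?ext (?cf x) (?cf y) (?cf z)" using c coord_field_near[OF c] by simp
    have "?lhs (?cf x) (?cf y) (?cf z) = r" using r ext by simp
    then show "r = ?r" using key[OF ext] by simp
  next
    assume "r = ?r"
    then show "\<forall>X Y Z. ?ext X Y Z \<longrightarrow> ?lhs X Y Z = r" using key by simp
  qed
  then have "curvature A D p x y z = ?r" unfolding curvature_def by simp
  then show ?thesis using c by simp
qed

lemma Rc_skew:
  assumes c: "c \<in> A" "p \<in> cdom c"
  shows "Gm c p (Rc c p u v w) z = - Gm c p w (Rc c p u v z)"
proof -
  have cM: "c \<in> M" using c atlas_maximal by simp
  note cc = cM c(2)
  let ?S = "cmap c ` cdom c" and ?x = "cmap c p"
  let ?G = "\<lambda>v w x. Gm c (cinv c x) v w"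
  note S = chart_nhd[OF cc]
  have lin1: "linear (\<lambda>v. Gm c q v w)" and lin2: "linear (\<lambda>w. Gm c q v w)" if "q \<in> cdom c" for q v w
    using Gm_bilinear[OF cM that] by (auto simp: bilinear_def)
  have dG: "(?G v w has_derivative (\<lambda>u. Gm c p (Gam c p u v) w + Gm c p v (Gam c p u w))) (at ?x within ?S)" for v w
  proof (rule has_derivative_eq_rhs[OF has_derivative_at_withinI[OF smooth_on_has_derivative[OF smooth_Gm[OF c(1)] S]]])
    show "frechet_derivative (?G v w) (at ?x) = (\<lambda>u. Gm c p (Gam c p u v) w + Gm c p v (Gam c p u w))"
      by (rule ext) (rule Gm_derivative[OF c])
  qed
  have second: "frechet_derivative (\<lambda>y. frechet_derivative (?G w z) (at y) v) (at ?x) u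
      = Gm c p (Gam c p u (Gam c p v w)) z + Gm c p (Gam c p v w) (Gam c p u z) + Gm c p (dGam c p u v w) z
      + (Gm c p (Gam c p u w) (Gam c p v z) + Gm c p w (Gam c p u (Gam c p v z)) + Gm c p w (dGam c p u v z))" for u v
  proof -
    note dGam = has_derivative_at_withinI[OF Gam_has_derivative[OF cc], of _ _ ?S]
    have "((\<lambda>y. Gm c (cinv c y) (Gam c (cinv c y) v w) z) has_derivative
        (\<lambda>u. Gm c p (Gam c p u (Gam c (cinv c ?x) v w)) z + Gm c p (Gam c (cinv c ?x) v w) (Gam c p u z)
          + Gm c (cinv c ?x) (dGam c p u v w) z)) (at ?x within ?S)"
      by (rule has_derivative_linear_apply[where L = "\<lambda>y v. Gm c (cinv c y) v z" and y = "\<lambda>y. Gam c (cinv c y) v w"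
          and L' = "\<lambda>v u. Gm c p (Gam c p u v) z + Gm c p v (Gam c p u z)", OF _ S(2) dG dGam])
         (use cM lin1 in auto)
    from has_derivative_add[OF this] have add: "((\<lambda>y. Gm c (cinv c y) (Gam c (cinv c y) v w) z + f y) has_derivative
        (\<lambda>u. Gm c p (Gam c p u (Gam c (cinv c ?x) v w)) z + Gm c p (Gam c (cinv c ?x) v w) (Gam c p u z)
          + Gm c (cinv c ?x) (dGam c p u v w) z + f' u)) (at ?x within ?S)"
      if "(f has_derivative f') (at ?x within ?S)" for f f' using that .
    have "((\<lambda>y. Gm c (cinv c y) w (Gam c (cinv c y) v z)) has_derivative
        (\<lambda>u. Gm c p (Gam c p u w) (Gam c (cinv c ?x) v z) + Gm c p w (Gam c p u (Gam c (cinv c ?x) v z))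
          + Gm c (cinv c ?x) w (dGam c p u v z))) (at ?x within ?S)"
      by (rule has_derivative_linear_apply[where L = "\<lambda>y v. Gm c (cinv c y) w v" and y = "\<lambda>y. Gam c (cinv c y) v z"
          and L' = "\<lambda>v u. Gm c p (Gam c p u w) v + Gm c p w (Gam c p u v)", OF _ S(2) dG dGam])
         (use cM lin2 in auto)
    from add[OF this] have "((\<lambda>y. Gm c (cinv c y) (Gam c (cinv c y) v w) z + Gm c (cinv c y) w (Gam c (cinv c y) v z))
        has_derivative (\<lambda>u. Gm c p (Gam c p u (Gam c p v w)) z + Gm c p (Gam c p v w) (Gam c p u z) + Gm c p (dGam c p u v w) z
      + (Gm c p (Gam c p u w) (Gam c p v z) + Gm c p w (Gam c p u (Gam c p v z)) + Gm c p w (dGam c p u v z)))) (at ?x)"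
      unfolding at_within_open[OF S(2,1)] cinv_cmap[OF cc] .
    then have "((\<lambda>y. frechet_derivative (?G w z) (at y) v) has_derivative
      (\<lambda>u. Gm c p (Gam c p u (Gam c p v w)) z + Gm c p (Gam c p v w) (Gam c p u z) + Gm c p (dGam c p u v w) z
      + (Gm c p (Gam c p u w) (Gam c p v z) + Gm c p w (Gam c p u (Gam c p v z)) + Gm c p w (dGam c p u v z)))) (at ?x)"
    proof (rule has_derivative_transform_within_open[OF _ S])
      fix y assume "y \<in> ?S"
      then obtain q where q: "y = cmap c q" "q \<in> cdom c" by auto
      show "Gm c (cinv c y) (Gam c (cinv c y) v w) z + Gm c (cinv c y) w (Gam c (cinv c y) v z)
          = frechet_derivative (?G w z) (at y) v"
        unfolding q(1) cinv_cmap[OF cM q(2)] by (rule Gm_derivative[OF c(1) q(2), symmetric])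
    qed
    from frechet_derivative_at[OF this] show ?thesis by (rule fun_cong[THEN sym])
  qed
  have sym: "frechet_derivative (\<lambda>y. frechet_derivative (?G w z) (at y) v) (at ?x) u
      = frechet_derivative (\<lambda>y. frechet_derivative (?G w z) (at y) u) (at ?x) v"
    by (rule second_derivative_symmetric[OF smooth_Gm[OF c(1)] S])
  show ?thesis
    using sym unfolding second Rc_def
      linear_add[OF lin1[OF c(2)]] linear_diff[OF lin1[OF c(2)]] linear_add[OF lin2[OF c(2)]] linear_diff[OF lin2[OF c(2)]]
    by linarith
qed

lemma curvature_chart_at: "curvature A D p x y z = Rc (chart_at A p) p x y z"
  using curvature_coord[OF chart_at(3,2), of p x y z] by simp

lemma curvature_skew_zero: "g p (curvature A D p x y x) x = 0"
proof -
  note c = chart_at(1,2)[of p] and cM = chart_at(3,2)[of p]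
  have "g p (curvature A D p x y x) x = - g p x (curvature A D p x y x)"
    using Rc_skew[OF c, of x y x x] by (simp add: Gm_coord[OF cM] curvature_chart_at)
  then show ?thesis using g_sym[of p x] by simp
qed

lemma curvature_sym: "g p (curvature A D p x y x) z = g p (curvature A D p x z x) y"
proof -
  let ?c = "chart_at A p"
  note c = chart_at(1,2)[of p] and cM = chart_at(3,2)[of p]
  define a where "a u v w z = Gm ?c p (Rc ?c p u v w) z" for u v w z
  have lin: "linear (\<lambda>v. Gm ?c p v w)" for w using Gm_bilinear[OF cM] by (auto simp: bilinear_def)
  have Gm_sym: "Gm ?c p v w = Gm ?c p w v" for v w by (simp add: Gm_def g_sym)
  have 1: "a u v w z = - a v u w z" for u v w z
    unfolding a_def by (subst Rc_antisym) (simp add: linear_neg[OF lin])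
  have 2: "a u v w z = - a u v z w" for u v w z
    unfolding a_def using Rc_skew[OF c, of u v w z] Gm_sym by simp
  have 3: "a u v w z + a v w u z + a w u v z = 0" for u v w z
    unfolding a_def linear_add[OF lin, symmetric] Rc_bianchi[OF cM] by (simp add: linear_0[OF lin])
  have "a x y x z = a x z x y"
    using 3[of x y z x] 2[of x y z x] 2[of y z x x] 1[of z x y x] 2[of x z y x]
    by linarith
  then show ?thesis by (simp add: a_def Gm_coord[OF cM] curvature_chart_at)
qed

end

section \<open>Submanifolds and the second fundamental form\<close>

lemma vector_derivative_in_subspace:
  fixes f :: "real \<Rightarrow> 'a::euclidean_space"
  assumes f: "(f has_vector_derivative v) (at 0)" and S: "subspace S"
    and U: "open U" "0 \<in> U" and in_S: "\<And>t. t \<in> U \<Longrightarrow> f t \<in> S"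
  shows "v \<in> S"
proof -
  obtain y z where yz: "y \<in> span S" "\<And>w. w \<in> span S \<Longrightarrow> orthogonal z w" "v = y + z"
    using orthogonal_subspace_decomp_exists[of S v] by metis
  have span: "span S = S" using S by (simp add: span_eq_iff)
  have "((\<lambda>t. f t \<bullet> z) has_derivative (\<lambda>h. (h *\<^sub>R v) \<bullet> z)) (at 0)"
    using has_derivative_inner_left[OF f[unfolded has_vector_derivative_def]] .
  moreover have "((\<lambda>t. f t \<bullet> z) has_derivative (\<lambda>h. 0)) (at 0)"
  proof (rule has_derivative_transform_within_open[OF has_derivative_const[of 0] U])
    fix t assume "t \<in> U"
    then have "orthogonal z (f t)" using yz(2) in_S span by simp
    then show "0 = f t \<bullet> z" by (simp add: orthogonal_def inner_commute)
  qed
  ultimately have "(\<lambda>h. (h *\<^sub>R v) \<bullet> z) = (\<lambda>h. 0)" by (rule has_derivative_unique)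
  from fun_cong[OF this, of 1] have "v \<bullet> z = 0" by simp
  moreover have "y \<bullet> z = 0" using yz(1,2) by (simp add: orthogonal_def inner_commute)
  ultimately have "z = 0" using yz(3) by (simp add: inner_add_left)
  then show ?thesis using yz span by simp
qed

context smooth_manifold
begin

definition slice :: "'m set \<Rightarrow> ('m, 'e) chart \<Rightarrow> 'e set \<Rightarrow> bool"
  where "slice P c S \<longleftrightarrow> c \<in> M \<and> subspace S \<and> cmap c ` (cdom c \<inter> P) = cmap c ` cdom c \<inter> S"

lemma submanifold_slice:
  assumes "submanifold A P" "p \<in> P"
  obtains c S where "slice P c S" "p \<in> cdom c"
  using assms unfolding submanifold_def slice_def by blast

lemma slice_mem: "slice P c S \<Longrightarrow> q \<in> P \<Longrightarrow> q \<in> cdom c \<Longrightarrow> cmap c q \<in> S"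
  by (auto simp: slice_def)

lemma slice_cinv:
  assumes "slice P c S" "x \<in> cmap c ` cdom c" "x \<in> S"
  shows "cinv c x \<in> P"
proof -
  have "x \<in> cmap c ` (cdom c \<inter> P)" using assms unfolding slice_def by blast
  then obtain q where "x = cmap c q" "q \<in> cdom c" "q \<in> P" by auto
  then show ?thesis using assms(1) by (simp add: slice_def)
qed

lemma tangent_space_slice:
  assumes sl: "slice P c S" and p: "p \<in> P" "p \<in> cdom c"
  shows "tangent_space A P p = {v. coord A c p v \<in> S}"
proof (intro equalityI subsetI)
  have c: "c \<in> M" and S: "subspace S" using sl by (auto simp: slice_def)
  let ?k = "chart_at A p"
  note k = chart_at[of p]
  let ?OO = "cdom c \<inter> cdom ?k"
  have OO: "open ?OO" "p \<in> ?OO" using c k p by auto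
  {
    fix v assume "v \<in> tangent_space A P p"
    then obtain \<epsilon> \<alpha> where \<epsilon>: "\<epsilon> > 0" and v: "v = velocity A {-\<epsilon><..<\<epsilon>} \<alpha> 0"
      and \<alpha>: "smooth_curve A {-\<epsilon><..<\<epsilon>} \<alpha>" "\<alpha> ` {-\<epsilon><..<\<epsilon>} \<subseteq> P" "\<alpha> 0 = p"
      unfolding tangent_space_def by blast
    let ?J = "{-\<epsilon><..<\<epsilon>}"
    have cont: "continuous_on ?J \<alpha>" using \<alpha>(1) by (simp add: smooth_curve_def)
    have op: "open {t \<in> ?J. \<alpha> t \<in> U}" if "open U" for U
    proof -
      have "open (\<alpha> -` U \<inter> ?J)"
        using continuous_on_open_vimage[of ?J \<alpha>] cont that by simp
      then show ?thesis by (simp add: vimage_def Int_def conj_commute)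
    qed
    let ?Jk = "{t \<in> ?J. \<alpha> t \<in> cdom ?k}" and ?JO = "{t \<in> ?J. \<alpha> t \<in> ?OO}"
    have "smooth_on ?Jk (cmap ?k \<circ> \<alpha>)" using \<alpha>(1) k(1) by (simp add: smooth_curve_def)
    from smooth_on_has_derivative[OF this op[OF open_cdom[OF k(3)]], of 0]
    have d: "((cmap ?k \<circ> \<alpha>) has_derivative frechet_derivative (cmap ?k \<circ> \<alpha>) (at 0)) (at 0)"
      using \<epsilon> \<alpha>(3) k(2) by simp
    have "(cmap ?k \<circ> \<alpha>) differentiable (at 0)" by (rule differentiableI[OF d])
    then have "((cmap ?k \<circ> \<alpha>) has_vector_derivative vector_derivative (cmap ?k \<circ> \<alpha>) (at 0)) (at 0)"
      by (simp add: vector_derivative_works)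
    moreover have "vector_derivative (cmap ?k \<circ> \<alpha>) (at 0) = v"
      using \<epsilon> at_within_open[of 0 ?J] by (simp add: v velocity_def \<alpha>(3))
    ultimately have dk: "((cmap ?k \<circ> \<alpha>) has_derivative (\<lambda>h. h *\<^sub>R v)) (at 0)"
      by (simp add: has_vector_derivative_def)
    have "((cmap c \<circ> cinv ?k) has_derivative Jac ?k c (cmap ?k p)) (at ((cmap ?k \<circ> \<alpha>) 0))"
      using Jac_has_derivative[OF k(3) c k(2) p(2)] \<alpha>(3) by simp
    from has_derivative_compose[OF dk this]
    have 1: "((\<lambda>t. (cmap c \<circ> cinv ?k) ((cmap ?k \<circ> \<alpha>) t)) has_derivative (\<lambda>h. Jac ?k c (cmap ?k p) (h *\<^sub>R v))) (at 0)" .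
    have "((cmap c \<circ> \<alpha>) has_derivative (\<lambda>h. Jac ?k c (cmap ?k p) (h *\<^sub>R v))) (at 0)"
      by (rule has_derivative_transform_within_open[OF 1 op[OF OO(1)]]) (use \<epsilon> \<alpha>(3) OO k(3) in auto)
    then have "((cmap c \<circ> \<alpha>) has_vector_derivative coord A c p v) (at 0)"
      by (simp add: has_vector_derivative_def coord_eq linear_scale[OF Jac_linear[OF k(3) c k(2) p(2)]])
    then have "coord A c p v \<in> S"
    proof (rule vector_derivative_in_subspace[OF _ S op[OF OO(1)]])
      show "0 \<in> ?JO" using \<epsilon> \<alpha>(3) OO by simp
      fix t assume t: "t \<in> ?JO"
      then have "\<alpha> t \<in> P" using \<alpha>(2) by blast
      then show "(cmap c \<circ> \<alpha>) t \<in> S" using slice_mem[OF sl, of "\<alpha> t"] t by simp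
    qed
    then show "v \<in> {v. coord A c p v \<in> S}" by simp
  }
  {
    fix v assume "v \<in> {v. coord A c p v \<in> S}"
    then have u: "coord A c p v \<in> S" by simp
    define u where "u = coord A c p v"
    define x0 where "x0 = cmap c p"
    define \<alpha> where "\<alpha> t = cinv c (x0 + t *\<^sub>R u)" for t :: real
    have Im: "open (cmap c ` cdom c)" "x0 \<in> cmap c ` cdom c"
      using open_image_subset[OF c open_cdom[OF c]] p by (auto simp: x0_def)
    then obtain r where r: "r > 0" "ball x0 r \<subseteq> cmap c ` cdom c" using open_contains_ball by blast
    define \<epsilon> where "\<epsilon> = r / (norm u + 1)"
    have nu: "norm u + 1 > 0" by (simp add: add_nonneg_pos)
    have \<epsilon>: "\<epsilon> > 0" using r nu by (simp add: \<epsilon>_def)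
    let ?J = "{-\<epsilon><..<\<epsilon>}"
    have inI: "x0 + t *\<^sub>R u \<in> cmap c ` cdom c" if "t \<in> ?J" for t
    proof -
      have "\<bar>t\<bar> * norm u \<le> \<bar>t\<bar> * (norm u + 1)" by (simp add: mult_left_mono)
      also have "\<dots> < \<epsilon> * (norm u + 1)" using that nu by (intro mult_strict_right_mono) auto
      also have "\<dots> = r" using nu by (simp add: \<epsilon>_def)
      finally have "x0 + t *\<^sub>R u \<in> ball x0 r" by (simp add: dist_norm)
      then show ?thesis using r by blast
    qed
    have \<alpha>c: "\<alpha> t \<in> cdom c" "cmap c (\<alpha> t) = x0 + t *\<^sub>R u" if "t \<in> ?J" for t
      using inI[OF that] c by (auto simp: \<alpha>_def)
    have \<alpha>0: "\<alpha> 0 = p" using c p by (simp add: \<alpha>_def x0_def)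
    have \<alpha>P: "\<alpha> t \<in> P" if "t \<in> ?J" for t
      unfolding \<alpha>_def
    proof (rule slice_cinv[OF sl inI[OF that]])
      have "x0 \<in> S" using slice_mem[OF sl p] by (simp add: x0_def)
      then show "x0 + t *\<^sub>R u \<in> S" using u S by (simp add: u_def subspace_add subspace_scale)
    qed
    have cont: "continuous_on ?J \<alpha>"
      unfolding \<alpha>_def using inI by (intro continuous_on_compose2[OF cont_cinv[OF c]] continuous_intros) auto
    have op: "open {t \<in> ?J. \<alpha> t \<in> U}" if "open U" for U
    proof -
      have "open (\<alpha> -` U \<inter> ?J)"
        using continuous_on_open_vimage[of ?J \<alpha>] cont that by simp
      then show ?thesis by (simp add: vimage_def Int_def conj_commute)
    qed
    have sm: "smooth_curve A ?J \<alpha>"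
      unfolding smooth_curve_def
    proof (intro conjI ballI cont)
      fix d assume d: "d \<in> A"
      have dM: "d \<in> M" by (rule atlas_maximal[OF d])
      let ?Jd = "{t \<in> ?J. \<alpha> t \<in> cdom d}"
      have fat: "fat ?Jd" by (rule fat_open[OF op[OF open_cdom[OF dM]]])
      have "smooth_on ?Jd (\<lambda>t. (cmap d \<circ> cinv c) (x0 + t *\<^sub>R u))"
      proof (rule smooth_on_compose[where h = "\<lambda>t. x0 + t *\<^sub>R u" and f = "cmap d \<circ> cinv c",
            OF fat fat_open[OF open_overlap[OF c dM]] _ smooth_transition[OF c dM]])
        show "(\<lambda>t. x0 + t *\<^sub>R u) ` ?Jd \<subseteq> cmap c ` (cdom c \<inter> cdom d)"
        proof
          fix x assume "x \<in> (\<lambda>t. x0 + t *\<^sub>R u) ` ?Jd"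
          then obtain t where t: "t \<in> ?J" "\<alpha> t \<in> cdom d" "x = x0 + t *\<^sub>R u" by auto
          then have "x = cmap c (\<alpha> t)" "\<alpha> t \<in> cdom c" using \<alpha>c[OF t(1)] by auto
          then show "x \<in> cmap c ` (cdom c \<inter> cdom d)" using t by blast
        qed
        show "smooth_on ?Jd (\<lambda>t. x0 + t *\<^sub>R u)"
          by (intro smooth_on_add smooth_on_const smooth_on_bounded_linear fat bounded_linear_scaleR_left)
      qed
      then show "smooth_on ?Jd (cmap d \<circ> \<alpha>)" by (simp add: \<alpha>_def[abs_def] o_def)
    qed
    have "velocity A ?J \<alpha> 0 = v"
    proof -
      have "((\<lambda>t. x0 + t *\<^sub>R u) has_derivative (\<lambda>h. h *\<^sub>R u)) (at (0::real))"
        by (auto intro!: derivative_eq_intros)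
      moreover have "((cmap ?k \<circ> cinv c) has_derivative Jac c ?k (cmap c p)) (at (x0 + (0::real) *\<^sub>R u))"
        using Jac_has_derivative[OF c k(3) p(2) k(2)] by (simp add: x0_def)
      ultimately have "((\<lambda>t. (cmap ?k \<circ> cinv c) (x0 + t *\<^sub>R u)) has_derivative
          (\<lambda>h. Jac c ?k (cmap c p) (h *\<^sub>R u))) (at (0::real))"
        by (rule has_derivative_compose)
      then have "((cmap ?k \<circ> \<alpha>) has_vector_derivative coord_field A c u p) (at 0)"
        by (simp add: has_vector_derivative_def coord_field_eq \<alpha>_def[abs_def] o_def
            linear_scale[OF Jac_linear[OF c k(3) p(2) k(2)]])
      then have "((cmap ?k \<circ> \<alpha>) has_vector_derivative v) (at 0)"
        using c p by (simp add: u_def)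
      then show ?thesis
        using \<epsilon> at_within_open[of 0 ?J] by (simp add: velocity_def \<alpha>0 vector_derivative_at)
    qed
    then show "v \<in> tangent_space A P p"
      unfolding tangent_space_def using \<epsilon> sm \<alpha>P \<alpha>0 by blast
  }
qed

lemma tangent_space_subspace:
  assumes "submanifold A P" "p \<in> P"
  shows "subspace (tangent_space A P p)"
proof -
  obtain c S where sl: "slice P c S" "p \<in> cdom c" by (rule submanifold_slice[OF assms])
  have c: "c \<in> M" "subspace S" using sl by (auto simp: slice_def)
  note lin = coord_linear[OF c(1) sl(2)]
  show ?thesis
    unfolding tangent_space_slice[OF sl(1) assms(2) sl(2)] using c(2)
    by (simp add: subspace_def linear_0[OF lin] linear_add[OF lin] linear_scale[OF lin])
qed

end

context semi_riemannian
begin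

lemma second_ff_slice:
  assumes sl: "slice P c S" and p: "p \<in> P" "p \<in> cdom c"
    and n: "\<forall>w\<in>tangent_space A P p. g p n w = 0"
    and v1: "v1 \<in> tangent_space A P p" and v2: "v2 \<in> tangent_space A P p"
  shows "second_ff A g D P p n v1 v2 = g p n (coord_field A c (Gam c p (coord A c p v1) (coord A c p v2)) p)"
proof -
  have c: "c \<in> M" and S: "subspace S" using sl by (auto simp: slice_def)
  note cp = c p(2)
  let ?r = "g p n (coord_field A c (Gam c p (coord A c p v1) (coord A c p v2)) p)"
  have u1: "coord A c p v1 \<in> S" and u2: "coord A c p v2 \<in> S"
    using v1 v2 unfolding tangent_space_slice[OF sl p] by auto
  have key: "g p n (D p v1 X) = ?r" if X: "tangent_extension A P p v2 X" for X
  proof -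
    obtain U where U: "p \<in> U" "smooth_field_on A U X" "\<And>q. q \<in> P \<inter> U \<Longrightarrow> X q \<in> tangent_space A P q"
      and Xp: "X p = v2"
      using X unfolding tangent_extension_def by blast
    have oU: "open U" using U(2) by (rule smooth_field_on_open)
    let ?x = "cmap c p" and ?u = "coord A c p v1"
    let ?d = "frechet_derivative (rep c X) (at ?x)"
    have N: "open (cmap c ` (cdom c \<inter> U))" "?x \<in> cmap c ` (cdom c \<inter> U)"
      using open_image[OF c oU] U p by auto
    have "continuous_on UNIV (\<lambda>t::real. ?x + t *\<^sub>R ?u)" by (intro continuous_intros)
    then have opT: "open ((\<lambda>t::real. ?x + t *\<^sub>R ?u) -` (cmap c ` (cdom c \<inter> U)))" (is "open ?T")
      using N(1) by (rule open_vimage[rotated])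
    have line: "((\<lambda>t. ?x + t *\<^sub>R ?u) has_derivative (\<lambda>h. h *\<^sub>R ?u)) (at (0::real))"
      by (auto intro!: derivative_eq_intros)
    note dX = rep_has_derivative[OF U(2,1) cp]
    have "(rep c X has_derivative ?d) (at (?x + (0::real) *\<^sub>R ?u))" using dX by simp
    from has_derivative_compose[OF line this]
    have "((\<lambda>t. rep c X (?x + t *\<^sub>R ?u)) has_vector_derivative ?d ?u) (at 0)"
      by (simp add: has_vector_derivative_def linear_scale[OF has_derivative_linear[OF dX]])
    then have "?d ?u \<in> S"
    proof (rule vector_derivative_in_subspace[OF _ S opT])
      show "0 \<in> ?T" using N(2) by simp
      fix t assume "t \<in> ?T"
      then obtain q where q: "?x + t *\<^sub>R ?u = cmap c q" "q \<in> cdom c" "q \<in> U" by auto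
      have "?x + t *\<^sub>R ?u \<in> S" using slice_mem[OF sl p] u1 S by (simp add: subspace_add subspace_scale)
      then have "q \<in> P" using slice_cinv[OF sl, of "cmap c q"] q c by simp
      then have "coord A c q (X q) \<in> S"
        using U(3)[of q] q tangent_space_slice[OF sl \<open>q \<in> P\<close> q(2)] by auto
      then show "rep c X (?x + t *\<^sub>R ?u) \<in> S" unfolding q(1) by (simp add: rep_cmap[OF c q(2)])
    qed
    then have "coord_field A c (?d ?u) p \<in> tangent_space A P p"
      unfolding tangent_space_slice[OF sl p] using cp by simp
    then have 0: "g p n (coord_field A c (?d ?u) p) = 0" by (rule n[rule_format])
    have "D p v1 X = coord_field A c (coord A c p (D p v1 X)) p" using cp by simp
    also have "coord A c p (D p v1 X) = ?d ?u + Gam c p ?u (coord A c p v2)"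
      using D_coord[OF U(2,1) cp, of v1] by (simp add: Xp)
    finally have "D p v1 X = coord_field A c (?d ?u) p + coord_field A c (Gam c p ?u (coord A c p v2)) p"
      by (simp add: linear_add[OF coord_field_linear[OF cp]])
    moreover have "linear (g p n)" using g_bilinear[of p] by (simp add: bilinear_def)
    ultimately show ?thesis using 0 by (simp add: linear_add)
  qed
  let ?X = "coord_field A c (coord A c p v2)"
  have ext: "tangent_extension A P p v2 ?X"
    unfolding tangent_extension_def
  proof (intro conjI exI[of _ "cdom c"] ballI)
    show "?X p = v2" using cp by simp
    show "smooth_field_on A (cdom c) ?X" by (rule smooth_coord_field[OF c])
    fix q assume q: "q \<in> P \<inter> cdom c"
    then show "?X q \<in> tangent_space A P q"
      using tangent_space_slice[OF sl, of q] u2 c by simp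
  qed (rule p)
  show ?thesis
    unfolding second_ff_def
  proof (rule the_equality)
    show "\<forall>V2. tangent_extension A P p v2 V2 \<longrightarrow> g p n (D p v1 V2) = ?r" using key by simp
    fix r assume "\<forall>V2. tangent_extension A P p v2 V2 \<longrightarrow> g p n (D p v1 V2) = r"
    then have "g p n (D p v1 ?X) = r" using ext by simp
    then show "r = ?r" using key[OF ext] by simp
  qed
qed

lemma second_ff_sym_bilinear:
  assumes P: "submanifold A P" "p \<in> P" and n: "\<forall>w\<in>tangent_space A P p. g p n w = 0"
    and v: "v \<in> tangent_space A P p" "v' \<in> tangent_space A P p" "w \<in> tangent_space A P p"
  shows "second_ff A g D P p n v w = second_ff A g D P p n w v"
    and "second_ff A g D P p n (r *\<^sub>R v + v') w = r * second_ff A g D P p n v w + second_ff A g D P p n v' w"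
proof -
  obtain c S where sl: "slice P c S" "p \<in> cdom c" by (rule submanifold_slice[OF P])
  have c: "c \<in> M" using sl by (simp add: slice_def)
  note cp = c sl(2)
  note T = tangent_space_subspace[OF P]
  have lin: "linear (g p n)" using g_bilinear[of p] by (simp add: bilinear_def)
  note formula = second_ff_slice[OF sl(1) P(2) sl(2) n]
  note lins = linear_add[OF coord_linear[OF cp]] linear_scale[OF coord_linear[OF cp]]
    linear_add[OF Gam_linear1[OF cp]] linear_scale[OF Gam_linear1[OF cp]]
    linear_add[OF coord_field_linear[OF cp]] linear_scale[OF coord_field_linear[OF cp]]
    linear_add[OF lin] linear_scale[OF lin]
  show "second_ff A g D P p n v w = second_ff A g D P p n w v"
    using formula v Gam_sym[OF cp, of "coord A c p v" "coord A c p w"] by simp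
  show "second_ff A g D P p n (r *\<^sub>R v + v') w = r * second_ff A g D P p n v w + second_ff A g D P p n v' w"
    using formula v subspace_add[OF T subspace_scale[OF T v(1)] v(2)] by (simp add: lins)
qed

end

section \<open>Vector fields along the geodesic\<close>

lemma smooth_on_has_vector_derivative:
  fixes f :: "real \<Rightarrow> 'b::real_normed_vector"
  assumes "smooth_on S f" "t \<in> S"
  shows "(f has_vector_derivative frechet_derivative f (at t within S) 1) (at t within S)"
proof -
  note d = smooth_on_has_derivative_within[OF assms]
  have "frechet_derivative f (at t within S) = (\<lambda>h. h *\<^sub>R frechet_derivative f (at t within S) 1)"
  proof
    fix h
    show "frechet_derivative f (at t within S) h = h *\<^sub>R frechet_derivative f (at t within S) 1"
      using linear_scale[OF has_derivative_linear[OF d], of h 1] by simp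
  qed
  from has_derivative_eq_rhs[OF d this] show ?thesis unfolding has_vector_derivative_def .
qed

lemma continuous_on_linear_apply:
  fixes L :: "'a::topological_space \<Rightarrow> 'b::euclidean_space \<Rightarrow> 'c::real_normed_vector"
  assumes "\<And>x. x \<in> S \<Longrightarrow> linear (L x)" "\<And>v. continuous_on S (\<lambda>x. L x v)" "continuous_on S f"
  shows "continuous_on S (\<lambda>x. L x (f x))"
proof -
  have "L x (f x) = (\<Sum>i\<in>Basis. (f x \<bullet> i) *\<^sub>R L x i)" if "x \<in> S" for x
    using linear_sum[OF assms(1)[OF that], of "\<lambda>i. (f x \<bullet> i) *\<^sub>R i" Basis]
    by (simp add: linear_scale[OF assms(1)[OF that]] euclidean_representation)
  moreover have "continuous_on S (\<lambda>x. \<Sum>i\<in>Basis. (f x \<bullet> i) *\<^sub>R L x i)"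
    by (intro continuous_intros assms)
  ultimately show ?thesis
    using continuous_on_cong[OF refl, of S "\<lambda>x. L x (f x)" "\<lambda>x. \<Sum>i\<in>Basis. (f x \<bullet> i) *\<^sub>R L x i"] by simp
qed

locale geodesic_curve = semi_riemannian A g D
  for A :: "('m::{t2_space,second_countable_topology}, 'e::euclidean_space) chart set" and g D +
  fixes a b :: real and \<gamma> :: "real \<Rightarrow> 'm"
  assumes ab: "a < b" and geod: "geodesic A D a b \<gamma>"
begin

abbreviation vel :: "real \<Rightarrow> 'e" where "vel \<equiv> velocity A {a..b} \<gamma>"
abbreviation cov :: "(real \<Rightarrow> 'e) \<Rightarrow> real \<Rightarrow> 'e" where "cov \<equiv> covd A D a b \<gamma>"
abbreviation xc :: "('m, 'e) chart \<Rightarrow> real \<Rightarrow> 'e" where "xc c \<equiv> cmap c \<circ> \<gamma>"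
abbreviation vc :: "('m, 'e) chart \<Rightarrow> (real \<Rightarrow> 'e) \<Rightarrow> real \<Rightarrow> 'e" where "vc c V \<equiv> \<lambda>s. coord A c (\<gamma> s) (V s)"
abbreviation over :: "'m set \<Rightarrow> real set" where "over U \<equiv> {t \<in> {a..b}. \<gamma> t \<in> U}"

lemma curve_continuous: "continuous_on {a..b} \<gamma>"
  using geod by (simp add: geodesic_def smooth_curve_def)

lemma openin_over: "open U \<Longrightarrow> openin (top_of_set {a..b}) (over U)"
  using continuous_openin_preimage_gen[OF curve_continuous] by (simp add: vimage_def Int_def)

lemma fat_over: "open U \<Longrightarrow> fat (over U)"
  using fat_openin[OF fat_interval[OF ab] openin_over] .

lemma at_within_over:
  assumes "open U" "t \<in> {a..b}" "\<gamma> t \<in> U"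
  shows "at t within over U = at t within {a..b}"
proof -
  obtain N where N: "open N" "over U = {a..b} \<inter> N" using openin_over[OF assms(1)] by (auto simp: openin_open)
  have "t \<in> over U" using assms by simp
  then have "t \<in> N" unfolding N(2) by simp
  then show ?thesis unfolding N(2) by (intro at_within_nhd[OF _ N(1)]) auto
qed

lemma smooth_xc: "c \<in> A \<Longrightarrow> smooth_on (over (cdom c)) (xc c)"
  using geod by (simp add: geodesic_def smooth_curve_def)

definition xdot :: "('m, 'e) chart \<Rightarrow> real \<Rightarrow> 'e"
  where "xdot c t = frechet_derivative (xc c) (at t within over (cdom c)) 1"

lemma smooth_xdot: "c \<in> A \<Longrightarrow> smooth_on (over (cdom c)) (xdot c)"
  using smooth_on_derivative_within[OF smooth_xc] by (simp add: xdot_def[abs_def])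

lemma xc_has_derivative:
  assumes "c \<in> A" "t \<in> {a..b}" "\<gamma> t \<in> cdom c"
  shows "(xc c has_derivative (\<lambda>h. h *\<^sub>R xdot c t)) (at t within {a..b})"
  using smooth_on_has_vector_derivative[OF smooth_xc[OF assms(1)], of t]
    at_within_over[OF open_cdom[OF atlas_maximal[OF assms(1)]] assms(2,3)] assms
  by (simp add: has_vector_derivative_def xdot_def)

lemma smooth_along_curve:
  assumes c: "c \<in> A" and S: "fat S" "S \<subseteq> over (cdom c)" and f: "smooth_on (cmap c ` cdom c) f"
  shows "smooth_on S (\<lambda>t. f (xc c t))"
proof (rule smooth_on_compose[where h = "xc c" and f = f, OF S(1) _ _ f])
  show "fat (cmap c ` cdom c)"
    by (rule fat_open[OF open_image_subset[OF atlas_maximal[OF c] open_cdom[OF atlas_maximal[OF c]]]]) simp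
  show "xc c ` S \<subseteq> cmap c ` cdom c" using S(2) by auto
  show "smooth_on S (xc c)" by (rule smooth_on_subset[OF S smooth_xc[OF c]])
qed

lemma smooth_Gam_curve:
  assumes c: "c \<in> A" and S: "fat S" "S \<subseteq> over (cdom c)" and u: "smooth_on S u" and w: "smooth_on S w"
  shows "smooth_on S (\<lambda>t. Gam c (\<gamma> t) (u t) (w t))"
proof -
  have cM: "c \<in> M" by (rule atlas_maximal[OF c])
  have dom: "\<gamma> t \<in> cdom c" if "t \<in> S" for t using that S by auto
  have 1: "smooth_on S (\<lambda>t. Gam c (\<gamma> t) v v')" for v v'
    by (rule smooth_on_cong[THEN iffD1, rotated, OF smooth_along_curve[OF c S smooth_Gam[OF cM, of v v']]])
      (simp add: cM dom)
  have 2: "smooth_on S (\<lambda>t. Gam c (\<gamma> t) (u t) v')" for v'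
    by (rule smooth_on_linear_apply[of S "\<lambda>t v. Gam c (\<gamma> t) v v'" u, OF S(1) Gam_linear1[OF cM dom] 1 u])
  show ?thesis
    by (rule smooth_on_linear_apply[of S "\<lambda>t v. Gam c (\<gamma> t) (u t) v" w, OF S(1) Gam_linear2[OF cM dom] 2 w])
qed

lemma Gm_curve_continuous:
  assumes c: "c \<in> A" and S: "fat S" "S \<subseteq> over (cdom c)" and v: "continuous_on S v" and w: "continuous_on S w"
  shows "continuous_on S (\<lambda>t. Gm c (\<gamma> t) (v t) (w t))"
proof -
  have cM: "c \<in> M" by (rule atlas_maximal[OF c])
  have G0: "continuous_on S (\<lambda>t. Gm c (\<gamma> t) v w)" for v w
  proof -
    have "continuous_on S (\<lambda>t. Gm c (cinv c (xc c t)) v w)"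
      by (rule smooth_on_continuous[OF smooth_along_curve[OF c S smooth_Gm[OF c, of v w]]])
    then show ?thesis by (rule continuous_on_cong[THEN iffD1, rotated 2]) (use cM S(2) in auto)
  qed
  have lin1: "linear (\<lambda>v. Gm c (\<gamma> t) v w)" and lin2: "linear (\<lambda>w. Gm c (\<gamma> t) v w)" if "t \<in> S" for t v w
    using Gm_bilinear[OF cM, of "\<gamma> t"] that S(2) by (auto simp: bilinear_def)
  have 1: "continuous_on S (\<lambda>t. Gm c (\<gamma> t) (v t) w')" for w'
    by (rule continuous_on_linear_apply[of S "\<lambda>t v. Gm c (\<gamma> t) v w'" v, OF lin1 G0 v])
  show ?thesis
    by (rule continuous_on_linear_apply[of S "\<lambda>t w. Gm c (\<gamma> t) (v t) w" w, OF lin2 1 w])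
qed

lemma coord_velocity:
  assumes c: "c \<in> A" and t: "t \<in> {a..b}" "\<gamma> t \<in> cdom c"
  shows "coord A c (\<gamma> t) (vel t) = xdot c t"
proof -
  let ?k = "chart_at A (\<gamma> t)"
  have cM: "c \<in> M" by (rule atlas_maximal[OF c])
  note kM = chart_at(3)[of "\<gamma> t"] and kt = chart_at(2)[of "\<gamma> t"]
  let ?U = "cdom c \<inter> cdom ?k"
  have U: "open ?U" "\<gamma> t \<in> ?U" using cM kM t kt by auto
  have "(xc c has_derivative (\<lambda>h. h *\<^sub>R xdot c t)) (at t within {a..b})" by (rule xc_has_derivative[OF c t])
  moreover have "((cmap ?k \<circ> cinv c) has_derivative Jac c ?k (cmap c (\<gamma> t))) (at (xc c t))"
    using Jac_has_derivative[OF cM kM t(2) kt] by simp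
  ultimately have "((\<lambda>s. (cmap ?k \<circ> cinv c) (xc c s)) has_derivative (\<lambda>h. Jac c ?k (cmap c (\<gamma> t)) (h *\<^sub>R xdot c t))) (at t within {a..b})"
    by (rule has_derivative_compose)
  then have "((\<lambda>s. (cmap ?k \<circ> cinv c) (xc c s)) has_derivative (\<lambda>h. h *\<^sub>R Jac c ?k (cmap c (\<gamma> t)) (xdot c t))) (at t within over ?U)"
    unfolding at_within_over[OF U(1) t(1) U(2)] using linear_scale[OF Jac_linear[OF cM kM t(2) kt]] by simp
  then have "(xc ?k has_derivative (\<lambda>h. h *\<^sub>R Jac c ?k (cmap c (\<gamma> t)) (xdot c t))) (at t within over ?U)"
    by (rule has_derivative_transform[rotated 2]) (use t U cM in auto)
  then have "(xc ?k has_vector_derivative Jac c ?k (cmap c (\<gamma> t)) (xdot c t)) (at t within {a..b})"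
    unfolding at_within_over[OF U(1) t(1) U(2)] has_vector_derivative_def .
  then have "vel t = Jac c ?k (cmap c (\<gamma> t)) (xdot c t)"
    unfolding velocity_def using vector_derivative_within_cbox[OF ab] t(1) by simp
  then show ?thesis using coord_coord_field[OF cM t(2), of "xdot c t"] by (simp add: coord_field_eq)
qed

lemma smooth_velocity: "smooth_along A \<gamma> {a..b} vel"
  unfolding smooth_along_def
proof
  fix c assume c: "c \<in> A"
  show "smooth_on (over (cdom c)) (vc c vel)"
    by (rule smooth_on_cong[THEN iffD1, rotated, OF smooth_xdot[OF c]]) (use coord_velocity[OF c] in simp)
qed

lemma covd_coord_field:
  assumes c: "c \<in> A" and t: "t \<in> {a..b}" "\<gamma> t \<in> cdom c"
    and V: "(vc c V has_vector_derivative v') (at t within {a..b})"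
  shows "cov V t = coord_field A c (v' + Gam c (\<gamma> t) (xdot c t) (vc c V t)) (\<gamma> t)"
proof -
  let ?d = "chart_at A (\<gamma> t)" and ?p = "\<gamma> t" and ?x = "cmap c (\<gamma> t)"
  have cM: "c \<in> M" by (rule atlas_maximal[OF c])
  note dM = chart_at(3)[of "\<gamma> t"] and dt = chart_at(2)[of "\<gamma> t"]
  let ?U = "cdom c \<inter> cdom ?d"
  have U: "open ?U" "?p \<in> ?U" using cM dM t dt by auto
  have S: "open (cmap c ` ?U)" "?x \<in> cmap c ` ?U" using open_overlap[OF cM dM] U by auto
  define dJ where "dJ w = frechet_derivative (\<lambda>x. Jac c ?d x w) (at ?x)" for w
  have dJ: "((\<lambda>x. Jac c ?d x w) has_derivative dJ w) (at ?x)" for w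
    unfolding dJ_def by (rule smooth_on_has_derivative[OF smooth_Jac[OF cM dM] S])
  have lin: "linear (Jac c ?d ?x)" by (rule Jac_linear[OF cM dM t(2) dt])
  note at_U = at_within_over[OF U(1) t(1) U(2)]
  have "((\<lambda>s. Jac c ?d (xc c s) (vc c V s)) has_derivative
      (\<lambda>h. dJ (vc c V t) (h *\<^sub>R xdot c t) + Jac c ?d (xc c t) (h *\<^sub>R v'))) (at t within over ?U)"
  proof (rule has_derivative_linear_apply[where L = "\<lambda>s. Jac c ?d (xc c s)" and y = "vc c V"
        and L' = "\<lambda>w h. dJ w (h *\<^sub>R xdot c t)"])
    show "linear (Jac c ?d (xc c s))" if "s \<in> over ?U" for s using that by (auto intro: Jac_linear[OF cM dM])
    show "((\<lambda>s. Jac c ?d (xc c s) w) has_derivative (\<lambda>h. dJ w (h *\<^sub>R xdot c t))) (at t within over ?U)" for w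
      unfolding at_U using dJ[of w] by (intro has_derivative_compose[OF xc_has_derivative[OF c t]]) simp
    show "(vc c V has_derivative (\<lambda>h. h *\<^sub>R v')) (at t within over ?U)"
      unfolding at_U using V by (simp add: has_vector_derivative_def)
  qed (use t U in auto)
  then have "(vc ?d V has_derivative
      (\<lambda>h. dJ (vc c V t) (h *\<^sub>R xdot c t) + Jac c ?d (xc c t) (h *\<^sub>R v'))) (at t within over ?U)"
    by (rule has_derivative_transform[rotated 2]) (use t U in \<open>auto simp: coord_change[OF cM dM]\<close>)
  moreover have "(\<lambda>h. dJ (vc c V t) (h *\<^sub>R xdot c t) + Jac c ?d (xc c t) (h *\<^sub>R v'))
      = (\<lambda>h. h *\<^sub>R (dJ (vc c V t) (xdot c t) + Jac c ?d ?x v'))"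
    using linear_scale[OF has_derivative_linear[OF dJ]] linear_scale[OF lin] by (auto simp: algebra_simps)
  ultimately have "(vc ?d V has_vector_derivative dJ (vc c V t) (xdot c t) + Jac c ?d ?x v') (at t within {a..b})"
    unfolding at_U has_vector_derivative_def by simp
  then have vd: "vector_derivative (vc ?d V) (at t within {a..b}) = dJ (vc c V t) (xdot c t) + Jac c ?d ?x v'"
    using vector_derivative_within_cbox[OF ab] t(1) by simp
  let ?Y = "coord_field A ?d (V t)"
  have Y: "smooth_field_on A (cdom ?d) ?Y" by (rule smooth_coord_field[OF dM])
  define dY where "dY = frechet_derivative (rep c ?Y) (at ?x)"
  have Yp: "?Y ?p = V t" using coord_field_coord[OF dM dt, of "V t"] by simp
  have "((\<lambda>x. Jac c ?d x (rep c ?Y x)) has_derivative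
      (\<lambda>h. dJ (rep c ?Y ?x) h + Jac c ?d ?x (dY h))) (at ?x within cmap c ` ?U)"
  proof (rule has_derivative_linear_apply[where L = "Jac c ?d", OF _ S(2)])
    show "linear (Jac c ?d x)" if "x \<in> cmap c ` ?U" for x using that by (auto intro: Jac_linear[OF cM dM])
    show "(rep c ?Y has_derivative dY) (at ?x within cmap c ` ?U)"
      unfolding dY_def by (rule has_derivative_at_withinI[OF rep_has_derivative[OF Y dt cM t(2)]])
  qed (rule has_derivative_at_withinI[OF dJ])
  then have 1: "((\<lambda>x. Jac c ?d x (rep c ?Y x)) has_derivative
      (\<lambda>h. dJ (vc c V t) h + Jac c ?d ?x (dY h))) (at ?x)"
    unfolding at_within_open[OF S(2,1)] rep_cmap[OF cM t(2)] Yp .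
  have "((\<lambda>x. V t) has_derivative (\<lambda>h. dJ (vc c V t) h + Jac c ?d ?x (dY h))) (at ?x)"
  proof (rule has_derivative_transform_within_open[OF 1 S])
    fix x assume "x \<in> cmap c ` ?U"
    then obtain q where q: "x = cmap c q" "q \<in> cdom c" "q \<in> cdom ?d" by auto
    show "Jac c ?d x (rep c ?Y x) = V t"
      unfolding q(1) rep_cmap[OF cM q(2)] coord_change[OF cM dM q(2,3), symmetric] by (rule coord_coord_field[OF dM q(3)])
  qed
  from fun_cong[OF has_derivative_unique[OF this has_derivative_const], of "xdot c t"]
  have dJY: "dJ (vc c V t) (xdot c t) + Jac c ?d ?x (dY (xdot c t)) = 0" .
  have "coord A c ?p (D ?p (vel t) ?Y) = dY (xdot c t) + Gam c ?p (xdot c t) (vc c V t)"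
    using D_coord[OF Y dt cM t(2), of "vel t"] coord_velocity[OF c t] by (simp add: dY_def Yp)
  moreover have "D ?p (vel t) ?Y = Jac c ?d ?x (coord A c ?p (D ?p (vel t) ?Y))"
    using coord_change[OF cM dM t(2) dt, of "D ?p (vel t) ?Y"] by simp
  ultimately have D: "D ?p (vel t) ?Y = Jac c ?d ?x (dY (xdot c t)) + Jac c ?d ?x (Gam c ?p (xdot c t) (vc c V t))"
    by (simp only: linear_add[OF lin])
  have "cov V t = (dJ (vc c V t) (xdot c t) + Jac c ?d ?x v')
      + (Jac c ?d ?x (dY (xdot c t)) + Jac c ?d ?x (Gam c ?p (xdot c t) (vc c V t)))"
    unfolding covd_def vd D ..
  also have "\<dots> = (dJ (vc c V t) (xdot c t) + Jac c ?d ?x (dY (xdot c t)))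
      + (Jac c ?d ?x v' + Jac c ?d ?x (Gam c ?p (xdot c t) (vc c V t)))"
    by (simp only: add_ac)
  finally have "cov V t = Jac c ?d ?x v' + Jac c ?d ?x (Gam c ?p (xdot c t) (vc c V t))"
    unfolding dJY by simp
  then show ?thesis by (simp add: coord_field_eq linear_add[OF lin])
qed

definition fdiff :: "(real \<Rightarrow> 'e) \<Rightarrow> real \<Rightarrow> bool"
  where "fdiff V t \<longleftrightarrow> (\<forall>c\<in>A. \<gamma> t \<in> cdom c \<longrightarrow> vc c V differentiable (at t within {a..b}))"

lemma fdiffD:
  assumes "fdiff V t" "c \<in> A" "\<gamma> t \<in> cdom c"
  obtains v' where "(vc c V has_vector_derivative v') (at t within {a..b})"
  using assms unfolding fdiff_def by (metis vector_derivative_works)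

lemma smooth_along_fdiff:
  assumes V: "smooth_along A \<gamma> {a..b} V" and t: "t \<in> {a..b}"
  shows "fdiff V t"
  unfolding fdiff_def
proof (intro ballI impI)
  fix c assume c: "c \<in> A" "\<gamma> t \<in> cdom c"
  have "smooth_on (over (cdom c)) (vc c V)" using V c by (simp add: smooth_along_def)
  from smooth_on_has_derivative_within[OF this, of t]
  show "vc c V differentiable (at t within {a..b})"
    unfolding at_within_over[OF open_cdom[OF atlas_maximal[OF c(1)]] t c(2)] using t c(2) by (auto intro: differentiableI)
qed

lemma chart_\<gamma>: "chart_at A (\<gamma> t) \<in> A" "chart_at A (\<gamma> t) \<in> M" "\<gamma> t \<in> cdom (chart_at A (\<gamma> t))"
  by (rule chart_at)+

lemma cov_combine:
  assumes t: "t \<in> {a..b}" and V: "fdiff V t" and W: "fdiff W t"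
  shows "cov (r *\<^sub>R V + W) t = r *\<^sub>R cov V t + cov W t"
proof -
  let ?c = "chart_at A (\<gamma> t)"
  note c = chart_\<gamma>[of t]
  obtain v' where v': "(vc ?c V has_vector_derivative v') (at t within {a..b})" by (rule fdiffD[OF V c(1,3)])
  obtain w' where w': "(vc ?c W has_vector_derivative w') (at t within {a..b})" by (rule fdiffD[OF W c(1,3)])
  note at = at_within_over[OF open_cdom[OF c(2)] t c(3)]
  have app: "(r *\<^sub>R V + W) s = r *\<^sub>R V s + W s" for s by (simp add: scaleR_fun_def)
  have lin: "vc ?c (r *\<^sub>R V + W) s = r *\<^sub>R vc ?c V s + vc ?c W s" if "s \<in> over (cdom ?c)" for s
    using that c(2) unfolding app by (simp add: linear_add[OF coord_linear] linear_scale[OF coord_linear])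
  have "((\<lambda>s. r *\<^sub>R vc ?c V s + vc ?c W s) has_derivative (\<lambda>h. h *\<^sub>R (r *\<^sub>R v' + w'))) (at t within over (cdom ?c))"
    unfolding at using has_derivative_add[OF has_derivative_scaleR_right w'[unfolded has_vector_derivative_def],
        OF v'[unfolded has_vector_derivative_def], of r]
    by (simp add: algebra_simps)
  then have "(vc ?c (r *\<^sub>R V + W) has_derivative (\<lambda>h. h *\<^sub>R (r *\<^sub>R v' + w'))) (at t within over (cdom ?c))"
    by (rule has_derivative_transform[rotated 2]) (use t c(3) lin in auto)
  then have vw': "(vc ?c (r *\<^sub>R V + W) has_vector_derivative r *\<^sub>R v' + w') (at t within {a..b})"
    unfolding at has_vector_derivative_def .
  have "t \<in> over (cdom ?c)" using t c(3) by simp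
  then show ?thesis
    unfolding covd_coord_field[OF c(1) t c(3) v'] covd_coord_field[OF c(1) t c(3) w']
      covd_coord_field[OF c(1) t c(3) vw'] lin[OF \<open>t \<in> over _\<close>]
    by (simp add: linear_add[OF coord_field_linear[OF c(2,3)]] linear_scale[OF coord_field_linear[OF c(2,3)]]
        linear_add[OF Gam_linear2[OF c(2,3)]] linear_scale[OF Gam_linear2[OF c(2,3)]] algebra_simps)
qed

lemma smooth_cov:
  assumes V: "smooth_along A \<gamma> {a..b} V"
  shows "smooth_along A \<gamma> {a..b} (cov V)"
  unfolding smooth_along_def
proof
  fix c assume c: "c \<in> A"
  have cM: "c \<in> M" by (rule atlas_maximal[OF c])
  let ?S = "over (cdom c)"
  have fat: "fat ?S" using cM by (intro fat_over) simp
  have Vc: "smooth_on ?S (vc c V)" using V c by (simp add: smooth_along_def)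
  have "smooth_on ?S (\<lambda>t. frechet_derivative (vc c V) (at t within ?S) 1 + Gam c (\<gamma> t) (xdot c t) (vc c V t))"
    by (intro smooth_on_add fat smooth_on_derivative_within[OF Vc] smooth_Gam_curve[OF c fat] smooth_xdot c Vc) simp
  then show "smooth_on ?S (vc c (cov V))"
  proof (rule smooth_on_cong[THEN iffD1, rotated])
    fix t assume "t \<in> ?S"
    then have t: "t \<in> {a..b}" "\<gamma> t \<in> cdom c" by auto
    have "(vc c V has_vector_derivative frechet_derivative (vc c V) (at t within ?S) 1) (at t within {a..b})"
      using smooth_on_has_vector_derivative[OF Vc, of t] at_within_over[OF open_cdom[OF cM] t] t by simp
    from covd_coord_field[OF c t this]
    show "frechet_derivative (vc c V) (at t within ?S) 1 + Gam c (\<gamma> t) (xdot c t) (vc c V t) = vc c (cov V) t"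
      using cM t by simp
  qed
qed

lemma g_has_derivative:
  assumes t: "t \<in> {a..b}" and V: "fdiff V t" and W: "fdiff W t"
  shows "((\<lambda>s. g (\<gamma> s) (V s) (W s)) has_vector_derivative
    g (\<gamma> t) (cov V t) (W t) + g (\<gamma> t) (V t) (cov W t)) (at t within {a..b})"
proof -
  let ?c = "chart_at A (\<gamma> t)" and ?p = "\<gamma> t"
  note c = chart_\<gamma>(1)[of t] and cM = chart_\<gamma>(2)[of t] and p = chart_\<gamma>(3)[of t]
  let ?S = "over (cdom ?c)" and ?x = "xc ?c t"
  obtain v' where v': "(vc ?c V has_vector_derivative v') (at t within {a..b})" by (rule fdiffD[OF V c p])
  obtain w' where w': "(vc ?c W has_vector_derivative w') (at t within {a..b})" by (rule fdiffD[OF W c p])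
  have tS: "t \<in> ?S" using t p by simp
  note at = at_within_over[OF open_cdom[OF cM] t p]
  define u where "u = xdot ?c t"
  have lin1: "linear (\<lambda>v. Gm ?c ?p v w)" and lin2: "linear (\<lambda>w. Gm ?c ?p v w)" for v w
    using Gm_bilinear[OF cM p] by (auto simp: bilinear_def)
  have lin3: "linear (\<lambda>u. Gam ?c ?p u w)" for w by (rule Gam_linear1[OF cM p])
  have Gm': "((\<lambda>s. Gm ?c (\<gamma> s) v w) has_derivative
      (\<lambda>h. h *\<^sub>R (Gm ?c ?p (Gam ?c ?p u v) w + Gm ?c ?p v (Gam ?c ?p u w)))) (at t within ?S)" for v w
  proof -
    have G: "((\<lambda>x. Gm ?c (cinv ?c x) v w) has_derivative frechet_derivative (\<lambda>x. Gm ?c (cinv ?c x) v w) (at ?x)) (at ?x)"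
      using smooth_on_has_derivative[OF smooth_Gm[OF c] chart_nhd[OF cM p]] by simp
    have "((\<lambda>s. Gm ?c (cinv ?c (xc ?c s)) v w) has_derivative
        (\<lambda>h. frechet_derivative (\<lambda>x. Gm ?c (cinv ?c x) v w) (at ?x) (h *\<^sub>R u))) (at t within ?S)"
      unfolding at u_def by (rule has_derivative_compose[OF xc_has_derivative[OF c t p] G])
    then have 1: "((\<lambda>s. Gm ?c (\<gamma> s) v w) has_derivative
        (\<lambda>h. frechet_derivative (\<lambda>x. Gm ?c (cinv ?c x) v w) (at ?x) (h *\<^sub>R u))) (at t within ?S)"
      by (rule has_derivative_transform[rotated 2]) (use tS cM in auto)
    show ?thesis
    proof (rule has_derivative_eq_rhs[OF 1], rule ext)
      fix h
      show "frechet_derivative (\<lambda>x. Gm ?c (cinv ?c x) v w) (at ?x) (h *\<^sub>R u)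
          = h *\<^sub>R (Gm ?c ?p (Gam ?c ?p u v) w + Gm ?c ?p v (Gam ?c ?p u w))"
        unfolding o_apply Gm_derivative[OF c p]
        by (simp add: linear_scale[OF lin3] linear_scale[OF lin1] linear_scale[OF lin2] algebra_simps)
    qed
  qed
  have "((\<lambda>s. Gm ?c (\<gamma> s) (vc ?c V s) (vc ?c W s)) has_derivative
      (\<lambda>h. h *\<^sub>R (Gm ?c ?p (Gam ?c ?p u (vc ?c V t)) (vc ?c W t) + Gm ?c ?p (vc ?c V t) (Gam ?c ?p u (vc ?c W t)))
        + Gm ?c ?p (h *\<^sub>R v') (vc ?c W t) + Gm ?c ?p (vc ?c V t) (h *\<^sub>R w'))) (at t within ?S)"
  proof (rule has_derivative_bilinear_apply[where B = "\<lambda>s. Gm ?c (\<gamma> s)" and y = "vc ?c V" and z = "vc ?c W"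
      and B' = "\<lambda>v w h. h *\<^sub>R (Gm ?c ?p (Gam ?c ?p u v) w + Gm ?c ?p v (Gam ?c ?p u w))", OF _ tS Gm'])
    show "bilinear (Gm ?c (\<gamma> s))" if "s \<in> ?S" for s using that by (intro Gm_bilinear[OF cM]) simp
    show "(vc ?c V has_derivative (\<lambda>h. h *\<^sub>R v')) (at t within ?S)" "(vc ?c W has_derivative (\<lambda>h. h *\<^sub>R w')) (at t within ?S)"
      unfolding at using v' w' by (auto simp: has_vector_derivative_def)
  qed
  then have "((\<lambda>s. g (\<gamma> s) (V s) (W s)) has_derivative
      (\<lambda>h. h *\<^sub>R (Gm ?c ?p (Gam ?c ?p u (vc ?c V t)) (vc ?c W t) + Gm ?c ?p (vc ?c V t) (Gam ?c ?p u (vc ?c W t)))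
        + Gm ?c ?p (h *\<^sub>R v') (vc ?c W t) + Gm ?c ?p (vc ?c V t) (h *\<^sub>R w'))) (at t within ?S)"
    by (rule has_derivative_transform[rotated 2]) (use tS in \<open>auto simp: Gm_coord[OF cM]\<close>)
  moreover have "g ?p (cov V t) (W t) + g ?p (V t) (cov W t)
      = Gm ?c ?p (v' + Gam ?c ?p u (vc ?c V t)) (vc ?c W t) + Gm ?c ?p (vc ?c V t) (w' + Gam ?c ?p u (vc ?c W t))"
    unfolding Gm_coord[OF cM p] covd_coord_field[OF c t p v'] covd_coord_field[OF c t p w'] coord_coord_field[OF cM p] u_def ..
  ultimately show ?thesis
    unfolding has_vector_derivative_def at
    by (simp only:) (simp add: linear_scale[OF lin1] linear_scale[OF lin2] linear_add[OF lin1] linear_add[OF lin2] algebra_simps)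
qed

section \<open>The index form\<close>

abbreviation curv_op :: "(real \<Rightarrow> 'e) \<Rightarrow> real \<Rightarrow> 'e"
  where "curv_op V t \<equiv> curvature A D (\<gamma> t) (vel t) (V t) (vel t)"

definition integrand :: "(real \<Rightarrow> 'e) \<Rightarrow> (real \<Rightarrow> 'e) \<Rightarrow> real \<Rightarrow> real"
  where "integrand V W t = g (\<gamma> t) (cov V t) (cov W t) + g (\<gamma> t) (curv_op V t) (W t)"

lemma g_linear1: "linear (\<lambda>v. g p v w)" and g_linear2: "linear (\<lambda>w. g p v w)"
  using g_bilinear[of p] by (auto simp: bilinear_def)

lemma integrand_sym: "integrand V W t = integrand W V t"
  unfolding integrand_def using curvature_sym[of "\<gamma> t" "vel t" "V t" "W t"] g_sym by metis

lemma integrand_combine: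
  assumes "t \<in> {a..b}" "fdiff U t" "fdiff V t"
  shows "integrand (r *\<^sub>R U + V) W t = r * integrand U W t + integrand V W t"
proof -
  have "(r *\<^sub>R U + V) t = r *\<^sub>R U t + V t" by (simp add: scaleR_fun_def)
  then show ?thesis
    unfolding integrand_def curvature_sym[of "\<gamma> t" "vel t" _ "W t"] cov_combine[OF assms]
    by (simp add: linear_add[OF g_linear1] linear_scale[OF g_linear1] linear_add[OF g_linear2]
        linear_scale[OF g_linear2] algebra_simps)
qed

lemma smooth_along_subinterval:
  assumes V: "smooth_along A \<gamma> {s..u} V" and "{l..r} \<subseteq> {s..u}" "l < r" "{s..u} \<subseteq> {a..b}"
  shows "smooth_along A \<gamma> {l..r} V"
  unfolding smooth_along_def
proof
  fix c assume c: "c \<in> A"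
  have "continuous_on {l..r} \<gamma>"
    by (rule continuous_on_subset[OF curve_continuous order_trans[OF assms(2,4)]])
  then have "openin (top_of_set {l..r}) ({l..r} \<inter> \<gamma> -` cdom c)"
    by (rule continuous_openin_preimage_gen) (simp add: atlas_maximal[OF c])
  from fat_openin[OF fat_interval[OF assms(3)] this]
  have fat: "fat {t \<in> {l..r}. \<gamma> t \<in> cdom c}" by (simp add: vimage_def Int_def)
  show "smooth_on {t \<in> {l..r}. \<gamma> t \<in> cdom c} (vc c V)"
    by (rule smooth_on_subset[OF fat, of "{t \<in> {s..u}. \<gamma> t \<in> cdom c}"])
       (use V c assms(2) in \<open>auto simp: smooth_along_def\<close>)
qed

definition pwfields :: "(real \<Rightarrow> 'e) set" where "pwfields = piecewise_smooth_fields A a b \<gamma>"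

lemma pwfields_piece:
  assumes "V \<in> pwfields"
  obtains T where "finite T"
    "\<And>t. a \<le> t \<Longrightarrow> t < b \<Longrightarrow> \<exists>s\<in>T. \<exists>u\<in>T. s \<le> t \<and> t < u \<and> {s..u} \<subseteq> {a..b} \<and> smooth_along A \<gamma> {s..u} V"
    "\<And>t. a < t \<Longrightarrow> t \<le> b \<Longrightarrow> \<exists>s\<in>T. \<exists>u\<in>T. s < t \<and> t \<le> u \<and> {s..u} \<subseteq> {a..b} \<and> smooth_along A \<gamma> {s..u} V"
proof -
  have "\<exists>T. finite T \<and> {a, b} \<subseteq> T \<and> T \<subseteq> {a..b} \<and>
      (\<forall>s\<in>T. \<forall>u\<in>T. s < u \<and> T \<inter> {s<..<u} = {} \<longrightarrow> smooth_along A \<gamma> {s..u} V)"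
    using assms by (simp add: pwfields_def piecewise_smooth_fields_def)
  then obtain T where T: "finite T" "{a, b} \<subseteq> T" "T \<subseteq> {a..b}"
    and piece: "\<forall>s\<in>T. \<forall>u\<in>T. s < u \<and> T \<inter> {s<..<u} = {} \<longrightarrow> smooth_along A \<gamma> {s..u} V"
    by (elim exE conjE)
  have succ: "\<exists>u\<in>T. s < u \<and> {s..u} \<subseteq> {a..b} \<and> smooth_along A \<gamma> {s..u} V" if s: "s \<in> T" "s < b" for s
  proof -
    let ?R = "{x \<in> T. s < x}"
    have R: "finite ?R" "?R \<noteq> {}" using T s by auto
    have u: "Min ?R \<in> ?R" by (rule Min_in[OF R])
    moreover have "T \<inter> {s<..<Min ?R} = {}" using R(1) by (auto dest: Min_le)
    moreover have "{s..Min ?R} \<subseteq> {a..b}" using s u T(3) by auto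
    ultimately show ?thesis using piece[rule_format, OF s(1), of "Min ?R"] by auto
  qed
  have Max: "Max {x \<in> T. x \<le> t} \<in> {x \<in> T. x \<le> t}" if "a \<le> t" for t
    by (rule Max_in) (use T that in auto)
  have Max': "Max {x \<in> T. x < t} \<in> {x \<in> T. x < t}" if "a < t" for t
    by (rule Max_in) (use T that in auto)
  show thesis
  proof (rule that[OF T(1)])
    fix t assume t: "a \<le> t" "t < b"
    let ?s = "Max {x \<in> T. x \<le> t}"
    obtain u where u: "u \<in> T" "?s < u" "{?s..u} \<subseteq> {a..b}" "smooth_along A \<gamma> {?s..u} V"
      using succ[of ?s] Max[OF t(1)] t(2) by auto
    have "t < u" using Max_ge[of "{x \<in> T. x \<le> t}" u] T(1) u(1,2) by fastforce
    then show "\<exists>s\<in>T. \<exists>u\<in>T. s \<le> t \<and> t < u \<and> {s..u} \<subseteq> {a..b} \<and> smooth_along A \<gamma> {s..u} V"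
      using u Max[OF t(1)] by (intro bexI[of _ ?s] bexI[of _ u]) auto
  next
    fix t assume t: "a < t" "t \<le> b"
    let ?s = "Max {x \<in> T. x < t}"
    obtain u where u: "u \<in> T" "?s < u" "{?s..u} \<subseteq> {a..b}" "smooth_along A \<gamma> {?s..u} V"
      using succ[of ?s] Max'[OF t(1)] t(2) by auto
    have "t \<le> u" using Max_ge[of "{x \<in> T. x < t}" u] T(1) u(1,2) by fastforce
    then show "\<exists>s\<in>T. \<exists>u\<in>T. s < t \<and> t \<le> u \<and> {s..u} \<subseteq> {a..b} \<and> smooth_along A \<gamma> {s..u} V"
      using u Max'[OF t(1)] by (intro bexI[of _ ?s] bexI[of _ u]) auto
  qed
qed

lemma pwfields_fdiff:
  assumes "V \<in> pwfields"
  obtains T where "finite T" "\<And>t. t \<in> {a..b} - T \<Longrightarrow> fdiff V t"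
proof -
  obtain T where T: "finite T"
    "\<And>t. a \<le> t \<Longrightarrow> t < b \<Longrightarrow> \<exists>s\<in>T. \<exists>u\<in>T. s \<le> t \<and> t < u \<and> {s..u} \<subseteq> {a..b} \<and> smooth_along A \<gamma> {s..u} V"
    by (rule pwfields_piece[OF assms]) blast
  have "fdiff V t" if t: "t \<in> {a..b} - insert b T" for t
  proof -
    have "a \<le> t" "t < b" using t by auto
    then obtain s u where s: "s \<in> T" "s \<le> t" and u: "t < u" and sub: "{s..u} \<subseteq> {a..b}" and sm: "smooth_along A \<gamma> {s..u} V"
      using T(2) by blast
    have s: "s < t" using s t by (cases "s = t") auto
    show ?thesis
      unfolding fdiff_def
    proof (intro ballI impI)
      fix c assume c: "c \<in> A" "\<gamma> t \<in> cdom c"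
      let ?S = "{r \<in> {s..u}. \<gamma> r \<in> cdom c}"
      have "smooth_on ?S (vc c V)" using sm c by (simp add: smooth_along_def)
      from smooth_on_has_derivative_within[OF this, of t]
      have "vc c V differentiable (at t within ?S)" using s u c(2) by (auto intro: differentiableI)
      moreover have "?S = over (cdom c) \<inter> {s..u}" using sub by auto
      moreover have "at t within over (cdom c) \<inter> {s..u} = at t within over (cdom c)"
        by (rule at_within_nhd[of t "{s<..<u}"]) (use s u in auto)
      moreover have "at t within over (cdom c) = at t within {a..b}"
        by (rule at_within_over) (use t c atlas_maximal in auto)
      ultimately show "vc c V differentiable (at t within {a..b})" by simp
    qed
  qed
  then show thesis using that[of "insert b T"] T(1) by blast
qed

lemma pwfields_smooth_near:
  assumes V: "V \<in> pwfields" and t: "t \<in> {a..b}"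
  obtains d where "d > 0" "\<forall>l r. a \<le> l \<and> l < r \<and> r \<le> b \<and> (l = t \<or> r = t) \<and> r - l < d \<longrightarrow> smooth_along A \<gamma> {l..r} V"
proof -
  obtain T where T: "finite T"
    "\<And>t. a \<le> t \<Longrightarrow> t < b \<Longrightarrow> \<exists>s\<in>T. \<exists>u\<in>T. s \<le> t \<and> t < u \<and> {s..u} \<subseteq> {a..b} \<and> smooth_along A \<gamma> {s..u} V"
    "\<And>t. a < t \<Longrightarrow> t \<le> b \<Longrightarrow> \<exists>s\<in>T. \<exists>u\<in>T. s < t \<and> t \<le> u \<and> {s..u} \<subseteq> {a..b} \<and> smooth_along A \<gamma> {s..u} V"
    by (rule pwfields_piece[OF V]) blast
  have "\<exists>d>0. \<forall>r. t < r \<and> r \<le> b \<and> r - t < d \<longrightarrow> smooth_along A \<gamma> {t..r} V"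
  proof (cases "t < b")
    case True
    then obtain s u where su: "s \<le> t" "t < u" "{s..u} \<subseteq> {a..b}" "smooth_along A \<gamma> {s..u} V"
      using T(2)[of t] t by auto
    show ?thesis
      by (rule exI[of _ "u - t"]) (use su in \<open>auto intro: smooth_along_subinterval[OF su(4) _ _ su(3)]\<close>)
  next
    case False
    then show ?thesis by (intro exI[of _ 1]) auto
  qed
  then obtain d1 where d1: "d1 > 0" "\<forall>r. t < r \<and> r \<le> b \<and> r - t < d1 \<longrightarrow> smooth_along A \<gamma> {t..r} V" by (elim exE conjE)
  have "\<exists>d>0. \<forall>l. a \<le> l \<and> l < t \<and> t - l < d \<longrightarrow> smooth_along A \<gamma> {l..t} V"
  proof (cases "a < t")
    case True
    then obtain s u where su: "s < t" "t \<le> u" "{s..u} \<subseteq> {a..b}" "smooth_along A \<gamma> {s..u} V"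
      using T(3)[of t] t by auto
    show ?thesis
      by (rule exI[of _ "t - s"]) (use su in \<open>auto intro: smooth_along_subinterval[OF su(4) _ _ su(3)]\<close>)
  next
    case False
    then show ?thesis by (intro exI[of _ 1]) auto
  qed
  then obtain d2 where d2: "d2 > 0" "\<forall>l. a \<le> l \<and> l < t \<and> t - l < d2 \<longrightarrow> smooth_along A \<gamma> {l..t} V" by (elim exE conjE)
  show thesis
    by (rule that[of "min d1 d2"]) (use d1 d2 in auto)
qed

text \<open>On the interior of a smooth piece the integrand agrees with an expression in one chart that
  is continuous up to the end points.\<close>

lemma integrand_integrable_piece:
  assumes lr: "l < r" "{l..r} \<subseteq> {a..b}" and c: "c \<in> A" "\<And>t. t \<in> {l..r} \<Longrightarrow> \<gamma> t \<in> cdom c"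
    and V: "smooth_along A \<gamma> {l..r} V" and W: "smooth_along A \<gamma> {l..r} W"
  shows "integrand V W integrable_on {l..r}"
proof -
  have cM: "c \<in> M" by (rule atlas_maximal[OF c(1)])
  let ?K = "{l..r}"
  have fat: "fat ?K" by (rule fat_interval[OF lr(1)])
  have K: "?K \<subseteq> over (cdom c)" using lr c(2) by auto
  have over: "{t \<in> ?K. \<gamma> t \<in> cdom c} = ?K" using c(2) by auto
  have along: "smooth_on ?K (vc c X)" if "smooth_along A \<gamma> ?K X" for X
  proof -
    have "smooth_on {t \<in> ?K. \<gamma> t \<in> cdom c} (vc c X)" using that c(1) unfolding smooth_along_def by blast
    then show ?thesis unfolding over .
  qed
  note Vs = along[OF V] and Ws = along[OF W]
  have xs: "smooth_on ?K (xdot c)" by (rule smooth_on_subset[OF fat K smooth_xdot[OF c(1)]])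
  define e where "e X t = frechet_derivative (vc c X) (at t within ?K) 1 + Gam c (\<gamma> t) (xdot c t) (vc c X t)" for X t
  define k where "k t = Gm c (\<gamma> t) (e V t) (e W t)
    + Gm c (\<gamma> t) (Rc c (\<gamma> t) (xdot c t) (vc c V t) (xdot c t)) (vc c W t)" for t
  have e: "continuous_on ?K (e X)" if X: "smooth_on ?K (vc c X)" for X
    unfolding e_def
    by (intro smooth_on_continuous smooth_on_add fat smooth_on_derivative_within[OF X] smooth_Gam_curve[OF c(1) fat K xs X])
  have R0: "continuous_on ?K (\<lambda>t. Rc c (\<gamma> t) u v w)" for u v w
  proof -
    have "continuous_on ?K (\<lambda>t. Rc c (cinv c (xc c t)) u v w)"
      by (rule smooth_on_continuous[OF smooth_along_curve[OF c(1) fat K smooth_Rc[OF cM, of u v w]]])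
    then show ?thesis by (rule continuous_on_cong[THEN iffD1, rotated 2]) (use cM c(2) in auto)
  qed
  have R: "continuous_on ?K (\<lambda>t. Rc c (\<gamma> t) (xdot c t) (vc c V t) (xdot c t))"
  proof -
    note xcont = smooth_on_continuous[OF xs]
    have 1: "continuous_on ?K (\<lambda>t. Rc c (\<gamma> t) (xdot c t) v w)" for v w
      by (rule continuous_on_linear_apply[of ?K "\<lambda>t u. Rc c (\<gamma> t) u v w" "xdot c", OF Rc_linear1[OF cM c(2)] R0 xcont])
    have 2: "continuous_on ?K (\<lambda>t. Rc c (\<gamma> t) (xdot c t) (vc c V t) w)" for w
      by (rule continuous_on_linear_apply[of ?K "\<lambda>t v. Rc c (\<gamma> t) (xdot c t) v w" "vc c V", OF Rc_linear2[OF cM c(2)] 1 smooth_on_continuous[OF Vs]])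
    show ?thesis
      by (rule continuous_on_linear_apply[of ?K "\<lambda>t w. Rc c (\<gamma> t) (xdot c t) (vc c V t) w" "xdot c", OF Rc_linear3[OF cM c(2)] 2 xcont])
  qed
  have "continuous_on ?K k"
    unfolding k_def by (intro continuous_on_add Gm_curve_continuous[OF c(1) fat K] e Vs Ws R smooth_on_continuous)
  then have "k integrable_on ?K" by (rule integrable_continuous_real)
  moreover have "integrand V W t = k t" if t: "t \<in> ?K - {l, r}" for t
  proof -
    have tI: "t \<in> {a..b}" "\<gamma> t \<in> cdom c" using t lr c(2) by auto
    have cov: "cov X t = coord_field A c (e X t) (\<gamma> t)" if X: "smooth_on ?K (vc c X)" for X
    proof -
      have "(vc c X has_vector_derivative frechet_derivative (vc c X) (at t within ?K) 1) (at t within ?K)"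
        using smooth_on_has_vector_derivative[OF X] t by simp
      moreover have "at t within ?K = at t" by (rule at_within_interior) (use t in auto)
      ultimately have "(vc c X has_vector_derivative frechet_derivative (vc c X) (at t within ?K) 1) (at t within {a..b})"
        by (metis has_vector_derivative_at_within)
      from covd_coord_field[OF c(1) tI this] show ?thesis by (simp add: e_def)
    qed
    show ?thesis
      unfolding integrand_def k_def Gm_coord[OF cM tI(2)] cov[OF Vs] cov[OF Ws] coord_coord_field[OF cM tI(2)]
        curvature_coord[OF cM tI(2)] coord_velocity[OF c(1) tI] ..
  qed
  ultimately show ?thesis
    using integrable_spike_finite[of "{l, r}" ?K "integrand V W" k] by simp
qed

lemma curve_nhd:
  assumes t: "t \<in> {a..b}" and U: "open U" "\<gamma> t \<in> U"
  obtains d where "d > 0" "\<forall>s\<in>{a..b}. \<bar>s - t\<bar> < d \<longrightarrow> \<gamma> s \<in> U"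
proof -
  obtain N where N: "open N" "over U = {a..b} \<inter> N" using openin_over[OF U(1)] by (auto simp: openin_open)
  have "t \<in> over U" using t U by simp
  then have "t \<in> N" unfolding N(2) by simp
  then obtain d where d: "d > 0" "ball t d \<subseteq> N" using N(1) open_contains_ball by blast
  show thesis
  proof (rule that[OF d(1)], intro ballI impI)
    fix s assume s: "s \<in> {a..b}" "\<bar>s - t\<bar> < d"
    then have "s \<in> ball t d" by (simp add: dist_real_def abs_minus_commute)
    then have "s \<in> {a..b} \<inter> N" using d s by auto
    then show "\<gamma> s \<in> U" unfolding N(2)[symmetric] by simp
  qed
qed

lemma integrand_integrable_near:
  assumes V: "V \<in> pwfields" and W: "W \<in> pwfields" and t: "t \<in> {a..b}"
  obtains d where "d > 0" "\<forall>l r. a \<le> l \<and> l < r \<and> r \<le> b \<and> (l = t \<or> r = t) \<and> r - l < d \<longrightarrow> integrand V W integrable_on {l..r}"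
proof -
  let ?c = "chart_at A (\<gamma> t)"
  obtain d where d: "d > 0" "\<forall>s\<in>{a..b}. \<bar>s - t\<bar> < d \<longrightarrow> \<gamma> s \<in> cdom ?c"
    by (rule curve_nhd[OF t open_cdom[OF chart_\<gamma>(2)] chart_\<gamma>(3)])
  obtain d1 where d1: "d1 > 0" "\<forall>l r. a \<le> l \<and> l < r \<and> r \<le> b \<and> (l = t \<or> r = t) \<and> r - l < d1 \<longrightarrow> smooth_along A \<gamma> {l..r} V"
    by (rule pwfields_smooth_near[OF V t])
  obtain d2 where d2: "d2 > 0" "\<forall>l r. a \<le> l \<and> l < r \<and> r \<le> b \<and> (l = t \<or> r = t) \<and> r - l < d2 \<longrightarrow> smooth_along A \<gamma> {l..r} W"
    by (rule pwfields_smooth_near[OF W t])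
  show thesis
  proof (rule that[of "min d (min d1 d2)"], simp add: d d1 d2, intro allI impI)
    fix l r assume lr: "a \<le> l \<and> l < r \<and> r \<le> b \<and> (l = t \<or> r = t) \<and> r - l < min d (min d1 d2)"
    show "integrand V W integrable_on {l..r}"
    proof (rule integrand_integrable_piece[OF _ _ chart_\<gamma>(1)])
      show "l < r" "{l..r} \<subseteq> {a..b}" using lr by auto
      show "\<gamma> s \<in> cdom ?c" if s: "s \<in> {l..r}" for s
      proof (rule d(2)[rule_format])
        show "s \<in> {a..b}" using s lr by auto
        have "l \<le> s" "s \<le> r" "r - l < d" using s lr by auto
        then show "\<bar>s - t\<bar> < d" using lr by linarith
      qed
      show "smooth_along A \<gamma> {l..r} V" by (rule d1(2)[rule_format]) (use lr in simp)
      show "smooth_along A \<gamma> {l..r} W" by (rule d2(2)[rule_format]) (use lr in simp)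
    qed
  qed
qed

lemma integrand_integrable:
  assumes V: "V \<in> pwfields" and W: "W \<in> pwfields"
  shows "integrand V W integrable_on {a..b}"
proof -
  define Q where "Q l r \<longleftrightarrow> (a \<le> l \<longrightarrow> r \<le> b \<longrightarrow> integrand V W integrable_on {l..r})" for l r
  have combine: "Q x z" if "Q x y" "Q y z" "x \<le> y" "y \<le> z" for x y z
    unfolding Q_def
  proof (intro impI)
    assume "a \<le> x" "z \<le> b"
    then have "integrand V W integrable_on {x..y}" "integrand V W integrable_on {y..z}"
      using that by (simp_all add: Q_def)
    with that(3,4) show "integrand V W integrable_on {x..z}"
      by (rule Henstock_Kurzweil_Integration.integrable_combine)
  qed
  have triv: "Q t t" for t using integrable_on_refl[of "integrand V W" t] by (simp add: Q_def)
  have local: "\<exists>d>0. \<forall>l r. l \<le> t \<and> t \<le> r \<and> r - l < d \<longrightarrow> Q l r" if t: "a \<le> t" "t \<le> b" for t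
  proof -
    have tI: "t \<in> {a..b}" using t by simp
    obtain d where d: "d > 0"
      "\<forall>l r. a \<le> l \<and> l < r \<and> r \<le> b \<and> (l = t \<or> r = t) \<and> r - l < d \<longrightarrow> integrand V W integrable_on {l..r}"
      by (rule integrand_integrable_near[OF V W tI])
    have "Q l r" if lr: "l \<le> t" "t \<le> r" "r - l < d" for l r
    proof (rule combine[OF _ _ lr(1,2)])
      show "Q l t" using d(2)[rule_format, of l t] triv lr by (cases "l = t") (auto simp: Q_def)
      show "Q t r" using d(2)[rule_format, of t r] triv lr by (cases "r = t") (auto simp: Q_def)
    qed
    then show ?thesis using d(1) by blast
  qed
  have "Q a b" by (rule Bolzano[OF less_imp_le[OF ab] combine local])
  then show ?thesis by (simp add: Q_def)
qed

lemma integral_integrand_combine: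
  assumes "U \<in> pwfields" "V \<in> pwfields" "W \<in> pwfields"
  shows "integral {a..b} (integrand (r *\<^sub>R U + V) W) = r * integral {a..b} (integrand U W) + integral {a..b} (integrand V W)"
proof -
  obtain T1 where T1: "finite T1" "\<And>t. t \<in> {a..b} - T1 \<Longrightarrow> fdiff U t" by (rule pwfields_fdiff[OF assms(1)]) blast
  obtain T2 where T2: "finite T2" "\<And>t. t \<in> {a..b} - T2 \<Longrightarrow> fdiff V t" by (rule pwfields_fdiff[OF assms(2)]) blast
  have "integral {a..b} (integrand (r *\<^sub>R U + V) W) = integral {a..b} (\<lambda>t. r * integrand U W t + integrand V W t)"
    by (rule integral_spike[of "T1 \<union> T2"]) (use T1 T2 integrand_combine in \<open>auto intro: negligible_finite\<close>)
  also have "\<dots> = r * integral {a..b} (integrand U W) + integral {a..b} (integrand V W)"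
    using integral_add[OF integrable_on_mult_right[OF integrand_integrable[OF assms(1,3)], of r] integrand_integrable[OF assms(2,3)]]
    by simp
  finally show ?thesis .
qed

lemma g_continuous:
  assumes V: "continuous_along A \<gamma> {a..b} V" and W: "continuous_along A \<gamma> {a..b} W"
  shows "continuous_on {a..b} (\<lambda>t. g (\<gamma> t) (V t) (W t))"
  unfolding continuous_on_eq_continuous_within
proof
  fix t assume t: "t \<in> {a..b}"
  let ?c = "chart_at A (\<gamma> t)"
  note c = chart_\<gamma>(1)[of t] and cM = chart_\<gamma>(2)[of t]
  let ?S = "over (cdom ?c)"
  have fat: "fat ?S" using cM by (intro fat_over) simp
  have "continuous_on ?S (\<lambda>t. Gm ?c (\<gamma> t) (vc ?c V t) (vc ?c W t))"
    by (rule Gm_curve_continuous[OF c fat order_refl]) (use V W c in \<open>auto simp: continuous_along_def\<close>)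
  then have "continuous_on ?S (\<lambda>t. g (\<gamma> t) (V t) (W t))"
    by (rule continuous_on_cong[THEN iffD1, rotated 2]) (auto simp: Gm_coord[OF cM])
  then have "continuous (at t within ?S) (\<lambda>t. g (\<gamma> t) (V t) (W t))"
    using t chart_\<gamma>(3)[of t] by (simp add: continuous_on_eq_continuous_within)
  then show "continuous (at t within {a..b}) (\<lambda>t. g (\<gamma> t) (V t) (W t))"
    unfolding at_within_over[OF open_cdom[OF cM] t chart_\<gamma>(3)] .
qed

lemma smooth_along_continuous: "smooth_along A \<gamma> {a..b} V \<Longrightarrow> continuous_along A \<gamma> {a..b} V"
  unfolding smooth_along_def continuous_along_def using smooth_on_continuous by blast

lemma smooth_fields_pwfields:
  assumes "J \<in> smooth_fields A a b \<gamma>"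
  shows "J \<in> pwfields"
proof -
  have J: "smooth_along A \<gamma> {a..b} J" "\<forall>t. t \<notin> {a..b} \<longrightarrow> J t = 0" using assms by (auto simp: smooth_fields_def)
  have "\<exists>T. finite T \<and> {a, b} \<subseteq> T \<and> T \<subseteq> {a..b} \<and>
      (\<forall>s\<in>T. \<forall>u\<in>T. s < u \<and> T \<inter> {s<..<u} = {} \<longrightarrow> smooth_along A \<gamma> {s..u} J)"
    by (rule exI[of _ "{a, b}"]) (use J ab in auto)
  then show ?thesis
    unfolding pwfields_def piecewise_smooth_fields_def using J smooth_along_continuous[OF J(1)] by blast
qed

lemma jacobi_smooth:
  assumes "J \<in> jacobi_fields A D a b \<gamma>"
  shows "smooth_along A \<gamma> {a..b} J" "J \<in> pwfields" "t \<in> {a..b} \<Longrightarrow> cov (cov J) t = curv_op J t"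
  using assms smooth_fields_pwfields by (auto simp: jacobi_fields_def smooth_fields_def)

lemma integral_integrand_jacobi:
  assumes J: "J \<in> jacobi_fields A D a b \<gamma>" and W: "W \<in> pwfields"
  shows "integral {a..b} (integrand J W) = g (\<gamma> b) (cov J b) (W b) - g (\<gamma> a) (cov J a) (W a)"
proof -
  obtain T where T: "finite T" "\<And>t. t \<in> {a..b} - T \<Longrightarrow> fdiff W t" by (rule pwfields_fdiff[OF W]) blast
  note Js = jacobi_smooth[OF J]
  have "(integrand J W has_integral g (\<gamma> b) (cov J b) (W b) - g (\<gamma> a) (cov J a) (W a)) {a..b}"
  proof (rule fundamental_theorem_of_calculus_interior_strong[OF T(1)])
    show "a \<le> b" using ab by simp
    show "continuous_on {a..b} (\<lambda>t. g (\<gamma> t) (cov J t) (W t))"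
      by (rule g_continuous[OF smooth_along_continuous[OF smooth_cov[OF Js(1)]]])
         (use W in \<open>simp add: pwfields_def piecewise_smooth_fields_def\<close>)
    fix t assume t: "t \<in> {a<..<b} - T"
    have tI: "t \<in> {a..b}" using t by auto
    have "fdiff (cov J) t" by (rule smooth_along_fdiff[OF smooth_cov[OF Js(1)] tI])
    moreover have "fdiff W t" using T(2) t by auto
    ultimately have "((\<lambda>s. g (\<gamma> s) (cov J s) (W s)) has_vector_derivative
        g (\<gamma> t) (cov (cov J) t) (W t) + g (\<gamma> t) (cov J t) (cov W t)) (at t within {a..b})"
      by (rule g_has_derivative[OF tI])
    moreover have "at t within {a..b} = at t" by (rule at_within_interior) (use t in auto)
    ultimately show "((\<lambda>s. g (\<gamma> s) (cov J s) (W s)) has_vector_derivative integrand J W t) (at t)"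
      by (simp add: Js(3)[OF tI] integrand_def add.commute)
  qed
  then show ?thesis by (rule integral_unique)
qed

lemma jacobi_orthogonal:
  assumes J: "J \<in> jacobi_fields A D a b \<gamma>"
    and ends: "g (\<gamma> a) (J a) (vel a) = 0" "g (\<gamma> b) (J b) (vel b) = 0" and t: "t \<in> {a..b}"
  shows "g (\<gamma> t) (J t) (vel t) = 0"
proof -
  note Js = jacobi_smooth[OF J]
  have vel0: "cov vel t = 0" if "t \<in> {a..b}" for t using geod that by (simp add: geodesic_def)
  have g0: "g p v 0 = 0" for p v by (rule linear_0[OF g_linear2])
  define f f' where "f s = g (\<gamma> s) (J s) (vel s)" and "f' s = g (\<gamma> s) (cov J s) (vel s)" for s
  have f: "(f has_vector_derivative f' s) (at s within {a..b})" if s: "s \<in> {a..b}" for s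
    using g_has_derivative[OF s smooth_along_fdiff[OF Js(1) s] smooth_along_fdiff[OF smooth_velocity s]]
    by (simp add: f_def[abs_def] f'_def vel0[OF s] g0)
  have f': "(f' has_vector_derivative 0) (at s within {a..b})" if s: "s \<in> {a..b}" for s
    using g_has_derivative[OF s smooth_along_fdiff[OF smooth_cov[OF Js(1)] s] smooth_along_fdiff[OF smooth_velocity s]]
    by (simp add: f'_def[abs_def] vel0[OF s] g0 Js(3)[OF s] curvature_skew_zero)
  have const: "h s = h a" if h0: "\<And>s. s \<in> {a..b} \<Longrightarrow> (h has_vector_derivative 0) (at s within {a..b})"
    and s: "s \<in> {a..b}" for h :: "real \<Rightarrow> real" and s
  proof -
    obtain c where "\<And>x. x \<in> {a..b} \<Longrightarrow> h x = c"
      by (rule has_vector_derivative_zero_constant[of "{a..b}" h]) (use h0 in auto)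
    then show ?thesis using s ab by auto
  qed
  have f'c: "f' s = f' a" if "s \<in> {a..b}" for s by (rule const[OF f' that])
  define h where "h s = f s - f' a * s" for s
  have "(h has_vector_derivative 0) (at s within {a..b})" if s: "s \<in> {a..b}" for s
    unfolding h_def using f[OF s] f'c[OF s] by (auto intro!: derivative_eq_intros)
  then have hc: "h s = h a" if "s \<in> {a..b}" for s using const that by blast
  have "h b = h a" using ab by (intro hc) simp
  then have "f' a * (b - a) = 0" using ends by (simp add: h_def f_def algebra_simps)
  then have "f' a = 0" using ab by simp
  then have "f t = f a" using hc[OF t] by (simp add: h_def)
  then show ?thesis using ends by (simp add: f_def)
qed

section \<open>The index theorem\<close>

lemma cov_cong:
  assumes eq: "\<And>s. s \<in> {a..b} \<Longrightarrow> V s = W s" and t: "t \<in> {a..b}"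
  shows "cov V t = cov W t"
proof -
  have "(vc c V has_vector_derivative v) (at t within {a..b}) \<longleftrightarrow> (vc c W has_vector_derivative v) (at t within {a..b})" for c v
    unfolding has_vector_derivative_def
    using has_derivative_transform[OF t, of "vc c W" "vc c V"] has_derivative_transform[OF t, of "vc c V" "vc c W"] eq
    by auto
  then show ?thesis unfolding covd_def vector_derivative_def eq[OF t] by simp
qed

lemma smooth_along_combine:
  assumes "smooth_along A \<gamma> {a..b} V" "smooth_along A \<gamma> {a..b} W"
  shows "smooth_along A \<gamma> {a..b} (r *\<^sub>R V + W)"
  unfolding smooth_along_def
proof
  fix c assume c: "c \<in> A"
  have cM: "c \<in> M" by (rule atlas_maximal[OF c])
  have "smooth_on (over (cdom c)) (\<lambda>t. r *\<^sub>R vc c V t + vc c W t)"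
    using assms c cM by (intro smooth_on_add smooth_on_scaleR smooth_on_const fat_over) (auto simp: smooth_along_def)
  then show "smooth_on (over (cdom c)) (vc c (r *\<^sub>R V + W))"
    by (rule smooth_on_cong[THEN iffD1, rotated])
       (simp add: scaleR_fun_def linear_add[OF coord_linear[OF cM]] linear_scale[OF coord_linear[OF cM]])
qed

lemma curvature_linear: "linear (\<lambda>y. curvature A D p x y z)"
  unfolding curvature_chart_at by (rule Rc_linear2[OF chart_at(3,2)])

lemma jacobi_combine:
  assumes J: "J1 \<in> jacobi_fields A D a b \<gamma>" "J2 \<in> jacobi_fields A D a b \<gamma>"
  shows "r *\<^sub>R J1 + J2 \<in> jacobi_fields A D a b \<gamma>"
proof -
  let ?J = "r *\<^sub>R J1 + J2"
  note s = jacobi_smooth(1)[OF J(1)] jacobi_smooth(1)[OF J(2)]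
  have app: "(r *\<^sub>R V + W) t = r *\<^sub>R V t + W t" for V W :: "real \<Rightarrow> 'e" and t by (simp add: scaleR_fun_def)
  have 1: "cov ?J t = (r *\<^sub>R cov J1 + cov J2) t" if "t \<in> {a..b}" for t
    using cov_combine[OF that smooth_along_fdiff[OF s(1) that] smooth_along_fdiff[OF s(2) that], of r]
    by (simp add: scaleR_fun_def)
  have "cov (cov ?J) t = curv_op ?J t" if t: "t \<in> {a..b}" for t
  proof -
    have "cov (cov ?J) t = cov (r *\<^sub>R cov J1 + cov J2) t" by (rule cov_cong[OF 1 t])
    also have "\<dots> = r *\<^sub>R cov (cov J1) t + cov (cov J2) t"
      by (rule cov_combine[OF t smooth_along_fdiff[OF smooth_cov[OF s(1)] t] smooth_along_fdiff[OF smooth_cov[OF s(2)] t]])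
    also have "\<dots> = curv_op ?J t"
      unfolding app jacobi_smooth(3)[OF J(1) t] jacobi_smooth(3)[OF J(2) t]
        linear_add[OF curvature_linear] linear_scale[OF curvature_linear] ..
    finally show ?thesis .
  qed
  then show ?thesis
    using J smooth_along_combine[OF s, of r] by (simp add: jacobi_fields_def smooth_fields_def scaleR_fun_def)
qed

lemma index_form_P_integrand:
  "index_form_P A g D a b \<gamma> P V W = integral {a..b} (integrand V W) - second_ff A g D P (\<gamma> a) (vel a) (V a) (W a)"
  unfolding index_form_P_def integrand_def[abs_def] ..

end

locale geodesic_between_submanifolds = geodesic_curve A g D a b \<gamma>
  for A :: "('m::{t2_space,second_countable_topology}, 'e::euclidean_space) chart set" and g D a b \<gamma> +
  fixes P Q :: "'m set" and \<V> :: "(real \<Rightarrow> 'e) set"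
  assumes P: "submanifold A P" "\<gamma> a \<in> P" "\<forall>w\<in>tangent_space A P (\<gamma> a). g (\<gamma> a) (vel a) w = 0"
    and Q: "submanifold A Q" "\<gamma> b \<in> Q" "\<forall>w\<in>tangent_space A Q (\<gamma> b). g (\<gamma> b) (vel b) w = 0"
    and TQ: "tangent_space A Q (\<gamma> b) \<subseteq> {J b |J. J \<in> P_jacobi_fields A g D a b \<gamma> P}"
    and V_subspace: "subspace \<V>"
    and V_sub: "\<V> \<subseteq> H_PQ A g a b \<gamma> P Q"
    and JQ_sub: "J_Q A g D a b \<gamma> P Q \<subseteq> \<V>"
begin

abbreviation "IPQ \<equiv> index_form_PQ A g D a b \<gamma> P Q"
abbreviation "SP \<equiv> second_ff A g D P (\<gamma> a) (vel a)"
abbreviation "SQ \<equiv> second_ff A g D Q (\<gamma> b) (vel b)"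
abbreviation "TP \<equiv> tangent_space A P (\<gamma> a)"
abbreviation "JQ \<equiv> J_Q A g D a b \<gamma> P Q"

lemma V_mem:
  assumes "V \<in> \<V>"
  shows "V \<in> pwfields" "V a \<in> TP" "V b \<in> tangent_space A Q (\<gamma> b)"
  using assms V_sub by (auto simp: H_PQ_def pwfields_def)

lemmas SP = second_ff_sym_bilinear[OF P]
lemmas SQ = second_ff_sym_bilinear[OF Q]

lemma IPQ_eq: "IPQ V W = integral {a..b} (integrand V W) - SP (V a) (W a) + SQ (V b) (W b)"
  unfolding index_form_PQ_def index_form_P_integrand ..

lemma IPQ_sym_bilinear: "sym_bilinear_on IPQ \<V>"
proof
  show "subspace \<V>" by (rule V_subspace)
  fix V W assume V: "V \<in> \<V>" and W: "W \<in> \<V>"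
  have "integrand V W = integrand W V" by (rule ext) (rule integrand_sym)
  then show "IPQ V W = IPQ W V"
    unfolding IPQ_eq using SP(1)[OF V_mem(2)[OF V] V_mem(2)[OF V] V_mem(2)[OF W]] SQ(1)[OF V_mem(3)[OF V] V_mem(3)[OF V] V_mem(3)[OF W]] by simp
  fix U r assume U: "U \<in> \<V>"
  have app: "(r *\<^sub>R U + V) t = r *\<^sub>R U t + V t" for t by (simp add: scaleR_fun_def)
  show "IPQ (r *\<^sub>R U + V) W = r * IPQ U W + IPQ V W"
    unfolding IPQ_eq app integral_integrand_combine[OF V_mem(1)[OF U] V_mem(1)[OF V] V_mem(1)[OF W]]
      SP(2)[OF V_mem(2)[OF U] V_mem(2)[OF V] V_mem(2)[OF W]] SQ(2)[OF V_mem(3)[OF U] V_mem(3)[OF V] V_mem(3)[OF W]]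
    by (simp add: algebra_simps)
qed

lemma P_jacobi_IP:
  assumes J: "J \<in> P_jacobi_fields A g D a b \<gamma> P" and W: "W \<in> pwfields" "W a \<in> TP"
  shows "integral {a..b} (integrand J W) - SP (J a) (W a) = g (\<gamma> b) (cov J b) (W b)"
proof -
  have "J \<in> jacobi_fields A D a b \<gamma>" "g (\<gamma> a) (cov J a) (W a) + SP (J a) (W a) = 0"
    using J W(2) by (auto simp: P_jacobi_fields_def)
  then show ?thesis using integral_integrand_jacobi[OF _ W(1), of J] by simp
qed

lemma form_A_eq:
  assumes "J1 \<in> JQ" "J2 \<in> JQ"
  shows "form_A A g D a b \<gamma> Q J1 J2 = IPQ J1 J2"
proof -
  have J2: "J2 \<in> \<V>" and J1: "J1 \<in> P_jacobi_fields A g D a b \<gamma> P"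
    using assms JQ_sub by (auto simp: J_Q_def)
  show ?thesis
    unfolding form_A_def IPQ_eq P_jacobi_IP[OF J1 V_mem(1)[OF J2] V_mem(2)[OF J2]] by simp
qed

lemma SQ_zero:
  assumes "v \<in> tangent_space A Q (\<gamma> b)"
  shows "SQ v 0 = 0"
proof -
  have "0 \<in> tangent_space A Q (\<gamma> b)" by (rule subspace_0[OF tangent_space_subspace[OF Q(1,2)]])
  then show ?thesis using SQ(1)[of v v 0] SQ(2)[of 0 0 v 1] assms by simp
qed

lemma H_P_Int: "H_P A g a b \<gamma> P \<inter> \<V> = {V \<in> \<V>. V b = 0}"
  using V_sub by (auto simp: H_P_def H_PQ_def H_tilde_def)

lemma ex_P_jacobi_part:
  assumes V: "V \<in> \<V>"
  shows "\<exists>J\<in>JQ. J b = V b"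
proof -
  obtain J where J: "J \<in> P_jacobi_fields A g D a b \<gamma> P" "J b = V b"
    using TQ V_mem(3)[OF V] by force
  have Jac: "J \<in> jacobi_fields A D a b \<gamma>" and T: "J a \<in> TP" using J by (auto simp: P_jacobi_fields_def)
  have Jb: "J b \<in> tangent_space A Q (\<gamma> b)" using V_mem(3)[OF V] J(2) by simp
  have "g (\<gamma> t) (J t) (vel t) = 0" if "t \<in> {a..b}" for t
    by (rule jacobi_orthogonal[OF Jac _ _ that]) (use P(3) Q(3) T Jb g_sym in metis)+
  then have "J \<in> H_PQ A g a b \<gamma> P Q"
    using jacobi_smooth(2)[OF Jac] T Jb by (simp add: H_PQ_def pwfields_def)
  then show ?thesis using J by (auto simp: J_Q_def)
qed

lemma JQ_subspace: "subspace JQ"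
proof -
  obtain J0 where J0: "J0 \<in> JQ"
    using ex_P_jacobi_part[OF subspace_0[OF V_subspace]] by blast
  show ?thesis
  proof (rule subspace_if_combine_closed[OF J0])
    fix J1 J2 r assume J: "J1 \<in> JQ" "J2 \<in> JQ"
    let ?J = "r *\<^sub>R J1 + J2"
    have Jac: "J1 \<in> jacobi_fields A D a b \<gamma>" "J2 \<in> jacobi_fields A D a b \<gamma>" and T: "J1 a \<in> TP" "J2 a \<in> TP"
      using J by (auto simp: J_Q_def P_jacobi_fields_def)
    have eq: "g (\<gamma> a) (cov J1 a) w + SP (J1 a) w = 0" "g (\<gamma> a) (cov J2 a) w + SP (J2 a) w = 0" if "w \<in> TP" for w
      using J that by (auto simp: J_Q_def P_jacobi_fields_def)
    have aI: "a \<in> {a..b}" using ab by simp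
    have app: "?J a = r *\<^sub>R J1 a + J2 a" by (simp add: scaleR_fun_def)
    have cov: "cov ?J a = r *\<^sub>R cov J1 a + cov J2 a"
      using Jac by (intro cov_combine smooth_along_fdiff jacobi_smooth(1) aI)
    have "g (\<gamma> a) (cov ?J a) w + SP (?J a) w = 0" if w: "w \<in> TP" for w
    proof -
      have "g (\<gamma> a) (cov ?J a) w + SP (?J a) w
          = r * (g (\<gamma> a) (cov J1 a) w + SP (J1 a) w) + (g (\<gamma> a) (cov J2 a) w + SP (J2 a) w)"
        unfolding cov app SP(2)[OF T w] linear_add[OF g_linear1] linear_scale[OF g_linear1] by (simp add: algebra_simps)
      then show ?thesis using eq[OF w] by simp
    qed
    moreover have "?J a \<in> TP"
      unfolding app using tangent_space_subspace[OF P(1,2)] T by (intro subspace_add subspace_scale)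
    moreover have "?J \<in> \<V>"
      using J JQ_sub V_subspace by (intro subspace_add subspace_scale) auto
    ultimately show "?J \<in> JQ"
      using jacobi_combine[OF Jac, of r] V_sub unfolding J_Q_def P_jacobi_fields_def by blast
  qed
qed

theorem index_decomposition:
  "ind IPQ \<V> = ind (index_form_P A g D a b \<gamma> P) (H_P A g a b \<gamma> P \<inter> \<V>) + ind (form_A A g D a b \<gamma> Q) JQ"
proof -
  interpret sym_bilinear_on IPQ \<V> by (rule IPQ_sym_bilinear)
  let ?K = "{V \<in> \<V>. V b = 0}"
  have "ind IPQ \<V> = ind IPQ ?K + ind IPQ JQ"
  proof (rule ind_orthogonal_sum)
    show "subspace ?K"
      using V_subspace by (auto simp: subspace_def scaleR_fun_def)
    show "?K \<subseteq> \<V>" by auto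
    show "subspace JQ" "JQ \<subseteq> \<V>" by (rule JQ_subspace, rule JQ_sub)
    show "\<exists>x\<in>?K. \<exists>y\<in>JQ. V = x + y" if V: "V \<in> \<V>" for V
    proof -
      obtain J where J: "J \<in> JQ" "J b = V b" using ex_P_jacobi_part[OF V] by blast
      have "J \<in> \<V>" using J(1) JQ_sub by auto
      then have "V - J \<in> \<V>" using V V_subspace by (intro subspace_diff)
      then have "V - J \<in> ?K" using J(2) by simp
      moreover have "V = (V - J) + J" by simp
      ultimately show ?thesis using J(1) by blast
    qed
    fix W J assume W: "W \<in> ?K" and J: "J \<in> JQ"
    have WV: "W \<in> \<V>" "W b = 0" using W by auto
    have JV: "J \<in> \<V>" using J JQ_sub by auto
    have "IPQ W J = IPQ J W" by (rule sym[OF WV(1) JV])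
    also have "\<dots> = g (\<gamma> b) (cov J b) 0 + SQ (J b) 0"
      using J P_jacobi_IP[OF _ V_mem(1)[OF WV(1)] V_mem(2)[OF WV(1)], of J] WV(2) by (simp add: IPQ_eq J_Q_def)
    also have "\<dots> = 0"
      using SQ_zero[OF V_mem(3)[OF JV]] linear_0[OF g_linear2] by simp
    finally show "IPQ W J = 0" .
  qed
  moreover have "ind IPQ ?K = ind (index_form_P A g D a b \<gamma> P) ?K"
  proof (rule ind_cong)
    fix V assume V: "V \<in> ?K"
    have "0 \<in> tangent_space A Q (\<gamma> b)" by (rule subspace_0[OF tangent_space_subspace[OF Q(1,2)]])
    then show "IPQ V V = index_form_P A g D a b \<gamma> P V V"
      using V SQ_zero[of 0] by (simp add: index_form_PQ_def)
  qed
  moreover have "ind IPQ JQ = ind (form_A A g D a b \<gamma> Q) JQ"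
    by (rule ind_cong) (simp add: form_A_eq)
  ultimately show ?thesis by (simp add: H_P_Int)
qed

end

theorem theorem2p7:
  fixes A :: "('m::{t2_space,second_countable_topology}, 'e::euclidean_space) chart set"
    and g :: "'m \<Rightarrow> 'e \<Rightarrow> 'e \<Rightarrow> real"
    and D :: "'m \<Rightarrow> 'e \<Rightarrow> ('m \<Rightarrow> 'e) \<Rightarrow> 'e"
    and P Q :: "'m set"
    and a b :: real
    and \<gamma> :: "real \<Rightarrow> 'm"
    and \<V> :: "(real \<Rightarrow> 'e) set"
  assumes "smooth_atlas A"
    and "semi_riemannian_metric A g"
    and "levi_civita A g D"
    and "submanifold A P" and "submanifold A Q"
    and "a < b"
    and "geodesic A D a b \<gamma>"
    and "\<exists>s\<in>{a..b}. \<exists>t\<in>{a..b}. \<gamma> s \<noteq> \<gamma> t"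
    and "\<gamma> a \<in> P"
    and "\<forall>w\<in>tangent_space A P (\<gamma> a). g (\<gamma> a) (velocity A {a..b} \<gamma> a) w = 0"
    and "\<gamma> b \<in> Q"
    and "\<forall>w\<in>tangent_space A Q (\<gamma> b). g (\<gamma> b) (velocity A {a..b} \<gamma> b) w = 0"
    and "tangent_space A Q (\<gamma> b) \<subseteq> {J b |J. J \<in> P_jacobi_fields A g D a b \<gamma> P}"
    and "subspace \<V>"
    and "\<V> \<subseteq> H_PQ A g a b \<gamma> P Q"
    and "J_Q A g D a b \<gamma> P Q \<subseteq> \<V>"
  shows "ind (index_form_PQ A g D a b \<gamma> P Q) \<V> =
      ind (index_form_P A g D a b \<gamma> P) (H_P A g a b \<gamma> P \<inter> \<V>)
      + ind (form_A A g D a b \<gamma> Q) (J_Q A g D a b \<gamma> P Q)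
    \<and> (\<forall>J1\<in>J_Q A g D a b \<gamma> P Q. \<forall>J2\<in>J_Q A g D a b \<gamma> P Q.
         form_A A g D a b \<gamma> Q J1 J2 = index_form_PQ A g D a b \<gamma> P Q J1 J2)"
proof -
  interpret geodesic_between_submanifolds A g D a b \<gamma> P Q \<V>
    by unfold_locales (use assms in auto)
  show ?thesis using index_decomposition form_A_eq by blast
qed

end
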